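(* Let $H := \{(a,b)\in \mathbb{N}_0^2 \mid 0\le b/a<\infty\}\cup\{(0,0)\}$ and let $k$ be a field. Then the following statements are true. (i) $k[H]$ is not Cohen-Macaulay in the sense of ideals. (ii) $k[H]$ is not weak Bourbaki unmixed. (iii) $k[H]$ is Cohen-Macaulay in the sense of Hamilton-Marley.
   Context: All rings are commutative, not necessarily Noetherian. $\mathbb{N}_0$ is the set of non-negative integers. In the definition of $H$, the condition $0\le b/a<\infty$ means in particular $a\neq 0$; thus $H=\{(a,b)\in\mathbb{N}_0^2 \mid a\ge 1\}\cup\{(0,0)\}$, a normal submonoid of $\mathbb{Z}^2$ (normal: whenever $c,c'\in H$ and $m(c-c')\in H$ for some positive integer $m$, then $c-c'\in H$). $k[H]$ is the monoid ring: the $k$-vector space with basis $\{X^c : c\in H\}$ and multiplication $X^cX^{c'}=X^{c+c'}$. Writing $x^ay^b$ for $X^{(a,b)}$, one has $k[H]=k+xk[x,y]\subseteq k[x,y]$. Polynomial grade. Let $R$ be a ring, $M$ an $R$-module. A sequence $x_1,\dots,x_\ell$ in $R$ is a weak regular sequence on $M$ if each $x_i$ is a nonzero-divisor on $M/(x_1,\dots,x_{i-1})M$. The classical grade $\operatorname{c.grade}_R(\mathfrak{a},M)$ of an ideal $\mathfrak{a}$ on $M$ is the supremum of the lengths of all weak regular sequences on $M$ contained in $\mathfrak{a}$. The polynomial grade is $$\operatorname{p.grade}_R(\mathfrak{a},M):=\lim_{m\to\infty}\operatorname{c.grade}_{R[t_1,\dots,t_m]}\bigl(\mathfrak{a}R[t_1,\dots,t_m],\,R[t_1,\dots,t_m]\otimes_R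 M\bigr).$$ A ring $A$ is Cohen-Macaulay in the sense of ideals if $\operatorname{ht}(\mathfrak{a})=\operatorname{p.grade}_A(\mathfrak{a},A)$ for every ideal $\mathfrak{a}$ of $A$ (the height of the unit ideal being $\infty$). Weak Bourbaki unmixed. A prime $\mathfrak{p}$ is weakly associated to an $A$-module $M$ if $\mathfrak{p}$ is minimal over $(0:_A m)$ for some $m\in M$; the set of these primes is $\operatorname{wAss}_A M$. Let $\mu(\mathfrak{a})$ denote the minimal number of generators of $\mathfrak{a}$ and $\min(\mathfrak{a})$ the set of primes minimal over $\mathfrak{a}$. A ring $A$ is weak Bourbaki unmixed if for every finitely generated ideal $\mathfrak{a}$ of $A$ with $\operatorname{ht}\mathfrak{a}\ge\mu(\mathfrak{a})$, every $\mathfrak{p}\in\operatorname{wAss}_A(A/\mathfrak{a})$ belongs to $\min(\mathfrak{a})$. Cohen-Macaulay in the sense of Hamilton-Marley. For a finite sequence $\underline{x}=x_1,\dots,x_\ell$ in a ring $R$, let $\mathbb{K}_\bullet(\underline{x})$ be the Koszul complex of $R$ with respect to $\underline{x}$, let $\underline{x}^m=x_1^m,\dots,x_\ell^m$, and let $H^i_{\underline{x}}(-)$ be the $i$-th Čech cohomology with respect to $\underline{x}$. For $m\ge n$ there is a chain map $\varphi^m_n(\underline{x}):\mathbb{K}_\bullet(\underline{x}^m)\to\mathbb{K}_\bullet(\underline{x}^n)$ induced by multiplication by $(\prod x_i)^{m-n}$ (that is, the tensor product of the maps of complexes $\mathbb{K}_\bullet(x_i^m)\to\mathbb{K}_\bullet(x_i^n)$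 which are multiplication by $x_i^{m-n}$ in degree 1 and the identity in degree 0). The sequence $\underline{x}$ is weakly proregular if for each $n>0$ there is $m\ge n$ such that $H_i(\varphi^m_n(\underline{x}))=0$ for all $i\ge1$. It is a parameter sequence on $R$ if (1) $\underline{x}$ is weakly proregular, (2) $(\underline{x})R\ne R$, and (3) $H^\ell_{\underline{x}}(R)_{\mathfrak{p}}\ne0$ for every prime $\mathfrak{p}\supseteq\underline{x}R$. It is a strong parameter sequence on $R$ if $x_1,\dots,x_i$ is a parameter sequence on $R$ for all $1\le i\le\ell$. $R$ is Cohen-Macaulay in the sense of Hamilton-Marley if every strong parameter sequence on $R$ is a regular sequence on $R$. *)

theory Defs
  imports
    "HOL-Algebra.Algebra"
    "HOL-Algebra.Indexed_Polynomials"
    "HOL-Library.Poly_Mapping"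
    "HOL-Library.Product_Plus"
    "HOL-Library.Extended_Real"
    "HOL-Library.Ramsey"
begin

section \<open>Modules\<close>

text \<open>
  HOL-Algebra module records extend ring records, so they carry the fields \<open>mult\<close> and \<open>one\<close>,
  which are irrelevant for the module structure; they are undefined except in \<open>self_module\<close>.
\<close>

definition self_module :: "('a, 'm) ring_scheme \<Rightarrow> ('a, 'a) module"
  where "self_module R =
    \<lparr>carrier = carrier R, monoid.mult = monoid.mult R, one = one R,
     ring.zero = ring.zero R, ring.add = ring.add R, smult = monoid.mult R\<rparr>"

definition quotient_module :: "('a, 'b) module \<Rightarrow> 'b set \<Rightarrow> ('a, 'b set) module"
  where "quotient_module M N =
    \<lparr>carrier = a_rcosets\<^bsub>M\<^esub> N, monoid.mult = undefined, one = undefined,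
     ring.zero = N, ring.add = set_add M,
     smult = (\<lambda>a C. \<Union>x\<in>C. N +>\<^bsub>M\<^esub> (a \<odot>\<^bsub>M\<^esub> x))\<rparr>"

definition prod_module :: "'i set \<Rightarrow> ('i \<Rightarrow> ('a, 'b) module) \<Rightarrow> ('a, 'i \<Rightarrow> 'b) module"
  where "prod_module I M =
    \<lparr>carrier = (\<Pi>\<^sub>E i\<in>I. carrier (M i)), monoid.mult = undefined, one = undefined,
     ring.zero = (\<lambda>i\<in>I. \<zero>\<^bsub>M i\<^esub>), ring.add = (\<lambda>f g. \<lambda>i\<in>I. f i \<oplus>\<^bsub>M i\<^esub> g i),
     smult = (\<lambda>a f. \<lambda>i\<in>I. a \<odot>\<^bsub>M i\<^esub> f i)\<rparr>"

definition is_zero_module :: "('a, 'b) module \<Rightarrow> bool"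
  where "is_zero_module M \<longleftrightarrow> carrier M = {\<zero>\<^bsub>M\<^esub>}"

definition kernel_on :: "('a, 'b) module \<Rightarrow> ('a, 'c) module \<Rightarrow> ('b \<Rightarrow> 'c) \<Rightarrow> 'b set"
  where "kernel_on M N h = {x \<in> carrier M. h x = \<zero>\<^bsub>N\<^esub>}"

text \<open>\<open>Z / B\<close> for submodules \<open>B \<subseteq> Z\<close> of \<open>M\<close>.\<close>

definition subquotient :: "('a, 'b) module \<Rightarrow> 'b set \<Rightarrow> 'b set \<Rightarrow> ('a, 'b set) module"
  where "subquotient M Z B = quotient_module (M\<lparr>carrier := Z\<rparr>) B"

text \<open>The submodule \<open>\<aa>M\<close> of \<open>M\<close>.\<close>

definition ideal_smult :: "('a, 'm) ring_scheme \<Rightarrow> 'a set \<Rightarrow> ('a, 'b) module \<Rightarrow> 'b set"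
  where "ideal_smult R I M =
    \<Inter>{N. submodule N R M \<and> (\<forall>a\<in>I. \<forall>x\<in>carrier M. a \<odot>\<^bsub>M\<^esub> x \<in> N)}"

definition annihilator :: "('a, 'm) ring_scheme \<Rightarrow> ('a, 'b) module \<Rightarrow> 'b \<Rightarrow> 'a set"
  where "annihilator R M x = {a \<in> carrier R. a \<odot>\<^bsub>M\<^esub> x = \<zero>\<^bsub>M\<^esub>}"


section \<open>Localization\<close>

definition loc_rel ::
    "('a, 'm) ring_scheme \<Rightarrow> ('a, 'b) module \<Rightarrow> 'a set \<Rightarrow> (('b \<times> 'a) \<times> ('b \<times> 'a)) set"
  where "loc_rel R M S =
    {((x, s), (y, t)). x \<in> carrier M \<and> y \<in> carrier M \<and> s \<in> S \<and> t \<in> S \<and>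
       (\<exists>u\<in>S. u \<odot>\<^bsub>M\<^esub> (t \<odot>\<^bsub>M\<^esub> x) = u \<odot>\<^bsub>M\<^esub> (s \<odot>\<^bsub>M\<^esub> y))}"

text \<open>\<open>S\<^sup>-\<^sup>1M\<close> as an \<open>R\<close>-module; the class of \<open>(x, s)\<close> is the fraction \<open>x/s\<close>.\<close>

definition localization ::
    "('a, 'm) ring_scheme \<Rightarrow> ('a, 'b) module \<Rightarrow> 'a set \<Rightarrow> ('a, ('b \<times> 'a) set) module"
  where "localization R M S =
    \<lparr>carrier = (carrier M \<times> S) // loc_rel R M S, monoid.mult = undefined, one = undefined,
     ring.zero = loc_rel R M S `` {(\<zero>\<^bsub>M\<^esub>, \<one>\<^bsub>R\<^esub>)},
     ring.add = (\<lambda>A B. \<Union>(x, s)\<in>A. \<Union>(y, t)\<in>B.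
              loc_rel R M S `` {(t \<odot>\<^bsub>M\<^esub> x \<oplus>\<^bsub>M\<^esub> s \<odot>\<^bsub>M\<^esub> y, s \<otimes>\<^bsub>R\<^esub> t)}),
     smult = (\<lambda>a A. \<Union>(x, s)\<in>A. loc_rel R M S `` {(a \<odot>\<^bsub>M\<^esub> x, s)})\<rparr>"

definition powers :: "('a, 'm) ring_scheme \<Rightarrow> 'a \<Rightarrow> 'a set"
  where "powers R y = {y [^]\<^bsub>R\<^esub> n | n::nat. True}"

definition localization_at_prime ::
    "('a, 'm) ring_scheme \<Rightarrow> ('a, 'b) module \<Rightarrow> 'a set \<Rightarrow> ('a, ('b \<times> 'a) set) module"
  where "localization_at_prime R M p = localization R M (carrier R - p)"

text \<open>The canonical map \<open>M\<^sub>y \<rightarrow> M\<^sub>y\<^sub>z\<close>, given on fractions by \<open>x/y\<^sup>n \<mapsto> z\<^sup>nx/(yz)\<^sup>n\<close>.\<close>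

definition loc_map ::
    "('a, 'm) ring_scheme \<Rightarrow> ('a, 'b) module \<Rightarrow> 'a \<Rightarrow> 'a \<Rightarrow> ('b \<times> 'a) set \<Rightarrow> ('b \<times> 'a) set"
  where "loc_map R M y z A =
    (\<Union>(x, n)\<in>{(x, n::nat). (x, y [^]\<^bsub>R\<^esub> n) \<in> A}.
       loc_rel R M (powers R (y \<otimes>\<^bsub>R\<^esub> z)) ``
         {((z [^]\<^bsub>R\<^esub> n) \<odot>\<^bsub>M\<^esub> x, (y \<otimes>\<^bsub>R\<^esub> z) [^]\<^bsub>R\<^esub> n)})"


section \<open>Prime ideals and height\<close>

definition minimal_primes :: "('a, 'm) ring_scheme \<Rightarrow> 'a set \<Rightarrow> 'a set set"
  where "minimal_primes R I =
    {p. primeideal p R \<and> I \<subseteq> p \<and> (\<forall>q. primeideal q R \<and> I \<subseteq> q \<and> q \<subseteq> p \<longrightarrow> q = p)}"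

definition prime_height :: "('a, 'm) ring_scheme \<Rightarrow> 'a set \<Rightarrow> enat"
  where "prime_height R p =
    (SUP n\<in>{n. \<exists>c :: nat \<Rightarrow> 'a set. (\<forall>i\<le>n. primeideal (c i) R) \<and>
                 (\<forall>i<n. c i \<subset> c (Suc i)) \<and> c n = p}. enat n)"

text \<open>The infimum over the empty set is \<open>\<infinity>\<close>, which is the height of the unit ideal.\<close>

definition height :: "('a, 'm) ring_scheme \<Rightarrow> 'a set \<Rightarrow> enat"
  where "height R I = (INF p\<in>{p. primeideal p R \<and> I \<subseteq> p}. prime_height R p)"


section \<open>Regular sequences and grade\<close>

definition nonzerodivisor_on :: "('a, 'b) module \<Rightarrow> 'a \<Rightarrow> bool"
  where "nonzerodivisor_on M a \<longleftrightarrow> (\<forall>x\<in>carrier M. a \<odot>\<^bsub>M\<^esub> x = \<zero>\<^bsub>M\<^esub> \<longrightarrow> x = \<zero>\<^bsub>M\<^esub>)"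

definition weak_regular_seq :: "('a, 'm) ring_scheme \<Rightarrow> ('a, 'b) module \<Rightarrow> 'a list \<Rightarrow> bool"
  where "weak_regular_seq R M xs \<longleftrightarrow> set xs \<subseteq> carrier R \<and>
    (\<forall>i<length xs. nonzerodivisor_on
       (quotient_module M (ideal_smult R (Idl\<^bsub>R\<^esub> (set (take i xs))) M)) (xs ! i))"

definition regular_seq :: "('a, 'm) ring_scheme \<Rightarrow> ('a, 'b) module \<Rightarrow> 'a list \<Rightarrow> bool"
  where "regular_seq R M xs \<longleftrightarrow> weak_regular_seq R M xs \<and>
    ideal_smult R (Idl\<^bsub>R\<^esub> (set xs)) M \<noteq> carrier M"

definition classical_grade :: "('a, 'm) ring_scheme \<Rightarrow> 'a set \<Rightarrow> ('a, 'b) module \<Rightarrow> enat"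
  where "classical_grade R I M =
    (SUP xs\<in>{xs. set xs \<subseteq> I \<and> weak_regular_seq R M xs}. enat (length xs))"

text \<open>
  \<open>R[t\<^sub>1, \<dots>, t\<^sub>m]\<close>, with the variables indexed by \<open>0, \<dots>, m - 1\<close>. The library supplies the underlying
  set and the addition of indexed polynomials; the multiplication is the convolution over all
  factorizations of a monomial.
\<close>

definition mpoly_ring :: "('a, 'm) ring_scheme \<Rightarrow> nat \<Rightarrow> (nat multiset \<Rightarrow> 'a) ring"
  where "mpoly_ring R m =
    \<lparr>carrier = ring.indexed_pset R {..<m} (carrier R),
     monoid.mult = (\<lambda>P Q e. finsum R (\<lambda>d. P d \<otimes>\<^bsub>R\<^esub> Q (e - d)) {d. d \<subseteq># e}),
     one = ring.indexed_const R \<one>\<^bsub>R\<^esub>, ring.zero = ring.indexed_const R \<zero>\<^bsub>R\<^esub>,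
     ring.add = ring.indexed_padd R\<rparr>"

definition mpoly_ideal :: "('a, 'm) ring_scheme \<Rightarrow> nat \<Rightarrow> 'a set \<Rightarrow> (nat multiset \<Rightarrow> 'a) set"
  where "mpoly_ideal R m I = Idl\<^bsub>mpoly_ring R m\<^esub> (ring.indexed_const R ` I)"

text \<open>
  The polynomial grade \<open>p.grade\<^sub>R(I, R)\<close> of an ideal on the ring itself, where
  \<open>R[t\<^sub>1, \<dots>, t\<^sub>m] \<otimes>\<^sub>R R\<close> is \<open>R[t\<^sub>1, \<dots>, t\<^sub>m]\<close>.
\<close>

definition polynomial_grade :: "('a, 'm) ring_scheme \<Rightarrow> 'a set \<Rightarrow> enat"
  where "polynomial_grade R I =
    lim (\<lambda>m. classical_grade (mpoly_ring R m) (mpoly_ideal R m I) (self_module (mpoly_ring R m)))"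

definition cohen_macaulay_ideals :: "('a, 'm) ring_scheme \<Rightarrow> bool"
  where "cohen_macaulay_ideals R \<longleftrightarrow> (\<forall>I. ideal I R \<longrightarrow> height R I = polynomial_grade R I)"


section \<open>Weak Bourbaki unmixed rings\<close>

definition weakly_associated_primes :: "('a, 'm) ring_scheme \<Rightarrow> ('a, 'b) module \<Rightarrow> 'a set set"
  where "weakly_associated_primes R M = (\<Union>x\<in>carrier M. minimal_primes R (annihilator R M x))"

definition finitely_generated_ideal :: "('a, 'm) ring_scheme \<Rightarrow> 'a set \<Rightarrow> bool"
  where "finitely_generated_ideal R I \<longleftrightarrow>
    (\<exists>S. finite S \<and> S \<subseteq> carrier R \<and> I = Idl\<^bsub>R\<^esub> S)"

text \<open>Equal to \<open>\<infinity>\<close> if \<open>I\<close> is not finitely generated.\<close>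

definition min_generators :: "('a, 'm) ring_scheme \<Rightarrow> 'a set \<Rightarrow> enat"
  where "min_generators R I =
    (INF S\<in>{S. finite S \<and> S \<subseteq> carrier R \<and> I = Idl\<^bsub>R\<^esub> S}. enat (card S))"

definition weak_bourbaki_unmixed :: "('a, 'm) ring_scheme \<Rightarrow> bool"
  where "weak_bourbaki_unmixed R \<longleftrightarrow>
    (\<forall>I. ideal I R \<and> finitely_generated_ideal R I \<and> height R I \<ge> min_generators R I \<longrightarrow>
       weakly_associated_primes R (quotient_module (self_module R) I) \<subseteq> minimal_primes R I)"


section \<open>Koszul complexes\<close>

text \<open>
  For \<open>S \<subseteq> {0, \<dots>, l - 1}\<close>, \<open>e\<^sub>S\<close> is the basis element of the tensor product of the \<open>l\<close> complexes
  \<open>0 \<rightarrow> R \<rightarrow> R \<rightarrow> 0\<close> that takes the factor of degree 1 exactly at the indices in \<open>S\<close>. An element of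
  degree \<open>p\<close> is given by its coefficients at the \<open>e\<^sub>S\<close> with \<open>card S = p\<close>, and
  \<open>d(e\<^sub>S) = (\<Sum>i\<in>S. (-1)\<^bsup>k\<^esup> x\<^sub>i e\<^bsub>S - {i}\<^esub>)\<close> with \<open>k\<close> the number of elements of \<open>S\<close> below \<open>i\<close>.
\<close>

definition position_sign :: "('b, 'm) ring_scheme \<Rightarrow> nat set \<Rightarrow> nat \<Rightarrow> 'b \<Rightarrow> 'b"
  where "position_sign M S i x = (if even (card {j \<in> S. j < i}) then x else \<ominus>\<^bsub>M\<^esub> x)"

definition koszul_module ::
    "('a, 'm) ring_scheme \<Rightarrow> nat \<Rightarrow> nat \<Rightarrow> ('a, nat set \<Rightarrow> 'a) module"
  where "koszul_module R l p = prod_module ([{..<l}]\<^bsup>p\<^esup>) (\<lambda>_. self_module R)"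

text \<open>The differential from degree \<open>p + 1\<close> to degree \<open>p\<close>.\<close>

definition koszul_diff ::
    "('a, 'm) ring_scheme \<Rightarrow> 'a list \<Rightarrow> nat \<Rightarrow> (nat set \<Rightarrow> 'a) \<Rightarrow> (nat set \<Rightarrow> 'a)"
  where "koszul_diff R xs p f =
    (\<lambda>T\<in>[{..<length xs}]\<^bsup>p\<^esup>.
       finsum R (\<lambda>i. position_sign R T i (xs ! i \<otimes>\<^bsub>R\<^esub> f (insert i T))) ({..<length xs} - T))"

fun koszul_cycles :: "('a, 'm) ring_scheme \<Rightarrow> 'a list \<Rightarrow> nat \<Rightarrow> (nat set \<Rightarrow> 'a) set"
  where
    "koszul_cycles R xs 0 = carrier (koszul_module R (length xs) 0)"
  | "koszul_cycles R xs (Suc p) =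
       kernel_on (koszul_module R (length xs) (Suc p)) (koszul_module R (length xs) p)
         (koszul_diff R xs p)"

definition koszul_boundaries :: "('a, 'm) ring_scheme \<Rightarrow> 'a list \<Rightarrow> nat \<Rightarrow> (nat set \<Rightarrow> 'a) set"
  where "koszul_boundaries R xs p =
    koszul_diff R xs p ` carrier (koszul_module R (length xs) (Suc p))"

definition koszul_homology ::
    "('a, 'm) ring_scheme \<Rightarrow> 'a list \<Rightarrow> nat \<Rightarrow> ('a, (nat set \<Rightarrow> 'a) set) module"
  where "koszul_homology R xs p =
    subquotient (koszul_module R (length xs) p) (koszul_cycles R xs p) (koszul_boundaries R xs p)"

definition power_seq :: "('a, 'm) ring_scheme \<Rightarrow> 'a list \<Rightarrow> nat \<Rightarrow> 'a list"
  where "power_seq R xs m = map (\<lambda>x. x [^]\<^bsub>R\<^esub> m) xs"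

text \<open>
  The chain map from the complex of \<open>x\<^sup>m\<close> to the complex of \<open>x\<^sup>n\<close> in degree \<open>p\<close>: the tensor product
  of the maps which multiply by \<open>x\<^sub>i\<^bsup>m-n\<^esup>\<close> in degree 1 sends \<open>e\<^sub>S\<close> to \<open>(\<Prod>i\<in>S. x\<^sub>i\<^bsup>m-n\<^esup>) e\<^sub>S\<close>.
\<close>

definition koszul_power_map ::
    "('a, 'm) ring_scheme \<Rightarrow> 'a list \<Rightarrow> nat \<Rightarrow> nat \<Rightarrow> nat \<Rightarrow> (nat set \<Rightarrow> 'a) \<Rightarrow> (nat set \<Rightarrow> 'a)"
  where "koszul_power_map R xs m n p f =
    (\<lambda>S\<in>[{..<length xs}]\<^bsup>p\<^esup>. finprod R (\<lambda>i. (xs ! i) [^]\<^bsub>R\<^esub> (m - n)) S \<otimes>\<^bsub>R\<^esub> f S)"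

definition koszul_homology_map ::
    "('a, 'm) ring_scheme \<Rightarrow> 'a list \<Rightarrow> nat \<Rightarrow> nat \<Rightarrow> nat \<Rightarrow>
       (nat set \<Rightarrow> 'a) set \<Rightarrow> (nat set \<Rightarrow> 'a) set"
  where "koszul_homology_map R xs m n p C =
    (\<Union>z\<in>C. koszul_boundaries R (power_seq R xs n) p
       +>\<^bsub>koszul_module R (length xs) p\<^esub> koszul_power_map R xs m n p z)"

definition weakly_proregular :: "('a, 'm) ring_scheme \<Rightarrow> 'a list \<Rightarrow> bool"
  where "weakly_proregular R xs \<longleftrightarrow>
    (\<forall>n>0. \<exists>m\<ge>n. \<forall>i\<ge>1. \<forall>C\<in>carrier (koszul_homology R (power_seq R xs m) i).
       koszul_homology_map R xs m n i C = \<zero>\<^bsub>koszul_homology R (power_seq R xs n) i\<^esub>)"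


section \<open>Cech cohomology\<close>

text \<open>
  In degree \<open>p\<close> the Cech complex of \<open>M\<close> is the product of the localizations of \<open>M\<close> at
  \<open>\<Prod>i\<in>S. x\<^sub>i\<close>, for \<open>card S = p\<close>.
\<close>

definition subseq_prod :: "('a, 'm) ring_scheme \<Rightarrow> 'a list \<Rightarrow> nat set \<Rightarrow> 'a"
  where "subseq_prod R xs S = finprod R (\<lambda>i. xs ! i) S"

definition cech_component ::
    "('a, 'm) ring_scheme \<Rightarrow> ('a, 'b) module \<Rightarrow> 'a list \<Rightarrow> nat set \<Rightarrow> ('a, ('b \<times> 'a) set) module"
  where "cech_component R M xs S = localization R M (powers R (subseq_prod R xs S))"

definition cech_module ::
    "('a, 'm) ring_scheme \<Rightarrow> ('a, 'b) module \<Rightarrow> 'a list \<Rightarrow> nat \<Rightarrow>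
       ('a, nat set \<Rightarrow> ('b \<times> 'a) set) module"
  where "cech_module R M xs p = prod_module ([{..<length xs}]\<^bsup>p\<^esup>) (cech_component R M xs)"

text \<open>The differential from degree \<open>p\<close> to degree \<open>p + 1\<close>.\<close>

definition cech_diff ::
    "('a, 'm) ring_scheme \<Rightarrow> ('a, 'b) module \<Rightarrow> 'a list \<Rightarrow> nat \<Rightarrow>
       (nat set \<Rightarrow> ('b \<times> 'a) set) \<Rightarrow> (nat set \<Rightarrow> ('b \<times> 'a) set)"
  where "cech_diff R M xs p f =
    (\<lambda>T\<in>[{..<length xs}]\<^bsup>Suc p\<^esup>.
       finsum (cech_component R M xs T)
         (\<lambda>i. position_sign (cech_component R M xs T) T i
            (loc_map R M (subseq_prod R xs (T - {i})) (xs ! i) (f (T - {i})))) T)"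

definition cech_cocycles ::
    "('a, 'm) ring_scheme \<Rightarrow> ('a, 'b) module \<Rightarrow> 'a list \<Rightarrow> nat \<Rightarrow> (nat set \<Rightarrow> ('b \<times> 'a) set) set"
  where "cech_cocycles R M xs p =
    kernel_on (cech_module R M xs p) (cech_module R M xs (Suc p)) (cech_diff R M xs p)"

fun cech_coboundaries ::
    "('a, 'm) ring_scheme \<Rightarrow> ('a, 'b) module \<Rightarrow> 'a list \<Rightarrow> nat \<Rightarrow> (nat set \<Rightarrow> ('b \<times> 'a) set) set"
  where
    "cech_coboundaries R M xs 0 = {\<zero>\<^bsub>cech_module R M xs 0\<^esub>}"
  | "cech_coboundaries R M xs (Suc p) = cech_diff R M xs p ` carrier (cech_module R M xs p)"

definition cech_cohomology ::
    "('a, 'm) ring_scheme \<Rightarrow> 'a list \<Rightarrow> nat \<Rightarrow> ('a, 'b) module \<Rightarrow>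
       ('a, (nat set \<Rightarrow> ('b \<times> 'a) set) set) module"
  where "cech_cohomology R xs p M =
    subquotient (cech_module R M xs p) (cech_cocycles R M xs p) (cech_coboundaries R M xs p)"


section \<open>The Cohen-Macaulay property of Hamilton and Marley\<close>

definition parameter_seq :: "('a, 'm) ring_scheme \<Rightarrow> 'a list \<Rightarrow> bool"
  where "parameter_seq R xs \<longleftrightarrow> set xs \<subseteq> carrier R \<and>
    weakly_proregular R xs \<and>
    Idl\<^bsub>R\<^esub> (set xs) \<noteq> carrier R \<and>
    (\<forall>p. primeideal p R \<and> Idl\<^bsub>R\<^esub> (set xs) \<subseteq> p \<longrightarrow>
       \<not> is_zero_module
           (localization_at_prime R (cech_cohomology R xs (length xs) (self_module R)) p))"

definition strong_parameter_seq :: "('a, 'm) ring_scheme \<Rightarrow> 'a list \<Rightarrow> bool"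
  where "strong_parameter_seq R xs \<longleftrightarrow> set xs \<subseteq> carrier R \<and>
    (\<forall>i. 1 \<le> i \<and> i \<le> length xs \<longrightarrow> parameter_seq R (take i xs))"

definition cohen_macaulay_hamilton_marley :: "('a, 'm) ring_scheme \<Rightarrow> bool"
  where "cohen_macaulay_hamilton_marley R \<longleftrightarrow>
    (\<forall>xs. strong_parameter_seq R xs \<longrightarrow> regular_seq R (self_module R) xs)"


section \<open>The monoid ring\<close>

text \<open>
  The type \<open>'h \<Rightarrow>\<^sub>0 'k\<close> is the monoid algebra of \<open>'h\<close> over \<open>'k\<close>, with \<open>Poly_Mapping.single c 1\<close> in
  the role of \<open>X\<^sup>c\<close>; the monoid ring of a submonoid consists of the elements supported on it.
\<close>

definition monoid_ring :: "'h::comm_monoid_add set \<Rightarrow> ('h \<Rightarrow>\<^sub>0 'k::field) ring"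
  where "monoid_ring H =
    \<lparr>carrier = {f. Poly_Mapping.keys f \<subseteq> H}, monoid.mult = (*), one = 1,
     ring.zero = 0, ring.add = (+)\<rparr>"

text \<open>The condition \<open>b/a < \<infinity>\<close> is \<open>a \<noteq> 0\<close>.\<close>

definition H_monoid :: "(nat \<times> nat) set"
  where "H_monoid = {(a, b). a \<noteq> 0 \<and> 0 \<le> real b / real a} \<union> {(0, 0)}"

lemma H_monoid_altdef: "H_monoid = {(a, b). a \<ge> 1} \<union> {(0, 0)}"
  by (auto simp: H_monoid_def)

lemma cring_monoid_ring:
  fixes H :: "'h::comm_monoid_add set"
  assumes zero: "0 \<in> H" and add: "\<And>a b. a \<in> H \<Longrightarrow> b \<in> H \<Longrightarrow> a + b \<in> H"
  shows "cring (monoid_ring H :: ('h \<Rightarrow>\<^sub>0 'k::field) ring)"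
proof (rule cringI)
  have uminus: "Poly_Mapping.keys (- f) = Poly_Mapping.keys f" for f :: "'h \<Rightarrow>\<^sub>0 'k"
    by (auto simp: in_keys_iff)
  show "abelian_group (monoid_ring H :: ('h \<Rightarrow>\<^sub>0 'k) ring)"
  proof (rule abelian_groupI)
    fix x :: "'h \<Rightarrow>\<^sub>0 'k" assume "x \<in> carrier (monoid_ring H)"
    then show "\<exists>y\<in>carrier (monoid_ring H). y \<oplus>\<^bsub>monoid_ring H\<^esub> x = \<zero>\<^bsub>monoid_ring H\<^esub>"
      by (intro bexI[of _ "- x"]) (auto simp: monoid_ring_def uminus)
  qed (use keys_add in \<open>fastforce simp: monoid_ring_def add_ac\<close>)+
  show "comm_monoid (monoid_ring H :: ('h \<Rightarrow>\<^sub>0 'k) ring)"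
  proof (rule comm_monoidI)
    fix x y :: "'h \<Rightarrow>\<^sub>0 'k"
    assume "x \<in> carrier (monoid_ring H)" "y \<in> carrier (monoid_ring H)"
    then show "x \<otimes>\<^bsub>monoid_ring H\<^esub> y \<in> carrier (monoid_ring H)"
      using keys_mult[of x y] add by (fastforce simp: monoid_ring_def)
  qed (use zero in \<open>auto simp: monoid_ring_def mult_ac\<close>)
qed (simp add: monoid_ring_def ring_distribs)

end

theory Submission
  imports Defs "Berlekamp_Zassenhaus.Unique_Factorization_Poly"
begin

text \<open>
  Write \<open>A = k[x, y]\<close>, \<open>R = k[H] = k + xA\<close> and \<open>\<mm> = xA\<close>. The set \<open>\<mm>\<close> is an ideal of \<open>R\<close> and also
  of \<open>A\<close>, so an element of \<open>\<mm>\<close> may be multiplied by \<open>y\<close> without leaving \<open>R\<close>, although \<open>y\<close> is not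
  in \<open>R\<close>. Since \<open>(xa)\<^sup>2 = x (xa\<^sup>2)\<close>, the only prime of \<open>R\<close> that contains \<open>x\<close> is \<open>\<mm>\<close>; at any other
  prime \<open>R\<close> and \<open>A\<close> have the same localization.

  The two negative statements come from \<open>y \<notin> R\<close>. The chain \<open>0 \<subset> yA \<inter> R \<subset> \<mm>\<close> shows that \<open>\<mm>\<close> has height
  at least 2. On the other hand, if \<open>f\<close> is a nonzerodivisor with coefficients in \<open>\<mm>\<close>, then \<open>yf\<close> is
  a nonzero element of \<open>R[t]/(f)\<close>, and every \<open>g\<close> with coefficients in \<open>\<mm>\<close> kills it because
  \<open>g (yf) = (yg) f\<close>; hence \<open>\<mm>\<close> has polynomial grade 1 (\<open>polynomial_grade_XA\<close>, \<open>height_XA\<close>).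
  Likewise \<open>\<mm>\<close> is the annihilator of \<open>x y\<^sup>2\<close> modulo \<open>xy\<close>, but it is not minimal over the height
  one ideal \<open>(xy)\<close>, since \<open>yA \<inter> R\<close> lies between them.

  For the positive statement, the top Cech cohomology of a sequence of length \<open>l\<close> is
  the direct limit of \<open>R/(x\<^sub>1\<^sup>n, \<dots>, x\<^sub>l\<^sup>n)\<close>, and its localization at a prime \<open>\<pp>\<close> vanishes as soon as
  for each \<open>n\<close> some \<open>u \<notin> \<pp>\<close> and some \<open>N\<close> satisfy
  \<open>u (x\<^sub>1 \<cdots> x\<^sub>l)\<^sup>N \<in> (x\<^sub>1\<^bsup>n+N\<^esup>, \<dots>, x\<^sub>l\<^bsup>n+N\<^esup>)\<close> (\<open>not_parameter_seq\<close>). At suitable primes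
  this condition rules out a zero entry and also the following:

  \<^item> If \<open>f = xf'\<close> and \<open>g = xg'\<close>, divide \<open>f', g'\<close> by a greatest common divisor. The cofactors
    generate an ideal containing a nonzero polynomial \<open>v(x) = x\<^sup>e w(x)\<close> with \<open>w(0) \<noteq> 0\<close>. The
    element \<open>w\<close> is outside \<open>\<mm>\<close>, and the power of \<open>x\<close> is supplied by the common factor \<open>x\<close>
    (\<open>top_class_killed_if_common_X\<close>).

  \<^item> If \<open>f, g\<close> do not both lie in \<open>\<mm>\<close> but share a prime factor \<open>c\<close> of \<open>A\<close>, then at the prime
    \<open>cA \<inter> R\<close> some power of \<open>g\<close> is a multiple of \<open>f\<close> (\<open>parameter_pair_coprime\<close>).

  \<^item> If \<open>f, g\<close> are coprime in \<open>A\<close> and not both in \<open>\<mm>\<close>, then \<open>A/(f, g)\<close> has finite dimension, so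
    \<open>h\<^sup>e (1 + hc) \<in> (f, g)\<close> for any \<open>h\<close>; at a prime containing \<open>f, g, h\<close> this makes a power of \<open>h\<close>
    redundant (\<open>no_parameter_triple\<close>).

  So a strong parameter sequence has length at most 2, and if it has length 2 it is a coprime pair
  not contained in \<open>\<mm>\<close>. Such a pair is regular by unique factorization in \<open>A\<close>
  (\<open>coprime_pair_regular\<close>).
\<close>

section \<open>Pairs of polynomials in two variables\<close>

text \<open>
  Over a field the ring \<open>k[x][y]\<close> is represented by the type of polynomials in \<open>y\<close> with coefficients in
  \<open>k[x]\<close>. A constant \<open>[:v:]\<close> is therefore a polynomial \<open>v(x)\<close> in \<open>x\<close> alone.
\<close>

lemma exists_prime_divisor:
  fixes x :: "'a::ufd"
  assumes "x \<noteq> 0" "\<not> x dvd 1"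
  shows "\<exists>c. prime_elem c \<and> c dvd x"
proof -
  obtain F where F: "mset_factors F x"
    using mset_factors_exist[OF assms] by blast
  then obtain c where "c \<in># F"
    unfolding mset_factors_def by blast
  with F show ?thesis
    unfolding mset_factors_def by (metis dvd_prod_mset prime_elem_iff_irreducible)
qed

lemma prod_primes_dvd_cancel:
  fixes g :: "'a::idom"
  assumes "\<And>c. c \<in># F \<Longrightarrow> prime_elem c \<and> \<not> c dvd g" and "prod_mset F dvd g * h"
  shows "prod_mset F dvd h"
  using assms
proof (induction F arbitrary: h)
  case (add c F)
  from add.prems(2) have "c dvd g * h"
    by (auto intro: dvd_mult_left)
  with add.prems(1)[of c] obtain h' where h: "h = c * h'"
    by (auto simp: prime_elem_dvd_mult_iff)
  have "c \<noteq> 0"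
    using add.prems(1)[of c] by auto
  have "c * prod_mset F dvd c * (g * h')"
    using add.prems(2) by (simp add: h mult.left_commute)
  then have "prod_mset F dvd g * h'"
    using \<open>c \<noteq> 0\<close> by simp
  with add.prems(1) have "prod_mset F dvd h'"
    using add.IH[of h'] by (metis union_iff add_mset_add_single)
  then show ?case
    by (simp add: h)
qed simp

lemma coprime_dvd_mult_cancel:
  fixes f g h :: "'a::ufd"
  assumes "f \<noteq> 0" and coprime: "\<And>c. prime_elem c \<Longrightarrow> c dvd f \<Longrightarrow> \<not> c dvd g"
    and dvd: "f dvd g * h"
  shows "f dvd h"
proof (cases "f dvd 1")
  case True
  then show ?thesis
    by (meson dvd_trans one_dvd)
next
  case False
  then obtain F where F: "mset_factors F f"
    using mset_factors_exist[OF \<open>f \<noteq> 0\<close>] by blast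
  then have f: "f = prod_mset F"
    unfolding mset_factors_def by (elim conjE)
  have prime: "prime_elem c \<and> \<not> c dvd g" if "c \<in># F" for c
  proof
    show "prime_elem c"
      using F that unfolding mset_factors_def prime_elem_iff_irreducible by simp
    then show "\<not> c dvd g"
      using dvd_prod_mset[OF that] coprime f by simp
  qed
  show ?thesis
    unfolding f by (rule prod_primes_dvd_cancel[OF prime dvd[unfolded f]])
qed

text \<open>
  Raising \<open>pa + qb\<close> to the power \<open>i + j\<close>, every monomial has at least \<open>i\<close> factors \<open>a\<close> or at least \<open>j\<close>
  factors \<open>b\<close>. This passes from \<open>(a, b)\<close> to \<open>(a\<^sup>i, b\<^sup>j)\<close>, as the direct limit that defines the top
  Cech cohomology requires.
\<close>

lemma power_add_combination:
  fixes a b p q :: "'a::comm_ring_1"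
  shows "\<exists>P Q. (p * a + q * b) ^ (i + j) = P * a ^ i + Q * b ^ j"
proof (induction n \<equiv> "i + j" arbitrary: i j)
  case 0
  then show ?case
    by (intro exI[of _ 1] exI[of _ 0]) simp
next
  case (Suc n)
  show ?case
  proof (cases "i = 0 \<or> j = 0")
    case True
    then show ?thesis
      by (metis add.commute add.right_neutral mult.right_neutral mult_zero_left power_0)
  next
    case False
    then obtain i' j' where ij: "i = Suc i'" "j = Suc j'"
      by (metis not0_implies_Suc)
    obtain P1 Q1 where 1: "(p * a + q * b) ^ (i' + j) = P1 * a ^ i' + Q1 * b ^ j"
      using Suc(1)[of i' j] Suc(2) ij by auto
    obtain P2 Q2 where 2: "(p * a + q * b) ^ (i + j') = P2 * a ^ i + Q2 * b ^ j'"
      using Suc(1)[of i j'] Suc(2) ij by auto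
    have "(p * a + q * b) ^ (i + j) = p * a * (p * a + q * b) ^ (i' + j) + q * b * (p * a + q * b) ^ (i + j')"
      by (simp add: ij algebra_simps)
    also have "\<dots> = (p * P1 + q * b * P2) * a ^ i + (p * a * Q1 + q * Q2) * b ^ j"
      unfolding 1 2 by (simp add: ij algebra_simps)
    finally show ?thesis
      by blast
  qed
qed

lemma split_off_prime_power:
  fixes c f :: "'a::ufd"
  assumes "prime_elem c" "f \<noteq> 0"
  shows "\<exists>i f'. f = c ^ i * f' \<and> \<not> c dvd f'"
proof (cases "f dvd 1")
  case True
  with assms(1) have "\<not> c dvd f"
    unfolding prime_elem_def using dvd_trans by blast
  then show ?thesis
    by (intro exI[of _ 0] exI[of _ f]) simp
next
  case False
  have "\<exists>i f'. prod_mset F = c ^ i * f' \<and> \<not> c dvd f'" if "\<And>e. e \<in># F \<Longrightarrow> prime_elem e" for F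
    using that
  proof (induction F)
    case empty
    show ?case
      using assms(1) unfolding prime_elem_def by (intro exI[of _ 0] exI[of _ 1]) simp
  next
    case (add e F)
    obtain i f' where F: "prod_mset F = c ^ i * f'" "\<not> c dvd f'"
      using add.IH add.prems by (metis union_iff add_mset_add_single)
    have e: "prime_elem e"
      using add.prems[of e] by simp
    show ?case
    proof (cases "c dvd e")
      case True
      then obtain u where u: "e = c * u"
        by (elim dvdE)
      have "\<not> e dvd c" if "\<not> u dvd 1"
      proof
        assume "e dvd c"
        then obtain w where "c = e * w"
          by (elim dvdE)
        then have "c * 1 = c * (u * w)"
          unfolding u by (simp only: mult_ac mult_1)
        then have "u * w = 1"
          using assms(1) unfolding prime_elem_def by (metis mult_left_cancel)
        with that show False
          by (metis dvd_triv_left)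
      qed
      moreover have "e dvd c \<or> e dvd u"
        using e u unfolding prime_elem_def by (metis dvd_refl)
      moreover have "\<not> e dvd u"
      proof
        assume "e dvd u"
        then obtain w where "e = c * (e * w)"
          using u by (elim dvdE) metis
        then have "e * (c * w) = e * 1"
          by (simp add: mult.left_commute)
        then have "c * w = 1"
          using e unfolding prime_elem_def by (metis mult_left_cancel)
        then show False
          using assms(1) unfolding prime_elem_def by (metis dvd_triv_left)
      qed
      ultimately have "u dvd 1"
        by blast
      have "\<not> c dvd u * f'"
      proof
        assume "c dvd u * f'"
        then have "c dvd u"
          using prime_elem_dvd_multD[OF assms(1)] F(2) by metis
        then show False
          using \<open>u dvd 1\<close> assms(1) unfolding prime_elem_def by (metis dvd_trans)
      qed
      moreover have "prod_mset (add_mset e F) = c ^ Suc i * (u * f')"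
        by (simp add: F(1) u mult_ac)
      ultimately show ?thesis
        by metis
    next
      case False
      then have "\<not> c dvd e * f'"
        using prime_elem_dvd_multD[OF assms(1)] F(2) by metis
      moreover have "prod_mset (add_mset e F) = c ^ i * (e * f')"
        by (simp add: F(1) mult_ac)
      ultimately show ?thesis
        by metis
    qed
  qed
  moreover obtain F where "mset_factors F f"
    using mset_factors_exist[OF assms(2) False] by metis
  ultimately show ?thesis
    unfolding mset_factors_def prime_elem_iff_irreducible by metis
qed

text \<open>
  A Bezout identity over the fraction field of the coefficients, with denominators cleared: \<open>D\<close> is a
  nonzero element of least degree in the ideal \<open>(f, g)\<close>, and pseudo-division by \<open>D\<close> leaves no
  remainder on that ideal.
\<close>

lemma pseudo_bezout:
  fixes f g :: "'k::idom poly"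
  assumes "f \<noteq> 0"
  shows "\<exists>D a b p q u. u \<noteq> 0 \<and> [:u:] * f = D * a \<and> [:u:] * g = D * b \<and> p * a + q * b = [:u:]"
proof -
  define I where "I = {p * f + q * g | p q. True}"
  have comb: "p * z + q * w \<in> I" if zw: "z \<in> I" "w \<in> I" for p q z w
  proof -
    from zw obtain p1 q1 p2 q2 where "z = p1 * f + q1 * g" "w = p2 * f + q2 * g"
      by (auto simp: I_def)
    then have "p * z + q * w = (p * p1 + q * p2) * f + (p * q1 + q * q2) * g"
      by (simp add: algebra_simps)
    then show ?thesis
      by (auto simp: I_def)
  qed
  have fI: "f \<in> I" and gI: "g \<in> I"
    unfolding I_def by (rule CollectI, metis add_0 add.right_neutral mult_1 mult_zero_left)+
  define D where "D = arg_min degree (\<lambda>z. z \<in> I \<and> z \<noteq> 0)"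
  have D: "D \<in> I" "D \<noteq> 0" and min: "\<And>z. z \<in> I \<Longrightarrow> z \<noteq> 0 \<Longrightarrow> degree D \<le> degree z"
    using arg_min_nat_lemma[of "\<lambda>z. z \<in> I \<and> z \<noteq> 0" f degree] fI assms by (auto simp: D_def)
  have "\<exists>u a. u \<noteq> 0 \<and> [:u:] * z = D * a" if "z \<in> I" for z
  proof -
    obtain u a where u: "u \<noteq> 0" and eq: "smult u z = D * a + pseudo_mod z D"
      using pseudo_mod(1)[OF D(2), of z] by blast
    have "[:u:] * z + (- a) * D \<in> I"
      using comb that D(1) by blast
    then have "pseudo_mod z D \<in> I"
      using eq by (simp add: algebra_simps)
    then have "pseudo_mod z D = 0"
      using pseudo_mod(2)[OF D(2), of z] min[of "pseudo_mod z D"] by linarith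
    then show ?thesis
      using u eq by (intro exI[of _ u] exI[of _ a]) simp
  qed
  with fI gI obtain u1 a u2 b where u: "u1 \<noteq> 0" "u2 \<noteq> 0"
    and a: "[:u1:] * f = D * a" and b: "[:u2:] * g = D * b"
    by meson
  obtain p q where pq: "D = p * f + q * g"
    using D(1) by (auto simp: I_def)
  let ?u = "u1 * u2"
  let ?a = "[:u2:] * a" and ?b = "[:u1:] * b"
  have c: "[:?u:] = [:u1:] * [:u2:]"
    by simp
  have eqs: "[:?u:] * f = D * ?a" "[:?u:] * g = D * ?b"
    unfolding c using a b by (metis mult.assoc mult.left_commute)+
  have "D * [:?u:] = p * ([:?u:] * f) + q * ([:?u:] * g)"
    by (subst pq) (simp only: ring_distribs mult_ac)
  then have "D * [:?u:] = D * (p * ?a + q * ?b)"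
    unfolding eqs by (simp only: ring_distribs mult_ac)
  then have "p * ?a + q * ?b = [:?u:]"
    using D(2) by (metis mult_left_cancel)
  moreover have "?u \<noteq> 0"
    using u by simp
  ultimately show ?thesis
    using eqs by blast
qed

text \<open>
  The denominators \<open>u\<close> in the previous identity can be removed one prime factor at a time. A prime \<open>c\<close>
  of \<open>k[x]\<close> stays prime in \<open>k[x][y]\<close> (Gauss), so if it divides \<open>Da\<close> and \<open>Db\<close>, it divides either
  \<open>D\<close> or both of \<open>a\<close> and \<open>b\<close>. In the second case it also divides \<open>v\<close>, and the identity for \<open>v\<close>
  survives the division.
\<close>

lemma cancel_constant_factor:
  fixes D a b p q f g :: "'k::field poly poly" and u v :: "'k poly"
  assumes "u \<noteq> 0" "v \<noteq> 0" "[:u:] * f = D * a" "[:u:] * g = D * b" "p * a + q * b = [:v:]"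
  shows "\<exists>D a b p q v. v \<noteq> 0 \<and> f = D * a \<and> g = D * b \<and> p * a + q * b = [:v:]"
  using assms
proof (induction "degree u" arbitrary: u v D a b rule: less_induct)
  case less
  show ?case
  proof (cases "u dvd 1")
    case True
    then obtain w where w: "1 = u * w"
      by (elim dvdE)
    then have "[:w:] * [:u:] = 1"
      by (simp add: mult.commute)
    then have "f = ([:w:] * D) * a" "g = ([:w:] * D) * b"
      using less.prems by (metis mult.assoc mult_1)+
    with less.prems show ?thesis
      by blast
  next
    case False
    then obtain c where c: "prime_elem c" "c dvd u"
      using exists_prime_divisor[OF less.prems(1) False] by metis
    then obtain u1 where u1: "u = c * u1"
      by (elim dvdE)
    have c0: "c \<noteq> 0" "\<not> c dvd 1"
      using c(1) unfolding prime_elem_def by blast+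
    have "degree c > 0"
      using c0 by (metis gr0I is_unit_iff_degree)
    then have deg: "degree u1 < degree u"
      using less.prems(1) u1 by (simp add: degree_mult_eq)
    have u1_0: "u1 \<noteq> 0"
      using less.prems(1) u1 by auto
    have C: "prime_elem [:c:]" "[:c:] \<noteq> 0"
      using lift_prime_elem_poly[OF c(1)] c0 by simp_all
    have cu: "[:u:] = [:c:] * [:u1:]"
      by (simp add: u1)
    show ?thesis
    proof (cases "[:c:] dvd D")
      case True
      then obtain D' where D': "D = [:c:] * D'"
        by (elim dvdE)
      have "[:u1:] * f = D' * a" "[:u1:] * g = D' * b"
        using less.prems(3,4) C(2) unfolding cu D' mult.assoc by (metis mult_left_cancel)+
      then show ?thesis
        using less.hyps[OF deg u1_0 less.prems(2)] less.prems(5) by blast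
    next
      case False
      have "[:c:] dvd D * a" "[:c:] dvd D * b"
        using less.prems(3,4) unfolding cu by (metis dvd_triv_left mult.assoc)+
      then have "[:c:] dvd a" "[:c:] dvd b"
        using False prime_elem_dvd_multD[OF C(1)] by metis+
      then obtain a' b' where ab: "a = [:c:] * a'" "b = [:c:] * b'"
        by (elim dvdE)
      have eqs: "[:u1:] * f = D * a'" "[:u1:] * g = D * b'"
        using less.prems(3,4) C(2) unfolding cu ab mult.assoc mult.left_commute[of D]
        by (metis mult_left_cancel)+
      have v: "[:v:] = [:c:] * (p * a' + q * b')"
        using less.prems(5) unfolding ab by (simp only: ring_distribs mult_ac)
      then have "c dvd v"
        by (metis dvd_triv_left const_poly_dvd)
      then obtain v1 where v1: "v = c * v1"
        by (elim dvdE)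
      then have "[:v:] = [:c:] * [:v1:]"
        by simp
      with v have "p * a' + q * b' = [:v1:]"
        using C(2) by (metis mult_left_cancel)
      moreover have "v1 \<noteq> 0"
        using v1 less.prems(2) by auto
      ultimately show ?thesis
        using less.hyps[OF deg u1_0 _ eqs] by blast
    qed
  qed
qed

lemma coprime_cofactors:
  fixes f g :: "'k::field poly poly"
  assumes "f \<noteq> 0"
  shows "\<exists>D a b p q v. v \<noteq> 0 \<and> f = D * a \<and> g = D * b \<and> p * a + q * b = [:v:]"
proof -
  obtain D a b p q u where "u \<noteq> 0" "[:u:] * f = D * a" "[:u:] * g = D * b" "p * a + q * b = [:u:]"
    using pseudo_bezout[OF assms, of g] by blast
  then show ?thesis
    by (intro cancel_constant_factor[of u u])
qed

lemma coprime_imp_eliminant: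
  fixes f g :: "'k::field poly poly"
  assumes "f \<noteq> 0" and coprime: "\<And>c. prime_elem c \<Longrightarrow> c dvd f \<Longrightarrow> \<not> c dvd g"
  shows "\<exists>p q v. v \<noteq> 0 \<and> p * f + q * g = [:v:]"
proof -
  obtain D a b p q v where *: "v \<noteq> 0" "f = D * a" "g = D * b" "p * a + q * b = [:v:]"
    using coprime_cofactors[OF assms(1)] by blast
  have "D \<noteq> 0"
    using * assms(1) by auto
  have "D dvd 1"
    using exists_prime_divisor[OF \<open>D \<noteq> 0\<close>] coprime * by (metis dvd_mult2)
  then obtain w where w: "1 = D * w"
    by (elim dvdE)
  have "(w * p) * f + (w * q) * g = (D * w) * (p * a + q * b)"
    unfolding *(2,3) by (simp only: ring_distribs mult_ac)
  then show ?thesis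
    using * w by (metis mult_1)
qed

text \<open>
  With \<open>f = Da\<close>, \<open>g = Db\<close> and \<open>pa + qb = x\<^sup>e s(x)\<close>, \<open>s(0) \<noteq> 0\<close>, a power of \<open>s\<close> multiplies \<open>x\<^sup>E\<close> into
  \<open>(a\<^sup>n, b\<^sup>n)\<close>. In \<open>(xf \<cdot> xg)\<^sup>N = (xD)\<^bsup>2N\<^esup> (ab)\<^sup>N\<close> only \<open>(xD)\<^bsup>n+N\<^esup>\<close> is used to rebuild
  \<open>(xf)\<^bsup>n+N\<^esup>\<close> and \<open>(xg)\<^bsup>n+N\<^esup>\<close>; the remaining \<open>N - n\<close> factors \<open>x\<close> pay for \<open>x\<^sup>E\<close>. One more factor \<open>x\<close>
  is kept in front of the coefficients, so that they lie in \<open>k + x k[x, y]\<close>.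
\<close>

lemma top_class_killed_if_common_X:
  fixes f g :: "'k::field poly poly"
  assumes "f \<noteq> 0"
  defines "x \<equiv> [:[:0, 1:]:]"
  shows "\<exists>N s P Q. coeff s 0 \<noteq> 0 \<and>
    [:s:] * (x * f * (x * g)) ^ N = x * P * (x * f) ^ (n + N) + x * Q * (x * g) ^ (n + N)"
proof -
  obtain D a b p q v where *: "v \<noteq> 0" "f = D * a" "g = D * b" "p * a + q * b = [:v:]"
    using coprime_cofactors[OF assms(1)] by blast
  define e where "e = order 0 v"
  obtain s where s: "v = [:0, 1:] ^ e * s" "\<not> [:0, 1:] dvd s"
    using order_decomp[OF *(1), of 0] by (auto simp: e_def)
  have s0: "coeff s 0 \<noteq> 0"
    using s(2) by (simp add: dvd_iff_poly_eq_0 [of 0 s, simplified] poly_0_coeff_0)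
  obtain P Q where PQ: "[:v:] ^ (n + n) = P * a ^ n + Q * b ^ n"
    using power_add_combination[of p a q b n n] *(4) by metis
  have v: "[:v:] = x ^ e * [:s:]"
    unfolding s(1) x_def by (simp add: poly_const_pow)
  define E where "E = e * (n + n)"
  \<comment> \<open>N - n must exceed E by one, for the factor x in front of the coefficients\<close>
  define N where "N = n + E + 1"
  have "(x ^ E * [:s:] ^ (n + n)) = P * a ^ n + Q * b ^ n"
    unfolding E_def PQ[symmetric] v power_mult_distrib power_mult ..
  note PQ' = this
  have "[:s ^ (n + n):] * (x * f * (x * g)) ^ N
      = [:s:] ^ (n + n) * (x ^ (N + N) * D ^ (N + N) * (a ^ N * b ^ N))"
    unfolding *(2,3) by (simp add: power_mult_distrib power_add poly_const_pow mult_ac)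
  also have "x ^ (N + N) = x * x ^ (n + N) * x ^ E"
    by (simp add: N_def power_add mult_ac)
  also have "[:s:] ^ (n + n) * (x * x ^ (n + N) * x ^ E * D ^ (N + N) * (a ^ N * b ^ N))
      = x * x ^ (n + N) * D ^ (N + N) * (a ^ N * b ^ N) * (x ^ E * [:s:] ^ (n + n))"
    by (simp only: mult_ac)
  also have "\<dots> = x * x ^ (n + N) * D ^ (N + N) * (a ^ N * b ^ N) * (P * a ^ n + Q * b ^ n)"
    unfolding PQ' ..
  also have "D ^ (N + N) = D ^ (n + N) * D ^ (E + 1)"
    unfolding power_add[symmetric] by (rule arg_cong[of _ _ "(^) D"]) (simp add: N_def)
  also have "x * x ^ (n + N) * (D ^ (n + N) * D ^ (E + 1)) * (a ^ N * b ^ N) * (P * a ^ n + Q * b ^ n)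
     = x * (D ^ (E + 1) * b ^ N * P) * (x * f) ^ (n + N) + x * (D ^ (E + 1) * a ^ N * Q) * (x * g) ^ (n + N)"
    unfolding *(2,3) by (simp add: power_mult_distrib power_add algebra_simps)
  finally show ?thesis
    using s0 by (intro exI[of _ N] exI[of _ "s ^ (n + n)"] exI conjI) (auto simp: coeff_0_power)
qed

section \<open>The monoid algebra of pairs of exponents\<close>

abbreviation "lookup \<equiv> Poly_Mapping.lookup"
abbreviation "keys \<equiv> Poly_Mapping.keys"
abbreviation "single \<equiv> Poly_Mapping.single"

lemma update_eq_add_single:
  assumes "a \<notin> keys f"
  shows "Poly_Mapping.update a b f = f + single a b"
  using assms
  by (intro poly_mapping_eqI)
    (auto simp: Poly_Mapping.lookup_update lookup_add lookup_single in_keys_iff when_def)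

lemma poly_mapping_add_induct [case_names zero add_single]:
  assumes "P 0" "\<And>f k c. P f \<Longrightarrow> P (f + single k c)"
  shows "P f"
proof (induction f rule: update_induct)
  case (update f a b)
  with assms(2)[of f a b] show ?case
    by (simp add: update_eq_add_single)
qed (rule assms)

text \<open>
  The monoid algebra of \<open>\<nat>\<^sup>2\<close> is \<open>k[x, y]\<close>, which is \<open>k[x][y]\<close> as well as \<open>k[y][x]\<close>. Both
  identifications are needed, the first to eliminate \<open>y\<close> and the second to eliminate \<open>x\<close>; the
  involution \<open>\<sigma>\<close> of the exponents, the identity or the exchange of coordinates, treats them together.
\<close>

locale exponent_symmetry =
  fixes \<sigma> :: "nat \<times> nat \<Rightarrow> nat \<times> nat"
  assumes involution: "\<sigma> (\<sigma> k) = k" and additive: "\<sigma> (k + l) = \<sigma> k + \<sigma> l"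
begin

definition to_poly :: "(nat \<times> nat \<Rightarrow>\<^sub>0 'k::field) \<Rightarrow> 'k poly poly"
  where "to_poly f = (\<Sum>k\<in>keys f. monom (monom (lookup f k) (fst (\<sigma> k))) (snd (\<sigma> k)))"

lemma coeff_to_poly: "coeff (coeff (to_poly f) b) a = lookup f (\<sigma> (a, b))"
proof -
  have "coeff (coeff (to_poly f) b) a = (\<Sum>k\<in>keys f. if \<sigma> (a, b) = k then lookup f k else 0)"
    unfolding to_poly_def coeff_sum
  proof (intro sum.cong refl)
    fix k
    have "snd (\<sigma> k) = b \<and> fst (\<sigma> k) = a \<longleftrightarrow> \<sigma> (a, b) = k"
      using involution[of k] involution[of "(a, b)"] by (metis prod.collapse fst_conv snd_conv)
    then show "coeff (coeff (monom (monom (lookup f k) (fst (\<sigma> k))) (snd (\<sigma> k))) b) a =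
        (if \<sigma> (a, b) = k then lookup f k else 0)"
      by auto
  qed
  then show ?thesis
    by (simp add: in_keys_iff)
qed

lemma to_poly_single: "to_poly (single k c) = monom (monom c (fst (\<sigma> k))) (snd (\<sigma> k))"
  by (simp add: to_poly_def)

lemma to_poly_0: "to_poly 0 = 0" and to_poly_1: "to_poly 1 = 1"
proof -
  have "\<sigma> 0 = 0"
    using additive[of 0 0] by simp
  then show "to_poly 1 = 1"
    by (simp add: to_poly_single flip: single_one)
qed (simp add: to_poly_def)

lemma to_poly_add: "to_poly (f + g) = to_poly f + to_poly g"
  by (intro poly_eqI) (simp add: coeff_to_poly lookup_add)

lemma to_poly_mult_single: "to_poly (f * single k c) = to_poly f * to_poly (single k c)"
  by (induction f rule: poly_mapping_add_induct)
    (simp_all add: to_poly_0 distrib_right to_poly_add mult_single to_poly_single additive mult_monom)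

lemma to_poly_mult: "to_poly (f * g) = to_poly f * to_poly g"
  by (induction g rule: poly_mapping_add_induct)
    (simp_all add: to_poly_0 distrib_left to_poly_add to_poly_mult_single)

lemma to_poly_power: "to_poly (f ^ n) = to_poly f ^ n"
  by (induction n) (simp_all add: to_poly_1 to_poly_mult)

lemma to_poly_eq_iff: "to_poly f = to_poly g \<longleftrightarrow> f = g"
proof
  assume "to_poly f = to_poly g"
  then have "lookup f (\<sigma> (a, b)) = lookup g (\<sigma> (a, b))" for a b
    by (metis coeff_to_poly)
  then show "f = g"
    by (intro poly_mapping_eqI) (metis involution surj_pair)
qed simp

lemma to_poly_eq_0_iff: "to_poly f = 0 \<longleftrightarrow> f = 0"
  using to_poly_eq_iff[of f 0] by (simp add: to_poly_0)

lemma to_poly_surj: "\<exists>f. to_poly f = F"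
proof -
  let ?f = "\<Sum>b\<le>degree F. \<Sum>a\<le>degree (coeff F b). single (\<sigma> (a, b)) (coeff (coeff F b) a)"
  have sum: "to_poly (sum h A) = (\<Sum>i\<in>A. to_poly (h i))" if "finite A" for h :: "nat \<Rightarrow> _" and A
    using that by induction (simp_all add: to_poly_0 to_poly_add)
  have "to_poly ?f = (\<Sum>b\<le>degree F. \<Sum>a\<le>degree (coeff F b). monom (monom (coeff (coeff F b) a) a) b)"
    by (simp add: sum to_poly_single involution)
  also have "\<dots> = (\<Sum>b\<le>degree F. monom (\<Sum>a\<le>degree (coeff F b). monom (coeff (coeff F b) a) a) b)"
    by (simp add: monom_hom.hom_sum)
  also have "\<dots> = F"
    by (simp add: poly_as_sum_of_monoms)
  finally show ?thesis ..
qed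

lemma to_poly_dvd_iff: "to_poly f dvd to_poly g \<longleftrightarrow> f dvd g"
proof
  assume "to_poly f dvd to_poly g"
  then obtain h where "to_poly g = to_poly f * to_poly h"
    using to_poly_surj by (metis dvdE)
  then show "f dvd g"
    by (metis dvd_triv_left to_poly_eq_iff to_poly_mult)
qed (auto simp: to_poly_mult elim!: dvdE)

lemma prime_elem_to_poly_iff: "prime_elem (to_poly c) \<longleftrightarrow> prime_elem c"
proof -
  have "(\<forall>a b. to_poly c dvd a * b \<longrightarrow> to_poly c dvd a \<or> to_poly c dvd b) \<longleftrightarrow>
    (\<forall>a b. to_poly c dvd to_poly a * to_poly b \<longrightarrow> to_poly c dvd to_poly a \<or> to_poly c dvd to_poly b)"
    by (metis to_poly_surj)
  also have "\<dots> \<longleftrightarrow> (\<forall>a b. c dvd a * b \<longrightarrow> c dvd a \<or> c dvd b)"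
    by (simp add: to_poly_dvd_iff flip: to_poly_mult)
  finally show ?thesis
    unfolding prime_elem_def to_poly_eq_0_iff to_poly_dvd_iff[of c 1, unfolded to_poly_1] by metis
qed

lemma coprime_to_poly:
  assumes "\<And>c. prime_elem c \<Longrightarrow> c dvd f \<Longrightarrow> \<not> c dvd g"
  shows "prime_elem c \<Longrightarrow> c dvd to_poly f \<Longrightarrow> \<not> c dvd to_poly g"
  by (metis assms prime_elem_to_poly_iff to_poly_dvd_iff to_poly_surj)

text \<open>
  The ideal of two coprime polynomials
  contains a nonzero polynomial in \<open>x\<close> alone, and by symmetry one in \<open>y\<close> alone.
\<close>

lemma eliminant:
  fixes f g :: "nat \<times> nat \<Rightarrow>\<^sub>0 'k::field"
  assumes "f \<noteq> 0" "\<And>c. prime_elem c \<Longrightarrow> c dvd f \<Longrightarrow> \<not> c dvd g"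
  shows "\<exists>p q d c. c d \<noteq> 0 \<and> p * f + q * g = (\<Sum>a\<le>d. single 0 (c a) * single (\<sigma> (1, 0)) 1 ^ a)"
proof -
  obtain p q v where v: "v \<noteq> 0" "p * to_poly f + q * to_poly g = [:v:]"
    using coprime_imp_eliminant[of "to_poly f" "to_poly g"] coprime_to_poly[OF assms(2)] assms(1)
    by (metis to_poly_eq_0_iff)
  obtain p' q' where pq: "to_poly p' = p" "to_poly q' = q"
    using to_poly_surj by metis
  have sum: "to_poly (sum h A) = (\<Sum>i\<in>A. to_poly (h i))" if "finite A" for h :: "nat \<Rightarrow> _" and A
    using that by induction (simp_all add: to_poly_0 to_poly_add)
  have \<sigma>0: "\<sigma> 0 = 0"
    using additive[of 0 0] by simp
  have "to_poly (\<Sum>a\<le>degree v. single 0 (coeff v a) * single (\<sigma> (1, 0)) 1 ^ a)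
      = (\<Sum>a\<le>degree v. monom (monom (coeff v a) a) 0)"
    by (simp add: sum to_poly_mult to_poly_power to_poly_single involution \<sigma>0 monom_power mult_monom)
  also have "\<dots> = monom (\<Sum>a\<le>degree v. monom (coeff v a) a) 0"
    by (rule monom_hom.hom_sum[symmetric])
  also have "\<dots> = [:v:]"
    by (simp add: monom_0 poly_as_sum_of_monoms)
  also have "\<dots> = to_poly (p' * f + q' * g)"
    by (simp add: v(2) to_poly_add to_poly_mult pq)
  finally have "p' * f + q' * g = (\<Sum>a\<le>degree v. single 0 (coeff v a) * single (\<sigma> (1, 0)) 1 ^ a)"
    unfolding to_poly_eq_iff by (rule sym)
  then show ?thesis
    using v(1)
    by (intro exI[of _ p'] exI[of _ q'] exI[of _ "degree v"] exI[of _ "coeff v"]) (simp add: leading_coeff_0_iff)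
qed

end

interpretation xy: exponent_symmetry id
  by unfold_locales simp_all

interpretation yx: exponent_symmetry prod.swap
  by unfold_locales auto

lemma bipoly_mult_cancel:
  fixes f g h :: "nat \<times> nat \<Rightarrow>\<^sub>0 'k::field"
  assumes "f \<noteq> 0" "f * g = f * h"
  shows "g = h"
  using assms by (metis mult_left_cancel xy.to_poly_eq_0_iff xy.to_poly_eq_iff xy.to_poly_mult)

lemma bipoly_mult_eq_0_iff:
  fixes f g :: "nat \<times> nat \<Rightarrow>\<^sub>0 'k::field"
  shows "f * g = 0 \<longleftrightarrow> f = 0 \<or> g = 0"
  using bipoly_mult_cancel[of f g 0] by auto

lemma bipoly_coprime_dvd_mult_cancel:
  fixes f g h :: "nat \<times> nat \<Rightarrow>\<^sub>0 'k::field"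
  assumes "f \<noteq> 0" "\<And>c. prime_elem c \<Longrightarrow> c dvd f \<Longrightarrow> \<not> c dvd g" "f dvd g * h"
  shows "f dvd h"
  using coprime_dvd_mult_cancel[of "xy.to_poly f" "xy.to_poly g" "xy.to_poly h"] assms(1,3)
    xy.coprime_to_poly[OF assms(2)] by (metis xy.to_poly_dvd_iff xy.to_poly_eq_0_iff xy.to_poly_mult)

lemma bipoly_split_off_prime_power:
  fixes c f :: "nat \<times> nat \<Rightarrow>\<^sub>0 'k::field"
  assumes "prime_elem c" "f \<noteq> 0"
  shows "\<exists>i f'. f = c ^ i * f' \<and> \<not> c dvd f'"
proof -
  obtain i F where F: "xy.to_poly f = xy.to_poly c ^ i * F" "\<not> xy.to_poly c dvd F"
    using split_off_prime_power[of "xy.to_poly c" "xy.to_poly f"] assms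
    by (metis xy.prime_elem_to_poly_iff xy.to_poly_eq_0_iff)
  obtain f' where "xy.to_poly f' = F"
    using xy.to_poly_surj by metis
  with F have "xy.to_poly f = xy.to_poly (c ^ i * f')" "\<not> c dvd f'"
    by (auto simp: xy.to_poly_mult xy.to_poly_power xy.to_poly_dvd_iff)
  then show ?thesis
    by (metis xy.to_poly_eq_iff)
qed

lemma bipoly_top_class_killed:
  fixes f g :: "nat \<times> nat \<Rightarrow>\<^sub>0 'k::field"
  assumes "f \<noteq> 0"
  defines "x \<equiv> single (1, 0) 1"
  shows "\<exists>N s P Q. lookup s (0, 0) \<noteq> 0 \<and> (\<forall>b>0. lookup s (0, b) = 0) \<and>
    s * (x * f * (x * g)) ^ N = x * P * (x * f) ^ (n + N) + x * Q * (x * g) ^ (n + N)"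
proof -
  have x: "xy.to_poly x = [:[:0, 1:]:]"
    by (simp add: x_def xy.to_poly_single monom_0 monom_Suc)
  obtain N s P Q where *: "coeff s 0 \<noteq> 0"
    "[:s:] * (xy.to_poly x * xy.to_poly f * (xy.to_poly x * xy.to_poly g)) ^ N =
      xy.to_poly x * P * (xy.to_poly x * xy.to_poly f) ^ (n + N) +
      xy.to_poly x * Q * (xy.to_poly x * xy.to_poly g) ^ (n + N)"
    using top_class_killed_if_common_X[of "xy.to_poly f" "xy.to_poly g" n] assms(1)
    unfolding x xy.to_poly_eq_0_iff by metis
  obtain s' P' Q' where pre: "xy.to_poly s' = [:s:]" "xy.to_poly P' = P" "xy.to_poly Q' = Q"
    using xy.to_poly_surj by metis
  have s': "lookup s' (a, b) = coeff (coeff [:s:] b) a" for a b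
    using xy.coeff_to_poly[of s' b a] pre(1) by simp
  have "xy.to_poly (s' * (x * f * (x * g)) ^ N) =
    xy.to_poly (x * P' * (x * f) ^ (n + N) + x * Q' * (x * g) ^ (n + N))"
    using *(2) by (simp only: xy.to_poly_add xy.to_poly_mult xy.to_poly_power pre)
  then have "s' * (x * f * (x * g)) ^ N = x * P' * (x * f) ^ (n + N) + x * Q' * (x * g) ^ (n + N)"
    unfolding xy.to_poly_eq_iff .
  moreover have "lookup s' (0, 0) \<noteq> 0" "\<forall>b>0. lookup s' (0, b) = 0"
    using *(1) by (auto simp: s' coeff_pCons split: nat.split)
  ultimately show ?thesis
    by blast
qed

section \<open>Two coprime polynomials have a finite-dimensional quotient\<close>

definition scale :: "'k \<Rightarrow> (nat \<times> nat \<Rightarrow>\<^sub>0 'k::field) \<Rightarrow> (nat \<times> nat \<Rightarrow>\<^sub>0 'k)"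
  where "scale c f = single 0 c * f"

interpretation bipoly: vector_space scale
  by unfold_locales
    (simp_all add: scale_def ring_distribs single_add mult_single flip: mult.assoc)

lemma scale_mult: "scale c f * g = scale c (f * g)" "f * scale c g = scale c (f * g)"
  by (simp_all add: scale_def mult_ac)

locale bipoly_ideal =
  fixes J :: "(nat \<times> nat \<Rightarrow>\<^sub>0 'k::field) set"
  assumes zero: "0 \<in> J" and add: "z \<in> J \<Longrightarrow> w \<in> J \<Longrightarrow> z + w \<in> J"
    and mult: "z \<in> J \<Longrightarrow> t * z \<in> J"
begin

lemma scale: "z \<in> J \<Longrightarrow> scale c z \<in> J"
  unfolding scale_def by (rule mult)

text \<open>
  The preimage in \<open>k[x, y]\<close> of the subspace of \<open>k[x, y]/J\<close> spanned by \<open>B\<close>. Working upstairs avoids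
  the quotient space.
\<close>

definition span_mod :: "(nat \<times> nat \<Rightarrow>\<^sub>0 'k) set \<Rightarrow> (nat \<times> nat \<Rightarrow>\<^sub>0 'k) set"
  where "span_mod B = {t. \<exists>v\<in>bipoly.span B. t - v \<in> J}"

lemma span_modI: "v \<in> bipoly.span B \<Longrightarrow> t - v \<in> J \<Longrightarrow> t \<in> span_mod B"
  unfolding span_mod_def by blast

lemma subspace_span_mod: "bipoly.subspace (span_mod B)"
proof (rule bipoly.subspaceI)
  show "0 \<in> span_mod B"
    using zero by (intro span_modI[of 0] bipoly.span_zero) simp
next
  fix t t' assume "t \<in> span_mod B" "t' \<in> span_mod B"
  then obtain v v' where v: "v \<in> bipoly.span B" "t - v \<in> J" "v' \<in> bipoly.span B" "t' - v' \<in> J"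
    unfolding span_mod_def by blast
  have "t + t' - (v + v') = (t - v) + (t' - v')"
    by simp
  then show "t + t' \<in> span_mod B"
    using v by (intro span_modI[of "v + v'"] bipoly.span_add) (simp_all only: add)
next
  fix c t assume "t \<in> span_mod B"
  then obtain v where "v \<in> bipoly.span B" "t - v \<in> J"
    unfolding span_mod_def by blast
  moreover from this have "scale c t - scale c v \<in> J"
    using scale[of "t - v" c] by (simp add: bipoly.scale_right_diff_distrib)
  ultimately show "scale c t \<in> span_mod B"
    unfolding span_mod_def using bipoly.span_scale by blast
qed

lemma span_mod_base: "t \<in> B \<Longrightarrow> t \<in> span_mod B"
  using zero by (intro span_modI[of t] bipoly.span_base) simp_all

lemma span_mod_cong: "t - t' \<in> J \<Longrightarrow> t' \<in> span_mod B \<Longrightarrow> t \<in> span_mod B"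
  unfolding span_mod_def using add[of "t - t'"] by fastforce

lemma span_mod_mult:
  assumes "t \<in> span_mod A" "t' \<in> span_mod B"
  shows "t * t' \<in> span_mod ((\<lambda>(a, b). a * b) ` (A \<times> B))"
proof -
  let ?AB = "(\<lambda>(a, b). a * b) ` (A \<times> B)"
  obtain v v' where v: "v \<in> bipoly.span A" "t - v \<in> J" "v' \<in> bipoly.span B" "t' - v' \<in> J"
    using assms unfolding span_mod_def by blast
  have "a * v' \<in> bipoly.span ?AB" if "a \<in> A" for a
    using v(3)
  proof (induction rule: bipoly.span_induct_alt)
    case base
    then show ?case
      by (simp add: bipoly.span_zero)
  next
    case (step c b y)
    have "a * b \<in> bipoly.span ?AB"
      using that step by (intro bipoly.span_base) auto
    then show ?case
      using step by (simp add: distrib_left scale_mult bipoly.span_add bipoly.span_scale)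
  qed
  with v(1) have "v * v' \<in> bipoly.span ?AB"
  proof (induction rule: bipoly.span_induct_alt)
    case base
    then show ?case
      by (simp add: bipoly.span_zero)
  next
    case (step c a y)
    then show ?case
      by (simp add: distrib_right scale_mult bipoly.span_add bipoly.span_scale)
  qed
  moreover have "t * t' - v * v' = t' * (t - v) + v * (t' - v')"
    by (simp add: algebra_simps)
  then have "t * t' - v * v' \<in> J"
    using v add mult by metis
  ultimately show ?thesis
    unfolding span_mod_def by blast
qed

text \<open>
  An element that is algebraic modulo \<open>J\<close> has only finitely many linearly independent powers: the
  relation of degree \<open>d\<close>, multiplied by \<open>z\<^bsup>i-d\<^esup>\<close>, expresses \<open>z\<^sup>i\<close> by lower powers.
\<close>

lemma powers_in_span_mod:
  assumes "c d \<noteq> 0" "(\<Sum>a\<le>d. scale (c a) (z ^ a)) \<in> J"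
  shows "z ^ i \<in> span_mod ((\<lambda>a. z ^ a) ` {..<d})"
proof (induction i rule: less_induct)
  case (less i)
  let ?W = "span_mod ((\<lambda>a. z ^ a) ` {..<d})"
  show ?case
  proof (cases "i < d")
    case True
    then show ?thesis
      by (intro span_mod_base) auto
  next
    case False
    have "(\<Sum>a<d. scale (c a) (z ^ (a + (i - d)))) \<in> ?W"
      using False
      by (intro bipoly.subspace_sum bipoly.subspace_scale subspace_span_mod less.IH) auto
    then have low: "scale (- 1 / c d) (\<Sum>a<d. scale (c a) (z ^ (a + (i - d)))) \<in> ?W" (is "?l \<in> _")
      by (rule bipoly.subspace_scale[OF subspace_span_mod])
    have "z ^ (i - d) * (\<Sum>a\<le>d. scale (c a) (z ^ a)) \<in> J"
      using assms(2) by (rule mult)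
    also have "z ^ (i - d) * (\<Sum>a\<le>d. scale (c a) (z ^ a)) = (\<Sum>a\<le>d. scale (c a) (z ^ (a + (i - d))))"
      by (simp add: sum_distrib_left scale_mult power_add mult.commute)
    also have "\<dots> = (\<Sum>a<d. scale (c a) (z ^ (a + (i - d)))) + scale (c d) (z ^ i)"
      using False by (simp add: lessThan_Suc_atMost[symmetric])
    finally have "scale (1 / c d) ((\<Sum>a<d. scale (c a) (z ^ (a + (i - d)))) + scale (c d) (z ^ i)) \<in> J"
      by (rule scale)
    also have "scale (1 / c d) ((\<Sum>a<d. scale (c a) (z ^ (a + (i - d)))) + scale (c d) (z ^ i)) = z ^ i - ?l"
      using assms(1) by (simp add: bipoly.scale_right_distrib bipoly.scale_minus_left)
    finally show ?thesis
      using low span_mod_cong by blast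
  qed
qed

lemma finite_dimension:
  assumes "c d \<noteq> 0" "(\<Sum>a\<le>d. scale (c a) (single (1, 0) 1 ^ a)) \<in> J"
    and "c' d' \<noteq> 0" "(\<Sum>a\<le>d'. scale (c' a) (single (0, 1) 1 ^ a)) \<in> J"
  shows "\<exists>B. finite B \<and> span_mod B = UNIV"
proof -
  let ?A = "(\<lambda>a. single (1, 0) (1::'k) ^ a) ` {..<d}" and ?B = "(\<lambda>a. single (0, 1) (1::'k) ^ a) ` {..<d'}"
  let ?AB = "(\<lambda>(a, b). a * b) ` (?A \<times> ?B)"
  have pow: "single (a, b) (1::'k) ^ n = single (n * a, n * b) 1" for a b n
    by (induction n) (simp_all add: mult_single single_one zero_prod_def add.commute flip: single_one)
  have "f \<in> span_mod ?AB" for f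
  proof (induction f rule: poly_mapping_add_induct)
    case zero
    then show ?case
      by (rule bipoly.subspace_0[OF subspace_span_mod])
  next
    case (add_single f k c)
    have "single (1, 0) 1 ^ fst k * single (0, 1) 1 ^ snd k \<in> span_mod ?AB"
      using powers_in_span_mod assms by (intro span_mod_mult) blast+
    then have "scale c (single (1, 0) 1 ^ fst k * single (0, 1) 1 ^ snd k) \<in> span_mod ?AB"
      by (rule bipoly.subspace_scale[OF subspace_span_mod])
    also have "scale c (single (1, 0) 1 ^ fst k * single (0, 1) 1 ^ snd k) = single k c"
      unfolding pow by (simp add: scale_def mult_single)
    finally show ?case
      using add_single by (intro bipoly.subspace_add[OF subspace_span_mod])
  qed
  then show ?thesis
    by (intro exI[of _ ?AB]) auto
qed

text \<open>
  The powers \<open>1, h, \<dots>, h\<^sup>d\<close> are one more than the dimension bound \<open>d\<close>, so they are linearly dependent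
  modulo \<open>J\<close>. If two of the chosen representatives coincide, their difference is the relation.
\<close>

lemma algebraic_mod:
  assumes "finite B" "span_mod B = UNIV"
  shows "\<exists>d c. (\<exists>i\<le>d. c i \<noteq> 0) \<and> (\<Sum>i\<le>d. scale (c i) (h ^ i)) \<in> J"
proof -
  have "\<exists>v\<in>bipoly.span B. h ^ i - v \<in> J" for i
    using assms(2) unfolding span_mod_def by blast
  then obtain r where r: "\<And>i. r i \<in> bipoly.span B" "\<And>i. h ^ i - r i \<in> J"
    by metis
  let ?d = "card B"
  have "\<exists>c. (\<exists>i\<le>?d. c i \<noteq> 0) \<and> (\<Sum>i\<le>?d. scale (c i) (r i)) = 0"
  proof (cases "inj_on r {..?d}")
    case False
    then obtain i j where ij: "i \<le> ?d" "j \<le> ?d" "i \<noteq> j" "r i = r j"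
      unfolding inj_on_def by auto
    let ?c = "\<lambda>k. if k = i then 1 else if k = j then - 1 else 0"
    have "(\<Sum>k\<le>?d. scale (?c k) (r k)) = (\<Sum>k\<in>{i, j}. scale (?c k) (r k))"
      using ij by (intro sum.mono_neutral_right) auto
    also have "\<dots> = 0"
      using ij by simp
    finally show ?thesis
      using ij(1) by (intro exI[of _ ?c]) auto
  next
    case True
    have "bipoly.dependent (r ` {..?d})"
    proof (rule ccontr)
      assume "bipoly.independent (r ` {..?d})"
      then have "card (r ` {..?d}) \<le> card B"
        using bipoly.independent_span_bound[OF assms(1)] r(1) by blast
      then show False
        using True by (simp add: card_image)
    qed
    then obtain u where u: "\<exists>v\<in>r ` {..?d}. u v \<noteq> 0" "(\<Sum>v\<in>r ` {..?d}. scale (u v) v) = 0"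
      using bipoly.dependent_finite[of "r ` {..?d}"] by auto
    then show ?thesis
      using True by (intro exI[of _ "u \<circ> r"]) (auto simp: sum.reindex)
  qed
  then obtain c where c: "\<exists>i\<le>?d. c i \<noteq> 0" "(\<Sum>i\<le>?d. scale (c i) (r i)) = 0"
    by blast
  have "(\<Sum>i\<le>?d. scale (c i) (h ^ i)) = (\<Sum>i\<le>?d. scale (c i) (h ^ i - r i))"
    using c(2) by (simp add: bipoly.scale_right_diff_distrib sum_subtractf)
  moreover have "(\<Sum>i\<in>I. scale (c i) (h ^ i - r i)) \<in> J" if "finite I" for I
    using that by induction (simp_all add: zero add scale r(2))
  ultimately show ?thesis
    using c(1) by (intro exI[of _ ?d] exI[of _ c]) simp
qed

text \<open>
  Fitting's lemma for multiplication by \<open>h\<close> on the finite-dimensional algebra \<open>k[x, y]/J\<close>, in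
  element form: dividing an algebraic relation of \<open>h\<close> by its lowest coefficient, at index \<open>e\<close>, brings
  it to the form \<open>h\<^sup>e (1 + hc)\<close>. So a power of \<open>h\<close> vanishes modulo \<open>J\<close> wherever \<open>1 + hc\<close> is invertible.
\<close>

lemma fitting:
  assumes "finite B" "span_mod B = UNIV"
  shows "\<exists>e c. h ^ e * (1 + h * c) \<in> J"
proof -
  obtain d c where c: "\<exists>i\<le>d. c i \<noteq> 0" "(\<Sum>i\<le>d. scale (c i) (h ^ i)) \<in> J"
    using algebraic_mod[OF assms] by blast
  define e where "e = (LEAST i. c i \<noteq> 0)"
  have e: "c e \<noteq> 0" "e \<le> d"
    using c(1) LeastI[of "\<lambda>i. c i \<noteq> 0"] Least_le[of "\<lambda>i. c i \<noteq> 0"] le_trans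
    unfolding e_def by blast+
  have low: "c i = 0" if "i < e" for i
    using not_less_Least[of i "\<lambda>i. c i \<noteq> 0"] that by (simp add: e_def)
  let ?w = "\<Sum>i\<in>{e<..d}. scale (c i) (h ^ (i - Suc e))"
  have "{..d} = {..<e} \<union> insert e {e<..d}"
    using e(2) by auto
  then have "(\<Sum>i\<le>d. scale (c i) (h ^ i)) = (\<Sum>i\<in>insert e {e<..d}. scale (c i) (h ^ i))"
    using low by (intro sum.mono_neutral_right) auto
  also have "\<dots> = scale (c e) (h ^ e) + (\<Sum>i\<in>{e<..d}. scale (c i) (h ^ i))"
    by simp
  also have "(\<Sum>i\<in>{e<..d}. scale (c i) (h ^ i)) = h ^ e * h * ?w"
    unfolding sum_distrib_left scale_mult
  proof (intro sum.cong refl)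
    fix i assume "i \<in> {e<..d}"
    then have "h ^ i = h ^ (Suc e + (i - Suc e))"
      by simp
    also have "\<dots> = h ^ e * h * h ^ (i - Suc e)"
      unfolding power_add by (simp add: mult.commute)
    finally show "scale (c i) (h ^ i) = scale (c i) (h ^ e * h * h ^ (i - Suc e))"
      by simp
  qed
  finally have "scale (1 / c e) (scale (c e) (h ^ e) + h ^ e * h * ?w) \<in> J"
    using c(2) scale by metis
  also have "scale (1 / c e) (scale (c e) (h ^ e) + h ^ e * h * ?w) = h ^ e * (1 + h * scale (1 / c e) ?w)"
    using e(1) by (simp add: bipoly.scale_right_distrib distrib_left scale_mult mult.assoc)
  finally show ?thesis
    by blast
qed

end

lemma coprime_fitting:
  fixes f g h :: "nat \<times> nat \<Rightarrow>\<^sub>0 'k::field"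
  assumes "f \<noteq> 0" "\<And>c. prime_elem c \<Longrightarrow> c dvd f \<Longrightarrow> \<not> c dvd g"
  shows "\<exists>e c p q. h ^ e * (1 + h * c) = p * f + q * g"
proof -
  define J where "J = {p * f + q * g | p q. True}"
  interpret bipoly_ideal J
  proof
    show "0 \<in> J"
      unfolding J_def by (rule CollectI, rule exI[of _ 0], rule exI[of _ 0]) simp
  next
    fix z w assume "z \<in> J" "w \<in> J"
    then obtain p q p' q' where "z = p * f + q * g" "w = p' * f + q' * g"
      unfolding J_def by blast
    then have "z + w = (p + p') * f + (q + q') * g"
      by (simp add: algebra_simps)
    then show "z + w \<in> J"
      unfolding J_def by blast
  next
    fix z t assume "z \<in> J"
    then obtain p q where "z = p * f + q * g"
      unfolding J_def by blast
    then have "t * z = (t * p) * f + (t * q) * g"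
      by (simp add: algebra_simps)
    then show "t * z \<in> J"
      unfolding J_def by blast
  qed
  obtain p q d c where 1: "c d \<noteq> 0"
    "p * f + q * g = (\<Sum>a\<le>d. scale (c a) (single (1, 0) 1 ^ a))"
    using xy.eliminant[OF assms] unfolding scale_def id_apply by blast
  obtain p' q' d' c' where 2: "c' d' \<noteq> 0"
    "p' * f + q' * g = (\<Sum>a\<le>d'. scale (c' a) (single (0, 1) 1 ^ a))"
    using yx.eliminant[OF assms] unfolding scale_def swap_simp by blast
  have "(\<Sum>a\<le>d. scale (c a) (single (1, 0) 1 ^ a)) \<in> J" "(\<Sum>a\<le>d'. scale (c' a) (single (0, 1) 1 ^ a)) \<in> J"
    unfolding 1(2)[symmetric] 2(2)[symmetric] J_def by blast+
  then obtain B where "finite B" "span_mod B = UNIV"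
    using finite_dimension[of c d c' d'] 1(1) 2(1) by blast
  then show ?thesis
    using fitting[of B h] unfolding J_def by blast
qed

section \<open>Quotients of modules and regular sequences\<close>

lemma self_module_simps [simp]:
  "carrier (self_module R) = carrier R" "\<zero>\<^bsub>self_module R\<^esub> = \<zero>\<^bsub>R\<^esub>"
  "add (self_module R) = add R" "a \<odot>\<^bsub>self_module R\<^esub> b = a \<otimes>\<^bsub>R\<^esub> b"
  by (simp_all add: self_module_def)

lemma (in cring) module_self_module: "module R (self_module R)"
proof (rule moduleI)
  show "abelian_group (self_module R)"
    by (rule abelian_groupI) (auto simp: a_assoc intro: a_comm l_neg a_inv_closed)
qed (auto simp: ring_simprules cring_axioms)

text \<open>
  The module operations on cosets do not depend on representatives exactly because \<open>N\<close> is a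
  submodule; all later computations in quotients go through representatives.
\<close>

locale quotient_by_submodule = module R M + sub: submodule N R M
  for R :: "('a, 'm) ring_scheme" (structure) and M :: "('a, 'c) module" (structure) and N
begin

sublocale abelian_subgroup N M
proof (rule abelian_subgroupI3)
  show "additive_subgroup N M"
    by (intro additive_subgroup.intro sub.subgroup_axioms)
qed (rule M.abelian_group_axioms)

lemma coset_eqI:
  assumes "x \<in> carrier M" "y \<in> carrier M" "y \<oplus>\<^bsub>M\<^esub> \<ominus>\<^bsub>M\<^esub> x \<in> N"
  shows "N +>\<^bsub>M\<^esub> x = N +>\<^bsub>M\<^esub> y"
  by (intro a_repr_independence' a_rcos_module_rev assms)

lemma coset_eq_zero_iff:
  assumes "x \<in> carrier M"
  shows "N +>\<^bsub>M\<^esub> x = N \<longleftrightarrow> x \<in> N"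
  using assms a_rcos_self[of x] a_rcos_const[of x] by auto

lemma quotient_simps [simp]:
  "\<zero>\<^bsub>quotient_module M N\<^esub> = N" "add (quotient_module M N) = set_add M"
  by (simp_all add: quotient_module_def)

lemma carrier_quotient: "carrier (quotient_module M N) = (\<lambda>x. N +>\<^bsub>M\<^esub> x) ` carrier M"
  by (auto simp: quotient_module_def A_RCOSETS_def')

lemma smult_quotient [simp]:
  assumes "a \<in> carrier R" "x \<in> carrier M"
  shows "a \<odot>\<^bsub>quotient_module M N\<^esub> (N +>\<^bsub>M\<^esub> x) = N +>\<^bsub>M\<^esub> (a \<odot>\<^bsub>M\<^esub> x)"
proof -
  have "N +>\<^bsub>M\<^esub> (a \<odot>\<^bsub>M\<^esub> z) = N +>\<^bsub>M\<^esub> (a \<odot>\<^bsub>M\<^esub> x)" if z: "z \<in> N +>\<^bsub>M\<^esub> x" for z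
  proof -
    have zM: "z \<in> carrier M"
      using z a_elemrcos_carrier assms by blast
    have "z \<oplus>\<^bsub>M\<^esub> \<ominus>\<^bsub>M\<^esub> x \<in> N"
      using z assms by (intro a_rcos_module_imp)
    then have "a \<odot>\<^bsub>M\<^esub> (z \<oplus>\<^bsub>M\<^esub> \<ominus>\<^bsub>M\<^esub> x) \<in> N"
      using assms by blast
    then have "a \<odot>\<^bsub>M\<^esub> z \<oplus>\<^bsub>M\<^esub> \<ominus>\<^bsub>M\<^esub> (a \<odot>\<^bsub>M\<^esub> x) \<in> N"
      using assms zM by (simp add: smult_r_distr smult_r_minus)
    then show ?thesis
      using assms zM by (intro coset_eqI[symmetric]) simp_all
  qed
  then have "(\<Union>z\<in>N +>\<^bsub>M\<^esub> x. N +>\<^bsub>M\<^esub> (a \<odot>\<^bsub>M\<^esub> z)) = (\<Union>z\<in>N +>\<^bsub>M\<^esub> x. N +>\<^bsub>M\<^esub> (a \<odot>\<^bsub>M\<^esub> x))"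
    by simp
  also have "\<dots> = N +>\<^bsub>M\<^esub> (a \<odot>\<^bsub>M\<^esub> x)"
    using a_rcos_self[OF assms(2)] by blast
  finally show ?thesis
    by (simp add: quotient_module_def)
qed

lemma module_quotient: "module R (quotient_module M N)"
proof (rule moduleI)
  have N: "N = N +>\<^bsub>M\<^esub> \<zero>\<^bsub>M\<^esub>"
    using coset_eq_zero_iff[of "\<zero>\<^bsub>M\<^esub>"] by simp
  show "abelian_group (quotient_module M N)"
  proof (rule abelian_groupI)
    fix C assume "C \<in> carrier (quotient_module M N)"
    then obtain x where x: "x \<in> carrier M" "C = N +>\<^bsub>M\<^esub> x"
      by (auto simp: carrier_quotient)
    have "(N +>\<^bsub>M\<^esub> \<zero>\<^bsub>M\<^esub>) <+>\<^bsub>M\<^esub> C = C" "(N +>\<^bsub>M\<^esub> \<ominus>\<^bsub>M\<^esub> x) <+>\<^bsub>M\<^esub> C = N +>\<^bsub>M\<^esub> \<zero>\<^bsub>M\<^esub>"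
      using x by (simp_all add: a_rcos_sum M.l_neg)
    then show "\<zero>\<^bsub>quotient_module M N\<^esub> \<oplus>\<^bsub>quotient_module M N\<^esub> C = C"
      and "\<exists>D\<in>carrier (quotient_module M N). D \<oplus>\<^bsub>quotient_module M N\<^esub> C = \<zero>\<^bsub>quotient_module M N\<^esub>"
      using x N by (auto simp: carrier_quotient)
  next
    show "\<zero>\<^bsub>quotient_module M N\<^esub> \<in> carrier (quotient_module M N)"
      using N by (auto simp: carrier_quotient)
  qed (auto simp: carrier_quotient a_rcos_sum M.a_ac)
qed (auto simp: carrier_quotient a_rcos_sum smult_l_distr smult_r_distr smult_assoc1 R.cring_axioms)

end

lemma (in cring) ideal_if_submodule:
  assumes "submodule J R (self_module R)"
  shows "ideal J R"
proof (rule idealI[OF ring_axioms])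
  show sub: "subgroup J (add_monoid R)"
    using submodule.axioms(1)[OF assms] by (simp add: self_module_def subgroup_def m_inv_def)
  fix a x assume "a \<in> J" "x \<in> carrier R"
  then show "x \<otimes> a \<in> J"
    using submodule.smult_closed[OF assms, of x a] by simp
  moreover have "a \<in> carrier R"
    using \<open>a \<in> J\<close> subgroup.subset[OF sub] by auto
  ultimately show "a \<otimes> x \<in> J"
    using \<open>x \<in> carrier R\<close> m_comm by metis
qed

lemma (in cring) quotient_by_ideal:
  assumes "ideal I R"
  shows "quotient_by_submodule R (self_module R) I"
proof -
  interpret I: ideal I R by fact
  interpret S: module R "self_module R" by (rule module_self_module)
  have "a_inv (self_module R) x = \<ominus> x" for x
    by (simp add: a_inv_def m_inv_def self_module_def)
  then have "submodule I R (self_module R)"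
    using I.a_subset I.I_l_closed by (intro S.submoduleI) auto
  then show ?thesis
    by (simp add: quotient_by_submodule_def S.module_axioms)
qed

lemma (in cring) ideal_smult_self_module:
  assumes "ideal I R"
  shows "ideal_smult R I (self_module R) = I"
proof
  interpret I: ideal I R by fact
  interpret Q: quotient_by_submodule R "self_module R" I
    using assms by (rule quotient_by_ideal)
  show "ideal_smult R I (self_module R) \<subseteq> I"
    unfolding ideal_smult_def using Q.sub.submodule_axioms I.I_r_closed by auto
  show "I \<subseteq> ideal_smult R I (self_module R)"
    unfolding ideal_smult_def using I.Icarr by (auto, metis r_one one_closed)
qed

lemma (in cring) quotient_self_module_eq_zero_iff:
  assumes "ideal I R" "a \<in> carrier R" "x \<in> carrier R"
  shows "a \<odot>\<^bsub>quotient_module (self_module R) I\<^esub> (I +>\<^bsub>R\<^esub> x) = \<zero>\<^bsub>quotient_module (self_module R) I\<^esub>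
    \<longleftrightarrow> a \<otimes> x \<in> I"
proof -
  interpret Q: quotient_by_submodule R "self_module R" I
    using assms by (intro quotient_by_ideal)
  have "I +>\<^bsub>self_module R\<^esub> y = I +>\<^bsub>R\<^esub> y" for y
    by (simp add: a_r_coset_def')
  then show ?thesis
    using assms Q.smult_quotient[of a x] Q.coset_eq_zero_iff[of "a \<otimes> x"] by simp
qed

lemma (in cring) carrier_quotient_self_module:
  assumes "ideal I R"
  shows "carrier (quotient_module (self_module R) I) = (\<lambda>x. I +>\<^bsub>R\<^esub> x) ` carrier R"
  by (auto simp: quotient_module_def A_RCOSETS_def' a_r_coset_def')

lemma (in cring) nonzerodivisor_on_quotient_iff:
  assumes "ideal I R" "a \<in> carrier R"
  shows "nonzerodivisor_on (quotient_module (self_module R) I) a \<longleftrightarrow>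
    (\<forall>x\<in>carrier R. a \<otimes> x \<in> I \<longrightarrow> x \<in> I)"
proof -
  interpret Q: quotient_by_submodule R "self_module R" I
    using assms by (intro quotient_by_ideal)
  have "I +>\<^bsub>R\<^esub> x = \<zero>\<^bsub>quotient_module (self_module R) I\<^esub> \<longleftrightarrow> x \<in> I" if "x \<in> carrier R" for x
    using Q.coset_eq_zero_iff[of x] that by (simp add: a_r_coset_def')
  then show ?thesis
    unfolding nonzerodivisor_on_def carrier_quotient_self_module[OF assms(1)]
    using quotient_self_module_eq_zero_iff[OF assms] by auto
qed

lemma (in cring) annihilator_quotient:
  assumes "ideal I R" "x \<in> carrier R"
  shows "annihilator R (quotient_module (self_module R) I) (I +>\<^bsub>R\<^esub> x) = {a \<in> carrier R. a \<otimes> x \<in> I}"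
  unfolding annihilator_def using quotient_self_module_eq_zero_iff[OF assms(1) _ assms(2)] by auto

text \<open>
  For the ring as a module over itself, \<open>I R = I\<close>, so the quotients in the definition of a weak regular
  sequence become membership conditions in the ideals of the initial segments.
\<close>

lemma (in cring) weak_regular_seq_self_iff:
  "weak_regular_seq R (self_module R) xs \<longleftrightarrow> set xs \<subseteq> carrier R \<and>
    (\<forall>i<length xs. \<forall>x\<in>carrier R. xs ! i \<otimes> x \<in> Idl (set (take i xs)) \<longrightarrow> x \<in> Idl (set (take i xs)))"
proof -
  have "nonzerodivisor_on (quotient_module (self_module R) (ideal_smult R (Idl (set (take i xs))) (self_module R))) (xs ! i)
    \<longleftrightarrow> (\<forall>x\<in>carrier R. xs ! i \<otimes> x \<in> Idl (set (take i xs)) \<longrightarrow> x \<in> Idl (set (take i xs)))"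
    if "set xs \<subseteq> carrier R" "i < length xs" for i
  proof -
    have I: "ideal (Idl (set (take i xs))) R"
      using that(1) set_take_subset[of i xs] by (intro genideal_ideal) simp
    have "xs ! i \<in> carrier R"
      using that nth_mem[of i xs] by auto
    with I show ?thesis
      unfolding ideal_smult_self_module[OF I] by (rule nonzerodivisor_on_quotient_iff)
  qed
  then show ?thesis
    unfolding weak_regular_seq_def by blast
qed

lemma (in cring) genideal_empty: "Idl {} = {\<zero>}"
proof
  show "Idl {} \<subseteq> {\<zero>}"
    by (intro genideal_minimal zeroideal) simp
  show "{\<zero>} \<subseteq> Idl {}"
    using additive_subgroup.zero_closed[OF ideal.axioms(1)[OF genideal_ideal[of "{}"]]] by simp
qed

section \<open>Localization of modules\<close>

locale localized_module = module R M
  for R :: "('a, 'm) ring_scheme" (structure) and M :: "('a, 'c) module" (structure) +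
  fixes S :: "'a set"
  assumes S_subset: "S \<subseteq> carrier R" and S_one: "\<one> \<in> S"
    and S_mult: "s \<in> S \<Longrightarrow> t \<in> S \<Longrightarrow> s \<otimes> t \<in> S"
begin

lemma S_carrier [simp]: "s \<in> S \<Longrightarrow> s \<in> carrier R"
  using S_subset by blast

lemma equiv_loc_rel: "equiv (carrier M \<times> S) (loc_rel R M S)"
proof (rule equivI)
  show "loc_rel R M S \<subseteq> (carrier M \<times> S) \<times> (carrier M \<times> S)"
    by (auto simp: loc_rel_def)
  show "refl_on (carrier M \<times> S) (loc_rel R M S)"
    using S_one by (auto simp: refl_on_def loc_rel_def)
  show "sym (loc_rel R M S)"
    by (auto simp: sym_def loc_rel_def) metis
  show "trans (loc_rel R M S)"
  proof (rule transI, clarify)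
    fix x s y t z r
    assume "((x, s), (y, t)) \<in> loc_rel R M S" "((y, t), (z, r)) \<in> loc_rel R M S"
    then obtain u v where *: "x \<in> carrier M" "y \<in> carrier M" "z \<in> carrier M" "s \<in> S" "t \<in> S" "r \<in> S"
      "u \<in> S" "v \<in> S" and 1: "u \<odot>\<^bsub>M\<^esub> (t \<odot>\<^bsub>M\<^esub> x) = u \<odot>\<^bsub>M\<^esub> (s \<odot>\<^bsub>M\<^esub> y)"
      and 2: "v \<odot>\<^bsub>M\<^esub> (r \<odot>\<^bsub>M\<^esub> y) = v \<odot>\<^bsub>M\<^esub> (t \<odot>\<^bsub>M\<^esub> z)"
      by (auto simp: loc_rel_def)
    have "(u \<otimes> v \<otimes> t) \<odot>\<^bsub>M\<^esub> (r \<odot>\<^bsub>M\<^esub> x) = (v \<otimes> r) \<odot>\<^bsub>M\<^esub> (u \<odot>\<^bsub>M\<^esub> (t \<odot>\<^bsub>M\<^esub> x))"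
      using * by (simp add: m_ac flip: smult_assoc1)
    also have "\<dots> = (u \<otimes> s) \<odot>\<^bsub>M\<^esub> (v \<odot>\<^bsub>M\<^esub> (r \<odot>\<^bsub>M\<^esub> y))"
      unfolding 1 using * by (simp add: m_ac flip: smult_assoc1)
    also have "\<dots> = (u \<otimes> v \<otimes> t) \<odot>\<^bsub>M\<^esub> (s \<odot>\<^bsub>M\<^esub> z)"
      unfolding 2 using * by (simp add: m_ac flip: smult_assoc1)
    finally show "((x, s), (z, r)) \<in> loc_rel R M S"
      using * S_mult by (auto simp: loc_rel_def)
  qed
qed

abbreviation L where "L \<equiv> localization R M S"

definition fraction :: "'c \<Rightarrow> 'a \<Rightarrow> ('c \<times> 'a) set"
  where "fraction x s = loc_rel R M S `` {(x, s)}"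

lemma fraction_eqI:
  assumes "x \<in> carrier M" "y \<in> carrier M" "s \<in> S" "t \<in> S" "u \<in> S"
    "u \<odot>\<^bsub>M\<^esub> (t \<odot>\<^bsub>M\<^esub> x) = u \<odot>\<^bsub>M\<^esub> (s \<odot>\<^bsub>M\<^esub> y)"
  shows "fraction x s = fraction y t"
  unfolding fraction_def using assms
  by (intro equiv_class_eq[OF equiv_loc_rel]) (auto simp: loc_rel_def)

lemma fraction_eqI_cross:
  assumes "x \<in> carrier M" "y \<in> carrier M" "s \<in> S" "t \<in> S" "t \<odot>\<^bsub>M\<^esub> x = s \<odot>\<^bsub>M\<^esub> y"
  shows "fraction x s = fraction y t"
  using assms S_one by (intro fraction_eqI[of x y s t \<one>]) auto

lemma mem_fraction_iff:
  assumes "x \<in> carrier M" "s \<in> S"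
  shows "(y, t) \<in> fraction x s \<longleftrightarrow> y \<in> carrier M \<and> t \<in> S \<and>
    (\<exists>u\<in>S. u \<odot>\<^bsub>M\<^esub> (t \<odot>\<^bsub>M\<^esub> x) = u \<odot>\<^bsub>M\<^esub> (s \<odot>\<^bsub>M\<^esub> y))"
  using assms by (auto simp: fraction_def loc_rel_def)

lemma fraction_self: "x \<in> carrier M \<Longrightarrow> s \<in> S \<Longrightarrow> (x, s) \<in> fraction x s"
  unfolding fraction_def using equiv_class_self[OF equiv_loc_rel] by auto

lemma carrier_L: "carrier L = {fraction x s | x s. x \<in> carrier M \<and> s \<in> S}"
  by (auto simp: localization_def quotient_def fraction_def)

lemma fraction_closed [simp, intro]: "x \<in> carrier M \<Longrightarrow> s \<in> S \<Longrightarrow> fraction x s \<in> carrier L"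
  by (auto simp: carrier_L)

lemma carrier_LE:
  assumes "C \<in> carrier L"
  obtains x s where "x \<in> carrier M" "s \<in> S" "C = fraction x s"
  using assms by (auto simp: carrier_L)

text \<open>
  Addition, scalar multiplication and the transition maps of localizations are unions over all
  representatives. Such a union is computed by one representative if the result is the same
  for equivalent ones.
\<close>

lemma UN_fraction_const:
  assumes "x \<in> carrier M" "s \<in> S"
    and "\<And>y t u. y \<in> carrier M \<Longrightarrow> t \<in> S \<Longrightarrow> u \<in> S \<Longrightarrow>
      u \<odot>\<^bsub>M\<^esub> (t \<odot>\<^bsub>M\<^esub> x) = u \<odot>\<^bsub>M\<^esub> (s \<odot>\<^bsub>M\<^esub> y) \<Longrightarrow> f y t = f x s"
  shows "(\<Union>(y, t)\<in>fraction x s. f y t) = f x s"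
proof -
  have "(case p of (y, t) \<Rightarrow> f y t) = f x s" if p: "p \<in> fraction x s" for p
  proof -
    obtain y t where yt: "p = (y, t)"
      by (rule prod.exhaust)
    obtain u where "y \<in> carrier M" "t \<in> S" "u \<in> S" "u \<odot>\<^bsub>M\<^esub> (t \<odot>\<^bsub>M\<^esub> x) = u \<odot>\<^bsub>M\<^esub> (s \<odot>\<^bsub>M\<^esub> y)"
      using p[unfolded yt] mem_fraction_iff[OF assms(1,2)] by blast
    then show ?thesis
      unfolding yt prod.case by (rule assms(3))
  qed
  moreover have "fraction x s \<noteq> {}"
    using fraction_self[OF assms(1,2)] by auto
  ultimately show ?thesis
    by (intro SUP_eq_const)
qed

lemma zero_L: "\<zero>\<^bsub>L\<^esub> = fraction \<zero>\<^bsub>M\<^esub> \<one>"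
  by (simp add: localization_def fraction_def)

lemma fraction_zero: "s \<in> S \<Longrightarrow> fraction \<zero>\<^bsub>M\<^esub> s = \<zero>\<^bsub>L\<^esub>"
  unfolding zero_L using S_one by (intro fraction_eqI_cross) auto

lemma add_fraction:
  assumes "x \<in> carrier M" "s \<in> S" "y \<in> carrier M" "t \<in> S"
  shows "fraction x s \<oplus>\<^bsub>L\<^esub> fraction y t = fraction (t \<odot>\<^bsub>M\<^esub> x \<oplus>\<^bsub>M\<^esub> s \<odot>\<^bsub>M\<^esub> y) (s \<otimes> t)"
proof -
  have "(\<Union>(y', t')\<in>fraction y t. fraction (t' \<odot>\<^bsub>M\<^esub> x' \<oplus>\<^bsub>M\<^esub> s' \<odot>\<^bsub>M\<^esub> y') (s' \<otimes> t')) =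
      fraction (t \<odot>\<^bsub>M\<^esub> x' \<oplus>\<^bsub>M\<^esub> s' \<odot>\<^bsub>M\<^esub> y) (s' \<otimes> t)" if "x' \<in> carrier M" "s' \<in> S" for x' s'
  proof (rule UN_fraction_const[OF assms(3,4)])
    fix y' t' u
    assume *: "y' \<in> carrier M" "t' \<in> S" "u \<in> S" and eq: "u \<odot>\<^bsub>M\<^esub> (t' \<odot>\<^bsub>M\<^esub> y) = u \<odot>\<^bsub>M\<^esub> (t \<odot>\<^bsub>M\<^esub> y')"
    have "u \<odot>\<^bsub>M\<^esub> ((s' \<otimes> t) \<odot>\<^bsub>M\<^esub> (t' \<odot>\<^bsub>M\<^esub> x' \<oplus>\<^bsub>M\<^esub> s' \<odot>\<^bsub>M\<^esub> y')) =
      (u \<otimes> s' \<otimes> t \<otimes> t') \<odot>\<^bsub>M\<^esub> x' \<oplus>\<^bsub>M\<^esub> (s' \<otimes> s') \<odot>\<^bsub>M\<^esub> (u \<odot>\<^bsub>M\<^esub> (t \<odot>\<^bsub>M\<^esub> y'))"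
      using * that assms by (simp add: smult_r_distr m_ac flip: smult_assoc1)
    also have "\<dots> = u \<odot>\<^bsub>M\<^esub> ((s' \<otimes> t') \<odot>\<^bsub>M\<^esub> (t \<odot>\<^bsub>M\<^esub> x' \<oplus>\<^bsub>M\<^esub> s' \<odot>\<^bsub>M\<^esub> y))"
      unfolding eq[symmetric] using * that assms by (simp add: smult_r_distr m_ac flip: smult_assoc1)
    finally show "fraction (t' \<odot>\<^bsub>M\<^esub> x' \<oplus>\<^bsub>M\<^esub> s' \<odot>\<^bsub>M\<^esub> y') (s' \<otimes> t') =
        fraction (t \<odot>\<^bsub>M\<^esub> x' \<oplus>\<^bsub>M\<^esub> s' \<odot>\<^bsub>M\<^esub> y) (s' \<otimes> t)"
      using * that assms by (intro fraction_eqI[where u = u]) (simp_all add: S_mult)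
  qed
  note inner = this
  have outer: "(\<Union>(x', s')\<in>fraction x s. fraction (t \<odot>\<^bsub>M\<^esub> x' \<oplus>\<^bsub>M\<^esub> s' \<odot>\<^bsub>M\<^esub> y) (s' \<otimes> t)) =
      fraction (t \<odot>\<^bsub>M\<^esub> x \<oplus>\<^bsub>M\<^esub> s \<odot>\<^bsub>M\<^esub> y) (s \<otimes> t)"
  proof (rule UN_fraction_const[OF assms(1,2)])
    fix x' s' u
    assume *: "x' \<in> carrier M" "s' \<in> S" "u \<in> S" and eq: "u \<odot>\<^bsub>M\<^esub> (s' \<odot>\<^bsub>M\<^esub> x) = u \<odot>\<^bsub>M\<^esub> (s \<odot>\<^bsub>M\<^esub> x')"
    have "u \<odot>\<^bsub>M\<^esub> ((s \<otimes> t) \<odot>\<^bsub>M\<^esub> (t \<odot>\<^bsub>M\<^esub> x' \<oplus>\<^bsub>M\<^esub> s' \<odot>\<^bsub>M\<^esub> y)) =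
      (t \<otimes> t) \<odot>\<^bsub>M\<^esub> (u \<odot>\<^bsub>M\<^esub> (s \<odot>\<^bsub>M\<^esub> x')) \<oplus>\<^bsub>M\<^esub> (u \<otimes> s \<otimes> t \<otimes> s') \<odot>\<^bsub>M\<^esub> y"
      using * assms by (simp add: smult_r_distr m_ac flip: smult_assoc1)
    also have "\<dots> = u \<odot>\<^bsub>M\<^esub> ((s' \<otimes> t) \<odot>\<^bsub>M\<^esub> (t \<odot>\<^bsub>M\<^esub> x \<oplus>\<^bsub>M\<^esub> s \<odot>\<^bsub>M\<^esub> y))"
      unfolding eq[symmetric] using * assms by (simp add: smult_r_distr m_ac flip: smult_assoc1)
    finally show "fraction (t \<odot>\<^bsub>M\<^esub> x' \<oplus>\<^bsub>M\<^esub> s' \<odot>\<^bsub>M\<^esub> y) (s' \<otimes> t) = fraction (t \<odot>\<^bsub>M\<^esub> x \<oplus>\<^bsub>M\<^esub> s \<odot>\<^bsub>M\<^esub> y) (s \<otimes> t)"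
      using * assms by (intro fraction_eqI[where u = u]) (simp_all add: S_mult)
  qed
  have "(\<Union>(x', s')\<in>fraction x s. \<Union>(y', t')\<in>fraction y t. fraction (t' \<odot>\<^bsub>M\<^esub> x' \<oplus>\<^bsub>M\<^esub> s' \<odot>\<^bsub>M\<^esub> y') (s' \<otimes> t')) =
      (\<Union>(x', s')\<in>fraction x s. fraction (t \<odot>\<^bsub>M\<^esub> x' \<oplus>\<^bsub>M\<^esub> s' \<odot>\<^bsub>M\<^esub> y) (s' \<otimes> t))"
  proof (intro SUP_cong refl, clarify)
    fix x' s' assume "(x', s') \<in> fraction x s"
    then have "x' \<in> carrier M" "s' \<in> S"
      using mem_fraction_iff[OF assms(1,2)] by blast+
    then show "(\<Union>(y', t')\<in>fraction y t. fraction (t' \<odot>\<^bsub>M\<^esub> x' \<oplus>\<^bsub>M\<^esub> s' \<odot>\<^bsub>M\<^esub> y') (s' \<otimes> t')) =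
      fraction (t \<odot>\<^bsub>M\<^esub> x' \<oplus>\<^bsub>M\<^esub> s' \<odot>\<^bsub>M\<^esub> y) (s' \<otimes> t)"
      by (rule inner)
  qed
  with outer have "(\<Union>(x', s')\<in>fraction x s. \<Union>(y', t')\<in>fraction y t. fraction (t' \<odot>\<^bsub>M\<^esub> x' \<oplus>\<^bsub>M\<^esub> s' \<odot>\<^bsub>M\<^esub> y') (s' \<otimes> t')) =
      fraction (t \<odot>\<^bsub>M\<^esub> x \<oplus>\<^bsub>M\<^esub> s \<odot>\<^bsub>M\<^esub> y) (s \<otimes> t)"
    by simp
  then show ?thesis
    by (simp add: localization_def fraction_def)
qed

lemma smult_fraction:
  assumes "a \<in> carrier R" "x \<in> carrier M" "s \<in> S"
  shows "a \<odot>\<^bsub>L\<^esub> fraction x s = fraction (a \<odot>\<^bsub>M\<^esub> x) s"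
proof -
  have "(\<Union>(x', s')\<in>fraction x s. fraction (a \<odot>\<^bsub>M\<^esub> x') s') = fraction (a \<odot>\<^bsub>M\<^esub> x) s"
  proof (rule UN_fraction_const[OF assms(2,3)])
    fix x' s' u
    assume *: "x' \<in> carrier M" "s' \<in> S" "u \<in> S" and eq: "u \<odot>\<^bsub>M\<^esub> (s' \<odot>\<^bsub>M\<^esub> x) = u \<odot>\<^bsub>M\<^esub> (s \<odot>\<^bsub>M\<^esub> x')"
    have "u \<odot>\<^bsub>M\<^esub> (s \<odot>\<^bsub>M\<^esub> (a \<odot>\<^bsub>M\<^esub> x')) = a \<odot>\<^bsub>M\<^esub> (u \<odot>\<^bsub>M\<^esub> (s \<odot>\<^bsub>M\<^esub> x'))"
      using * assms by (simp add: m_ac flip: smult_assoc1)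
    also have "\<dots> = u \<odot>\<^bsub>M\<^esub> (s' \<odot>\<^bsub>M\<^esub> (a \<odot>\<^bsub>M\<^esub> x))"
      unfolding eq[symmetric] using * assms by (simp add: m_ac flip: smult_assoc1)
    finally show "fraction (a \<odot>\<^bsub>M\<^esub> x') s' = fraction (a \<odot>\<^bsub>M\<^esub> x) s"
      using * assms by (intro fraction_eqI[where u = u]) simp_all
  qed
  then show ?thesis
    by (simp add: localization_def fraction_def)
qed

lemma add_fraction_same:
  assumes "x \<in> carrier M" "y \<in> carrier M" "s \<in> S"
  shows "fraction x s \<oplus>\<^bsub>L\<^esub> fraction y s = fraction (x \<oplus>\<^bsub>M\<^esub> y) s"
  using assms S_mult unfolding add_fraction[OF assms(1,3,2,3)]
  by (intro fraction_eqI_cross) (simp_all add: smult_r_distr smult_assoc1)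

lemma module_L: "module R L"
proof (rule moduleI)
  show "abelian_group L"
  proof (rule abelian_groupI)
    fix A B C assume "A \<in> carrier L" "B \<in> carrier L" "C \<in> carrier L"
    then show "A \<oplus>\<^bsub>L\<^esub> B \<oplus>\<^bsub>L\<^esub> C = A \<oplus>\<^bsub>L\<^esub> (B \<oplus>\<^bsub>L\<^esub> C)"
      by (elim carrier_LE) (simp add: add_fraction S_mult smult_r_distr m_ac M.a_ac flip: smult_assoc1)
  next
    fix A B assume "A \<in> carrier L" "B \<in> carrier L"
    then show "A \<oplus>\<^bsub>L\<^esub> B = B \<oplus>\<^bsub>L\<^esub> A" "A \<oplus>\<^bsub>L\<^esub> B \<in> carrier L"
      by (elim carrier_LE, simp add: add_fraction S_mult M.a_comm m_comm)+
  next
    fix A assume "A \<in> carrier L"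
    then obtain x s where A: "x \<in> carrier M" "s \<in> S" "A = fraction x s"
      by (elim carrier_LE)
    then show "\<zero>\<^bsub>L\<^esub> \<oplus>\<^bsub>L\<^esub> A = A"
      using add_fraction_same[of "\<zero>\<^bsub>M\<^esub>" x s] by (simp add: fraction_zero)
    show "\<exists>B\<in>carrier L. B \<oplus>\<^bsub>L\<^esub> A = \<zero>\<^bsub>L\<^esub>"
      using A add_fraction_same[of "\<ominus>\<^bsub>M\<^esub> x" x s] by (intro bexI[of _ "fraction (\<ominus>\<^bsub>M\<^esub> x) s"]) (auto simp: fraction_zero M.l_neg)
  qed (simp add: zero_L S_one)
next
  fix a b A assume *: "a \<in> carrier R" "b \<in> carrier R" "A \<in> carrier L"
  then obtain x s where "x \<in> carrier M" "s \<in> S" "A = fraction x s"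
    by (elim carrier_LE)
  with * show "(a \<oplus> b) \<odot>\<^bsub>L\<^esub> A = a \<odot>\<^bsub>L\<^esub> A \<oplus>\<^bsub>L\<^esub> b \<odot>\<^bsub>L\<^esub> A" "(a \<otimes> b) \<odot>\<^bsub>L\<^esub> A = a \<odot>\<^bsub>L\<^esub> (b \<odot>\<^bsub>L\<^esub> A)"
    by (simp_all add: smult_fraction add_fraction_same smult_l_distr smult_assoc1)
next
  fix a A B assume *: "a \<in> carrier R" "A \<in> carrier L" "B \<in> carrier L"
  then show "a \<odot>\<^bsub>L\<^esub> (A \<oplus>\<^bsub>L\<^esub> B) = a \<odot>\<^bsub>L\<^esub> A \<oplus>\<^bsub>L\<^esub> a \<odot>\<^bsub>L\<^esub> B"
    by (elim carrier_LE) (simp add: smult_fraction add_fraction S_mult smult_r_distr m_ac flip: smult_assoc1)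
qed (auto elim!: carrier_LE simp: smult_fraction R.cring_axioms)

lemma finsum_fraction:
  assumes "finite A" "f \<in> A \<rightarrow> carrier M" "s \<in> S"
  shows "finsum L (\<lambda>i. fraction (f i) s) A = fraction (finsum M f A) s"
  using assms(1,2)
proof induction
  interpret L: module R L by (rule module_L)
  case empty
  then show ?case
    by (simp add: fraction_zero assms(3))
next
  interpret L: module R L by (rule module_L)
  case (insert i A)
  then have "finsum L (\<lambda>i. fraction (f i) s) (insert i A) = fraction (f i) s \<oplus>\<^bsub>L\<^esub> finsum L (\<lambda>i. fraction (f i) s) A"
    using assms(3) by (intro L.M.finsum_insert) auto
  with insert assms(3) show ?case
    by (simp add: add_fraction_same M.finsum_insert Pi_iff)
qed

lemma minus_fraction:
  assumes "x \<in> carrier M" "s \<in> S"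
  shows "\<ominus>\<^bsub>L\<^esub> fraction x s = fraction (\<ominus>\<^bsub>M\<^esub> x) s"
proof -
  interpret L: module R L by (rule module_L)
  have "fraction (\<ominus>\<^bsub>M\<^esub> x) s \<oplus>\<^bsub>L\<^esub> fraction x s = \<zero>\<^bsub>L\<^esub>"
    using assms add_fraction_same[of "\<ominus>\<^bsub>M\<^esub> x" x s] by (simp add: fraction_zero M.l_neg)
  then show ?thesis
    using assms by (intro L.M.minus_equality) auto
qed

text \<open>
  If each element of \<open>M\<close> is killed by some element of \<open>S\<close>, then every fraction equals \<open>0/1\<close>.
\<close>

lemma localization_is_zero:
  assumes "\<And>x. x \<in> carrier M \<Longrightarrow> \<exists>u\<in>S. u \<odot>\<^bsub>M\<^esub> x = \<zero>\<^bsub>M\<^esub>"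
  shows "is_zero_module L"
proof -
  have "fraction x s = \<zero>\<^bsub>L\<^esub>" if x: "x \<in> carrier M" "s \<in> S" for x s
  proof -
    obtain u where u: "u \<in> S" "u \<odot>\<^bsub>M\<^esub> x = \<zero>\<^bsub>M\<^esub>"
      using assms[OF x(1)] by blast
    show ?thesis
      unfolding zero_L using x u S_one
      by (intro fraction_eqI[of x "\<zero>\<^bsub>M\<^esub>" s \<one> u]) simp_all
  qed
  then have "carrier L \<subseteq> {\<zero>\<^bsub>L\<^esub>}"
    by (intro subsetI, elim carrier_LE) simp
  moreover have "\<zero>\<^bsub>L\<^esub> \<in> carrier L"
    unfolding zero_L using S_one by simp
  ultimately show ?thesis
    unfolding is_zero_module_def by blast
qed

end

section \<open>Top Cech cohomology\<close>

lemma (in module) submodule_if_closed: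
  assumes "H \<subseteq> carrier M" "H \<noteq> {}"
    and add: "\<And>x y. x \<in> H \<Longrightarrow> y \<in> H \<Longrightarrow> x \<oplus>\<^bsub>M\<^esub> y \<in> H"
    and smult: "\<And>a x. a \<in> carrier R \<Longrightarrow> x \<in> H \<Longrightarrow> a \<odot>\<^bsub>M\<^esub> x \<in> H"
  shows "submodule H R M"
proof (rule submoduleI)
  show "\<zero>\<^bsub>M\<^esub> \<in> H"
    using assms(1,2) smult[OF R.zero_closed] by fastforce
  show "\<ominus>\<^bsub>M\<^esub> x \<in> H" if "x \<in> H" for x
    using that assms(1) smult[of "\<ominus> \<one>" x] smult_l_minus[of \<one> x] by auto
qed (use assms in auto)

lemma (in module) finsum_smult:
  assumes "finite A" "f \<in> A \<rightarrow> carrier R" "x \<in> carrier M"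
  shows "finsum R f A \<odot>\<^bsub>M\<^esub> x = finsum M (\<lambda>i. f i \<odot>\<^bsub>M\<^esub> x) A"
  using assms(1,2)
proof induction
  case (insert i A)
  then have "finsum M (\<lambda>i. f i \<odot>\<^bsub>M\<^esub> x) (insert i A) = f i \<odot>\<^bsub>M\<^esub> x \<oplus>\<^bsub>M\<^esub> finsum M (\<lambda>i. f i \<odot>\<^bsub>M\<^esub> x) A"
    using assms(3) by (intro M.finsum_insert) auto
  with insert assms(3) show ?case
    by (simp add: R.finsum_insert smult_l_distr Pi_iff)
qed (simp add: assms(3))

lemma module_prod_module:
  assumes "cring R" "\<And>i. i \<in> I \<Longrightarrow> module R (M i)"
  shows "module R (prod_module I M)"
proof -
  interpret R: cring R by fact
  have [simp]: "carrier (prod_module I M) = (\<Pi>\<^sub>E i\<in>I. carrier (M i))"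
    "\<zero>\<^bsub>prod_module I M\<^esub> = (\<lambda>i\<in>I. \<zero>\<^bsub>M i\<^esub>)"
    "f \<oplus>\<^bsub>prod_module I M\<^esub> g = (\<lambda>i\<in>I. f i \<oplus>\<^bsub>M i\<^esub> g i)"
    "a \<odot>\<^bsub>prod_module I M\<^esub> f = (\<lambda>i\<in>I. a \<odot>\<^bsub>M i\<^esub> f i)" for f g a
    by (simp_all add: prod_module_def)
  note [simp] = module.axioms(2)[OF assms(2)] abelian_group.axioms(1)[OF module.axioms(2)[OF assms(2)]]
  show ?thesis
  proof (rule moduleI)
    show "abelian_group (prod_module I M)"
    proof (rule abelian_groupI)
      fix f assume f: "f \<in> carrier (prod_module I M)"
      then show "\<exists>g\<in>carrier (prod_module I M). g \<oplus>\<^bsub>prod_module I M\<^esub> f = \<zero>\<^bsub>prod_module I M\<^esub>"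
        by (intro bexI[of _ "\<lambda>i\<in>I. \<ominus>\<^bsub>M i\<^esub> f i"])
          (auto simp: PiE_iff abelian_group.l_neg abelian_group.a_inv_closed intro!: restrict_ext)
      show "\<zero>\<^bsub>prod_module I M\<^esub> \<oplus>\<^bsub>prod_module I M\<^esub> f = f"
        using f by (auto simp: PiE_iff abelian_monoid.l_zero fun_eq_iff extensional_def)
    next
      fix f g h
      assume fgh: "f \<in> carrier (prod_module I M)" "g \<in> carrier (prod_module I M)" "h \<in> carrier (prod_module I M)"
      then show "f \<oplus>\<^bsub>prod_module I M\<^esub> g \<oplus>\<^bsub>prod_module I M\<^esub> h = f \<oplus>\<^bsub>prod_module I M\<^esub> (g \<oplus>\<^bsub>prod_module I M\<^esub> h)"
        by (auto simp: PiE_iff abelian_monoid.a_assoc intro!: restrict_ext)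
      show "f \<oplus>\<^bsub>prod_module I M\<^esub> g = g \<oplus>\<^bsub>prod_module I M\<^esub> f"
        using fgh by (auto simp: PiE_iff abelian_monoid.a_comm intro!: restrict_ext)
    qed (auto simp: PiE_iff abelian_monoid.a_closed abelian_monoid.zero_closed)
  qed (auto simp: PiE_iff assms(1) module.smult_closed[OF assms(2)] module.smult_l_distr[OF assms(2)]
      module.smult_r_distr[OF assms(2)] module.smult_assoc1[OF assms(2)] module.smult_one[OF assms(2)]
      fun_eq_iff extensional_def)
qed

text \<open>
  The Cech complex only uses localizations \<open>M\<^sub>y\<close> at the powers of one element, where a fraction is
  determined by a numerator and an exponent.
\<close>

locale power_localization = module R M
  for R :: "('a, 'm) ring_scheme" (structure) and M :: "('a, 'c) module" (structure)
begin

lemma localized_powers: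
  assumes "y \<in> carrier R"
  shows "localized_module R M (powers R y)"
proof
  show "powers R y \<subseteq> carrier R"
    using assms by (auto simp: powers_def)
  show "\<one> \<in> powers R y"
    unfolding powers_def by (rule CollectI, rule exI[of _ 0]) simp
  show "s \<otimes> t \<in> powers R y" if "s \<in> powers R y" "t \<in> powers R y" for s t
    using that assms unfolding powers_def by (auto, metis R.nat_pow_mult)
qed

lemma power_in_powers [simp]: "y [^] (n::nat) \<in> powers R y"
  by (auto simp: powers_def)

definition frac_pow :: "'a \<Rightarrow> 'c \<Rightarrow> nat \<Rightarrow> ('c \<times> 'a) set"
  where "frac_pow y x n = localized_module.fraction R M (powers R y) x (y [^] n)"

lemma localization_powersE:
  assumes "y \<in> carrier R" "A \<in> carrier (localization R M (powers R y))"
  obtains x n where "x \<in> carrier M" "A = frac_pow y x n"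
proof -
  interpret L: localized_module R M "powers R y"
    using assms(1) by (rule localized_powers)
  show ?thesis
    using assms(2) that by (elim L.carrier_LE) (auto simp: frac_pow_def powers_def)
qed

lemma frac_pow_closed:
  assumes "y \<in> carrier R" "x \<in> carrier M"
  shows "frac_pow y x n \<in> carrier (localization R M (powers R y))"
proof -
  interpret L: localized_module R M "powers R y"
    using assms(1) by (rule localized_powers)
  show ?thesis
    using assms(2) unfolding frac_pow_def by simp
qed

lemma smult_frac_pow:
  assumes "y \<in> carrier R" "x \<in> carrier M" "a \<in> carrier R"
  shows "a \<odot>\<^bsub>localization R M (powers R y)\<^esub> frac_pow y x n = frac_pow y (a \<odot>\<^bsub>M\<^esub> x) n"
proof -
  interpret L: localized_module R M "powers R y"
    using assms(1) by (rule localized_powers)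
  show ?thesis
    using assms unfolding frac_pow_def by (simp add: L.smult_fraction)
qed

lemma minus_frac_pow:
  assumes "y \<in> carrier R" "x \<in> carrier M"
  shows "\<ominus>\<^bsub>localization R M (powers R y)\<^esub> frac_pow y x n = frac_pow y (\<ominus>\<^bsub>M\<^esub> x) n"
proof -
  interpret L: localized_module R M "powers R y"
    using assms(1) by (rule localized_powers)
  show ?thesis
    using assms unfolding frac_pow_def by (simp add: L.minus_fraction)
qed

text \<open>
  The relation \<open>x/y\<^sup>n = y\<^sup>N x/y\<^bsup>n+N\<^esup>\<close>, which serves both for common denominators and for passing to a
  later stage of the direct limit.
\<close>

lemma frac_pow_expand:
  assumes "y \<in> carrier R" "x \<in> carrier M"
  shows "frac_pow y x n = frac_pow y ((y [^] N) \<odot>\<^bsub>M\<^esub> x) (n + N)"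
proof -
  interpret L: localized_module R M "powers R y"
    using assms(1) by (rule localized_powers)
  have "(y [^] (n + N)) \<odot>\<^bsub>M\<^esub> x = (y [^] n) \<odot>\<^bsub>M\<^esub> ((y [^] N) \<odot>\<^bsub>M\<^esub> x)"
    using assms by (simp add: R.nat_pow_mult[symmetric] smult_assoc1)
  with assms show ?thesis
    unfolding frac_pow_def by (intro L.fraction_eqI_cross) simp_all
qed

lemma loc_map_frac_pow:
  assumes "y \<in> carrier R" "z \<in> carrier R" "x \<in> carrier M"
  shows "loc_map R M y z (frac_pow y x n) = frac_pow (y \<otimes> z) ((z [^] n) \<odot>\<^bsub>M\<^esub> x) n"
proof -
  interpret L: localized_module R M "powers R y"
    using assms(1) by (rule localized_powers)
  interpret L': localized_module R M "powers R (y \<otimes> z)"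
    using assms by (intro localized_powers) simp
  have const: "frac_pow (y \<otimes> z) ((z [^] n') \<odot>\<^bsub>M\<^esub> x') n' = frac_pow (y \<otimes> z) ((z [^] n) \<odot>\<^bsub>M\<^esub> x) n"
    if "(x', y [^] n') \<in> frac_pow y x n" for x' and n' :: nat
  proof -
    obtain u where x': "x' \<in> carrier M" and u: "u \<in> powers R y"
      "u \<odot>\<^bsub>M\<^esub> ((y [^] n') \<odot>\<^bsub>M\<^esub> x) = u \<odot>\<^bsub>M\<^esub> ((y [^] n) \<odot>\<^bsub>M\<^esub> x')"
      using \<open>(x', y [^] n') \<in> frac_pow y x n\<close> L.mem_fraction_iff[of x "y [^] n" x' "y [^] n'"] assms(3)
      unfolding frac_pow_def by auto
    then obtain k :: nat where k: "u = y [^] k"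
      by (auto simp: powers_def)
    let ?w = "z [^] k \<otimes> z [^] n \<otimes> z [^] n'"
    have "((y \<otimes> z) [^] k) \<odot>\<^bsub>M\<^esub> (((y \<otimes> z) [^] n) \<odot>\<^bsub>M\<^esub> ((z [^] n') \<odot>\<^bsub>M\<^esub> x')) =
      ?w \<odot>\<^bsub>M\<^esub> (u \<odot>\<^bsub>M\<^esub> ((y [^] n) \<odot>\<^bsub>M\<^esub> x'))"
      using assms x' by (simp add: k R.nat_pow_distrib R.m_ac flip: smult_assoc1)
    also have "\<dots> = ((y \<otimes> z) [^] k) \<odot>\<^bsub>M\<^esub> (((y \<otimes> z) [^] n') \<odot>\<^bsub>M\<^esub> ((z [^] n) \<odot>\<^bsub>M\<^esub> x))"
      unfolding u(2)[symmetric] using assms x'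
      by (simp add: k R.nat_pow_distrib R.m_ac flip: smult_assoc1)
    finally show ?thesis
      using assms x' unfolding frac_pow_def
      by (intro L'.fraction_eqI[of _ _ _ _ "(y \<otimes> z) [^] k"]) simp_all
  qed
  define D where "D = {(x', n' :: nat). (x', y [^] n') \<in> frac_pow y x n}"
  have "(x, y [^] n) \<in> frac_pow y x n"
    using L.fraction_self[of x "y [^] n"] assms(3) by (simp add: frac_pow_def)
  then have "(x, n) \<in> D"
    by (simp add: D_def)
  have "loc_map R M y z (frac_pow y x n) =
    (\<Union>p\<in>D. case p of (x', n') \<Rightarrow> frac_pow (y \<otimes> z) ((z [^] n') \<odot>\<^bsub>M\<^esub> x') n')"
    by (simp add: loc_map_def frac_pow_def L'.fraction_def D_def)
  also have "\<dots> = frac_pow (y \<otimes> z) ((z [^] n) \<odot>\<^bsub>M\<^esub> x) n"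
  proof (rule SUP_eq_const)
    show "D \<noteq> {}"
      using \<open>(x, n) \<in> D\<close> by blast
  next
    fix p assume "p \<in> D"
    then show "(case p of (x', n') \<Rightarrow> frac_pow (y \<otimes> z) ((z [^] n') \<odot>\<^bsub>M\<^esub> x') n') =
        frac_pow (y \<otimes> z) ((z [^] n) \<odot>\<^bsub>M\<^esub> x) n"
      using const[of "fst p" "snd p"] by (simp add: D_def case_prod_beta)
  qed
  finally show ?thesis .
qed

lemma loc_map_closed:
  assumes "y \<in> carrier R" "z \<in> carrier R" "A \<in> carrier (localization R M (powers R y))"
  shows "loc_map R M y z A \<in> carrier (localization R M (powers R (y \<otimes> z)))"
proof -
  obtain x n where "x \<in> carrier M" "A = frac_pow y x n"
    using assms(1,3) by (rule localization_powersE)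
  with assms(1,2) show ?thesis
    by (simp add: loc_map_frac_pow frac_pow_closed)
qed

lemma loc_map_smult:
  assumes "y \<in> carrier R" "z \<in> carrier R" "A \<in> carrier (localization R M (powers R y))" "a \<in> carrier R"
  shows "loc_map R M y z (a \<odot>\<^bsub>localization R M (powers R y)\<^esub> A) =
    a \<odot>\<^bsub>localization R M (powers R (y \<otimes> z))\<^esub> loc_map R M y z A"
proof -
  obtain x n where "x \<in> carrier M" "A = frac_pow y x n"
    using assms(1,3) by (rule localization_powersE)
  with assms(1,2,4) show ?thesis
    by (simp add: loc_map_frac_pow smult_frac_pow R.m_comm flip: smult_assoc1)
qed

lemma loc_map_add:
  assumes "y \<in> carrier R" "z \<in> carrier R"
    "A \<in> carrier (localization R M (powers R y))" "B \<in> carrier (localization R M (powers R y))"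
  shows "loc_map R M y z (A \<oplus>\<^bsub>localization R M (powers R y)\<^esub> B) =
    loc_map R M y z A \<oplus>\<^bsub>localization R M (powers R (y \<otimes> z))\<^esub> loc_map R M y z B"
proof -
  interpret L: localized_module R M "powers R y"
    using assms(1) by (rule localized_powers)
  interpret L': localized_module R M "powers R (y \<otimes> z)"
    using assms by (intro localized_powers) simp
  obtain a n where A: "a \<in> carrier M" "A = frac_pow y a n"
    using assms(1,3) by (rule localization_powersE)
  obtain b m where B: "b \<in> carrier M" "B = frac_pow y b m"
    using assms(1,4) by (rule localization_powersE)
  define a' b' k where "a' = (y [^] m) \<odot>\<^bsub>M\<^esub> a" and "b' = (y [^] n) \<odot>\<^bsub>M\<^esub> b" and "k = n + m"
  have AB: "a' \<in> carrier M" "b' \<in> carrier M" "A = frac_pow y a' k" "B = frac_pow y b' k"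
    using A B assms frac_pow_expand[of y a n m] frac_pow_expand[of y b m n]
    by (simp_all add: a'_def b'_def k_def add.commute)
  have "A \<oplus>\<^bsub>localization R M (powers R y)\<^esub> B = frac_pow y (a' \<oplus>\<^bsub>M\<^esub> b') k"
    using AB by (simp add: frac_pow_def L.add_fraction_same)
  then have "loc_map R M y z (A \<oplus>\<^bsub>localization R M (powers R y)\<^esub> B) =
      frac_pow (y \<otimes> z) ((z [^] k) \<odot>\<^bsub>M\<^esub> a' \<oplus>\<^bsub>M\<^esub> (z [^] k) \<odot>\<^bsub>M\<^esub> b') k"
    using AB assms by (simp add: loc_map_frac_pow smult_r_distr)
  also have "\<dots> = frac_pow (y \<otimes> z) ((z [^] k) \<odot>\<^bsub>M\<^esub> a') k \<oplus>\<^bsub>localization R M (powers R (y \<otimes> z))\<^esub>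
      frac_pow (y \<otimes> z) ((z [^] k) \<odot>\<^bsub>M\<^esub> b') k"
    using AB(1,2) assms by (simp add: frac_pow_def L'.add_fraction_same)
  also have "\<dots> = loc_map R M y z A \<oplus>\<^bsub>localization R M (powers R (y \<otimes> z))\<^esub> loc_map R M y z B"
    using AB assms by (simp add: loc_map_frac_pow)
  finally show ?thesis .
qed

end

locale cech_complex = power_localization R M
  for R :: "('a, 'm) ring_scheme" (structure) and M :: "('a, 'c) module" (structure) +
  fixes xs :: "'a list"
  assumes xs: "set xs \<subseteq> carrier R"
begin

abbreviation y :: "nat set \<Rightarrow> 'a" where "y \<equiv> subseq_prod R xs"

abbreviation C :: "nat set \<Rightarrow> ('a, ('c \<times> 'a) set) module" where "C \<equiv> cech_component R M xs"

abbreviation subsets :: "nat \<Rightarrow> nat set set" where "subsets p \<equiv> nsets {..<length xs} p"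

lemma nth_carrier [simp]: "i < length xs \<Longrightarrow> xs ! i \<in> carrier R"
  using xs nth_mem by blast

lemma subsetsD:
  assumes "T \<in> subsets p"
  shows "finite T" "T \<subseteq> {..<length xs}" "card T = p"
  using assms by (auto simp: nsets_def)

lemma subsets_top: "subsets (length xs) = {{..<length xs}}"
proof -
  have "S = {..<length xs}" if "S \<in> subsets (length xs)" for S
    using subsetsD[OF that] by (intro card_subset_eq) simp_all
  then show ?thesis
    by (auto simp: nsets_def)
qed

lemma y_closed: "T \<subseteq> {..<length xs} \<Longrightarrow> y T \<in> carrier R"
  unfolding subseq_prod_def by (intro R.finprod_closed) auto

lemma y_remove:
  assumes "T \<subseteq> {..<length xs}" "i \<in> T"
  shows "y T = y (T - {i}) \<otimes> xs ! i"
proof -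
  have "finite T"
    using assms(1) finite_subset by blast
  have "y T = y (insert i (T - {i}))"
    using assms(2) by (simp add: insert_absorb)
  also have "\<dots> = xs ! i \<otimes> y (T - {i})"
    unfolding subseq_prod_def using assms \<open>finite T\<close> by (intro R.finprod_insert) auto
  also have "\<dots> = y (T - {i}) \<otimes> xs ! i"
    using assms y_closed[of "T - {i}"] by (intro R.m_comm) auto
  finally show ?thesis .
qed

lemma module_C: "T \<subseteq> {..<length xs} \<Longrightarrow> module R (C T)"
  unfolding cech_component_def by (intro localized_module.module_L localized_powers y_closed)

lemma module_cech: "module R (cech_module R M xs p)"
  unfolding cech_module_def
  by (intro module_prod_module module_C R.cring_axioms) (simp add: subsetsD)

lemma cech_module_simps:
  "carrier (cech_module R M xs p) = (\<Pi>\<^sub>E T\<in>subsets p. carrier (C T))"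
  "f \<oplus>\<^bsub>cech_module R M xs p\<^esub> g = (\<lambda>T\<in>subsets p. f T \<oplus>\<^bsub>C T\<^esub> g T)"
  "a \<odot>\<^bsub>cech_module R M xs p\<^esub> f = (\<lambda>T\<in>subsets p. a \<odot>\<^bsub>C T\<^esub> f T)"
  by (simp_all add: cech_module_def prod_module_def)

text \<open>
  The signed component of the Cech differential that leads from \<open>T - {i}\<close> to \<open>T\<close>.
\<close>

definition face :: "nat set \<Rightarrow> nat \<Rightarrow> ('c \<times> 'a) set \<Rightarrow> ('c \<times> 'a) set"
  where "face T i A = position_sign (C T) T i (loc_map R M (y (T - {i})) (xs ! i) A)"

lemma cech_diff_face:
  "cech_diff R M xs p f = (\<lambda>T\<in>subsets (Suc p). finsum (C T) (\<lambda>i. face T i (f (T - {i}))) T)"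
  by (simp add: cech_diff_def face_def)

lemma face:
  assumes "T \<subseteq> {..<length xs}" "i \<in> T" "A \<in> carrier (C (T - {i}))" "B \<in> carrier (C (T - {i}))"
    "a \<in> carrier R"
  shows "face T i A \<in> carrier (C T)"
    and "face T i (A \<oplus>\<^bsub>C (T - {i})\<^esub> B) = face T i A \<oplus>\<^bsub>C T\<^esub> face T i B"
    and "face T i (a \<odot>\<^bsub>C (T - {i})\<^esub> A) = a \<odot>\<^bsub>C T\<^esub> face T i A"
proof -
  interpret C: module R "C T"
    using assms(1) by (rule module_C)
  have carr: "y (T - {i}) \<in> carrier R" "xs ! i \<in> carrier R"
    using assms(1,2) by (auto intro!: y_closed)
  note rem = y_remove[OF assms(1,2)]
  have lm: "loc_map R M (y (T - {i})) (xs ! i) D \<in> carrier (C T)" if "D \<in> carrier (C (T - {i}))" for D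
    using loc_map_closed[OF carr] that unfolding cech_component_def rem by blast
  show "face T i A \<in> carrier (C T)"
    using lm[OF assms(3)] by (simp add: face_def position_sign_def)
  have "loc_map R M (y (T - {i})) (xs ! i) (A \<oplus>\<^bsub>C (T - {i})\<^esub> B) =
      loc_map R M (y (T - {i})) (xs ! i) A \<oplus>\<^bsub>C T\<^esub> loc_map R M (y (T - {i})) (xs ! i) B"
    using loc_map_add[OF carr] assms(3,4) unfolding cech_component_def rem by blast
  then show "face T i (A \<oplus>\<^bsub>C (T - {i})\<^esub> B) = face T i A \<oplus>\<^bsub>C T\<^esub> face T i B"
    using lm[OF assms(3)] lm[OF assms(4)] by (simp add: face_def position_sign_def C.M.minus_add)
  have "loc_map R M (y (T - {i})) (xs ! i) (a \<odot>\<^bsub>C (T - {i})\<^esub> A) =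
      a \<odot>\<^bsub>C T\<^esub> loc_map R M (y (T - {i})) (xs ! i) A"
    using loc_map_smult[OF carr] assms(3,5) unfolding cech_component_def rem by blast
  then show "face T i (a \<odot>\<^bsub>C (T - {i})\<^esub> A) = a \<odot>\<^bsub>C T\<^esub> face T i A"
    using lm[OF assms(3)] assms(5) by (simp add: face_def position_sign_def C.smult_r_minus)
qed

lemma remove_in_subsets:
  assumes "T \<in> subsets (Suc p)" "i \<in> T"
  shows "T - {i} \<in> subsets p"
  using assms by (auto simp: nsets_def)

text \<open>
  The differential is linear, componentwise in each localization, so its image is a submodule.
\<close>

lemma coboundaries_submodule:
  "submodule (cech_coboundaries R M xs (Suc p)) R (cech_module R M xs (Suc p))"
proof -
  interpret K: module R "cech_module R M xs p"
    by (rule module_cech)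
  interpret K': module R "cech_module R M xs (Suc p)"
    by (rule module_cech)
  let ?d = "cech_diff R M xs p"
  have comp: "f (T - {i}) \<in> carrier (C (T - {i}))"
    if "f \<in> carrier (cech_module R M xs p)" "T \<in> subsets (Suc p)" "i \<in> T" for f T i
    using that remove_in_subsets[OF that(2,3)] by (simp add: cech_module_simps PiE_iff)
  have face_f: "face T i (f (T - {i})) \<in> carrier (C T)"
    if "f \<in> carrier (cech_module R M xs p)" "T \<in> subsets (Suc p)" "i \<in> T" for f T i
    using comp[OF that] face(1)[of T i _ _ \<one>] subsetsD(2)[OF that(2)] that(3) by simp
  show ?thesis
    unfolding cech_coboundaries.simps
  proof (rule K'.submodule_if_closed)
    show "?d ` carrier (cech_module R M xs p) \<subseteq> carrier (cech_module R M xs (Suc p))"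
    proof (rule image_subsetI)
      fix f assume f: "f \<in> carrier (cech_module R M xs p)"
      have "finsum (C T) (\<lambda>i. face T i (f (T - {i}))) T \<in> carrier (C T)" if "T \<in> subsets (Suc p)" for T
      proof -
        interpret C: module R "C T"
          using subsetsD(2)[OF that] by (rule module_C)
        show ?thesis
          using face_f[OF f that] by (intro C.M.finsum_closed) auto
      qed
      then show "?d f \<in> carrier (cech_module R M xs (Suc p))"
        by (simp add: cech_diff_face cech_module_simps)
    qed
    show "?d ` carrier (cech_module R M xs p) \<noteq> {}"
      using K.M.zero_closed by blast
  next
    fix z w
    assume "z \<in> ?d ` carrier (cech_module R M xs p)" "w \<in> ?d ` carrier (cech_module R M xs p)"
    then obtain f g where fg: "f \<in> carrier (cech_module R M xs p)" "g \<in> carrier (cech_module R M xs p)"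
      and zw: "z = ?d f" "w = ?d g"
      by (elim imageE)
    let ?h = "f \<oplus>\<^bsub>cech_module R M xs p\<^esub> g"
    have "finsum (C T) (\<lambda>i. face T i (?h (T - {i}))) T =
        finsum (C T) (\<lambda>i. face T i (f (T - {i}))) T \<oplus>\<^bsub>C T\<^esub> finsum (C T) (\<lambda>i. face T i (g (T - {i}))) T"
      if "T \<in> subsets (Suc p)" for T
    proof -
      interpret C: module R "C T"
        using subsetsD(2)[OF that] by (rule module_C)
      have "face T i (?h (T - {i})) = face T i (f (T - {i})) \<oplus>\<^bsub>C T\<^esub> face T i (g (T - {i}))" if i: "i \<in> T" for i
        using face(2)[OF subsetsD(2)[OF \<open>T \<in> _\<close>] i comp[OF fg(1) \<open>T \<in> _\<close> i] comp[OF fg(2) \<open>T \<in> _\<close> i] R.one_closed]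
          remove_in_subsets[OF \<open>T \<in> _\<close> i] by (simp add: cech_module_simps)
      then have "finsum (C T) (\<lambda>i. face T i (?h (T - {i}))) T =
          finsum (C T) (\<lambda>i. face T i (f (T - {i})) \<oplus>\<^bsub>C T\<^esub> face T i (g (T - {i}))) T"
        using face_f[OF fg(1) that] face_f[OF fg(2) that] by (intro C.M.finsum_cong') auto
      also have "\<dots> = finsum (C T) (\<lambda>i. face T i (f (T - {i}))) T \<oplus>\<^bsub>C T\<^esub> finsum (C T) (\<lambda>i. face T i (g (T - {i}))) T"
        using face_f[OF fg(1) that] face_f[OF fg(2) that] by (intro C.M.finsum_addf) auto
      finally show ?thesis .
    qed
    then have "z \<oplus>\<^bsub>cech_module R M xs (Suc p)\<^esub> w = ?d ?h"
      unfolding zw cech_diff_face cech_module_simps(2)[where p = "Suc p"] by (intro restrict_ext) simp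
    then show "z \<oplus>\<^bsub>cech_module R M xs (Suc p)\<^esub> w \<in> ?d ` carrier (cech_module R M xs p)"
      using fg K.M.a_closed by (intro image_eqI[of _ _ ?h])
  next
    fix a z assume a: "a \<in> carrier R" and "z \<in> ?d ` carrier (cech_module R M xs p)"
    then obtain f where f: "f \<in> carrier (cech_module R M xs p)" and z: "z = ?d f"
      by (elim imageE)
    let ?h = "a \<odot>\<^bsub>cech_module R M xs p\<^esub> f"
    have "finsum (C T) (\<lambda>i. face T i (?h (T - {i}))) T = a \<odot>\<^bsub>C T\<^esub> finsum (C T) (\<lambda>i. face T i (f (T - {i}))) T"
      if "T \<in> subsets (Suc p)" for T
    proof -
      interpret C: module R "C T"
        using subsetsD(2)[OF that] by (rule module_C)
      have "face T i (?h (T - {i})) = a \<odot>\<^bsub>C T\<^esub> face T i (f (T - {i}))" if i: "i \<in> T" for i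
        using face(3)[OF subsetsD(2)[OF \<open>T \<in> _\<close>] i comp[OF f \<open>T \<in> _\<close> i] comp[OF f \<open>T \<in> _\<close> i] a]
          remove_in_subsets[OF \<open>T \<in> _\<close> i] by (simp add: cech_module_simps)
      then have "finsum (C T) (\<lambda>i. face T i (?h (T - {i}))) T =
          finsum (C T) (\<lambda>i. a \<odot>\<^bsub>C T\<^esub> face T i (f (T - {i}))) T"
        using face_f[OF f that] a by (intro C.M.finsum_cong') auto
      also have "\<dots> = a \<odot>\<^bsub>C T\<^esub> finsum (C T) (\<lambda>i. face T i (f (T - {i}))) T"
        using face_f[OF f that] a subsetsD(1)[OF that] by (intro C.finsum_smult_ldistr[symmetric]) auto
      finally show ?thesis .
    qed
    then have "a \<odot>\<^bsub>cech_module R M xs (Suc p)\<^esub> z = ?d ?h"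
      unfolding z cech_diff_face cech_module_simps(3)[where p = "Suc p"] by (intro restrict_ext) simp
    then show "a \<odot>\<^bsub>cech_module R M xs (Suc p)\<^esub> z \<in> ?d ` carrier (cech_module R M xs p)"
      using f a K.smult_closed by (intro image_eqI[of _ _ ?h])
  qed
qed

text \<open>
  An element of the top degree is a single fraction \<open>r/Y\<^sup>n\<close> with \<open>Y = x\<^sub>1 \<cdots> x\<^sub>l\<close>. If \<open>uY\<^sup>N\<close> is the sum of
  the terms \<open>c\<^sub>i x\<^sub>i\<^bsup>n+N\<^esup>\<close>, then \<open>ur/Y\<^sup>n = uY\<^sup>N r/Y\<^bsup>n+N\<^esup>\<close> is the sum of the fractions
  \<open>c\<^sub>i r/(Y/x\<^sub>i)\<^bsup>n+N\<^esup>\<close>, the \<open>i\<close>-th of which is defined without inverting \<open>x\<^sub>i\<close>.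
\<close>

lemma top_element_is_coboundary:
  assumes len: "length xs = Suc p" and r: "r \<in> carrier M" and u: "u \<in> carrier R"
    and c: "c \<in> {..<length xs} \<rightarrow> carrier R"
    and eq: "u \<otimes> y {..<length xs} [^] N = finsum R (\<lambda>i. c i \<otimes> (xs ! i) [^] (n + N)) {..<length xs}"
  shows "(\<lambda>T\<in>subsets (Suc p). frac_pow (y {..<length xs}) (u \<odot>\<^bsub>M\<^esub> r) n)
    \<in> cech_coboundaries R M xs (Suc p)"
proof -
  let ?T = "{..<length xs}"
  let ?Y = "y ?T"
  interpret C: module R "C ?T"
    by (rule module_C) simp
  have top: "subsets (Suc p) = {?T}"
    unfolding len[symmetric] by (rule subsets_top)
  have Y: "?Y \<in> carrier R"
    by (rule y_closed) simp
  interpret L: localized_module R M "powers R ?Y"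
    using Y by (rule localized_powers)
  define e where "e i = position_sign R ?T i (c i)" for i
  have e: "e i \<in> carrier R" if "i \<in> ?T" for i
    using that c by (auto simp: e_def position_sign_def)
  \<comment> \<open>In degree p every index set omits one index i; e i carries the sign of the i-th face.\<close>
  define f where "f = (\<lambda>S\<in>subsets p. frac_pow (y S) (e (the_elem (?T - S)) \<odot>\<^bsub>M\<^esub> r) (n + N))"
  have missing: "\<exists>i\<in>?T. ?T - S = {i}" if S: "S \<in> subsets p" for S
  proof -
    have "card (?T - S) = 1"
      using subsetsD[OF S] len by (simp add: card_Diff_subset)
    then obtain i where "?T - S = {i}"
      by (metis card_1_singletonE)
    then show ?thesis
      by blast
  qed
  have f: "f \<in> carrier (cech_module R M xs p)"
    unfolding cech_module_simps f_def
  proof (rule restrict_PiE[THEN iffD2], rule Pi_I)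
    fix S assume S: "S \<in> subsets p"
    then obtain i where "i \<in> ?T" "?T - S = {i}"
      using missing by blast
    then show "frac_pow (y S) (e (the_elem (?T - S)) \<odot>\<^bsub>M\<^esub> r) (n + N) \<in> carrier (C S)"
      unfolding cech_component_def using e r y_closed[OF subsetsD(2)[OF S]]
      by (intro frac_pow_closed) simp_all
  qed
  have face_f: "face ?T i (f (?T - {i})) = frac_pow ?Y ((c i \<otimes> (xs ! i) [^] (n + N)) \<odot>\<^bsub>M\<^esub> r) (n + N)"
    if i: "i \<in> ?T" for i
  proof -
    have "?T - {i} \<in> subsets p"
      using remove_in_subsets[of ?T p i] i top by simp
    moreover have "?T - (?T - {i}) = {i}"
      using i by blast
    ultimately have "f (?T - {i}) = frac_pow (y (?T - {i})) (e i \<odot>\<^bsub>M\<^esub> r) (n + N)"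
      by (simp add: f_def)
    moreover have "y (?T - {i}) \<in> carrier R" "xs ! i \<in> carrier R" "c i \<in> carrier R"
      using i c by (auto intro: y_closed)
    ultimately show ?thesis
      using e[OF i] r y_remove[OF subset_refl i, symmetric] Y
      by (simp add: face_def loc_map_frac_pow position_sign_def e_def cech_component_def minus_frac_pow
          smult_l_minus smult_r_minus smult_assoc1[symmetric] R.r_minus R.l_minus R.m_comm)
  qed
  have cr: "(c i \<otimes> (xs ! i) [^] (n + N)) \<odot>\<^bsub>M\<^esub> r \<in> carrier M" if "i \<in> ?T" for i
  proof -
    have "c i \<in> carrier R" "xs ! i \<in> carrier R"
      using that c by (auto simp: Pi_iff)
    then show ?thesis
      using r by simp
  qed
  have "finsum (C ?T) (\<lambda>i. face ?T i (f (?T - {i}))) ?T =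
      finsum (C ?T) (\<lambda>i. frac_pow ?Y ((c i \<otimes> (xs ! i) [^] (n + N)) \<odot>\<^bsub>M\<^esub> r) (n + N)) ?T"
  proof (intro C.M.finsum_cong' refl funcsetI)
    fix i assume "i \<in> ?T"
    then show "frac_pow ?Y ((c i \<otimes> (xs ! i) [^] (n + N)) \<odot>\<^bsub>M\<^esub> r) (n + N) \<in> carrier (C ?T)"
      unfolding cech_component_def by (intro frac_pow_closed Y cr)
  qed (rule face_f)
  also have "\<dots> = frac_pow ?Y (finsum M (\<lambda>i. (c i \<otimes> (xs ! i) [^] (n + N)) \<odot>\<^bsub>M\<^esub> r) ?T) (n + N)"
    unfolding cech_component_def frac_pow_def using cr
    by (intro L.finsum_fraction) auto
  also have "finsum M (\<lambda>i. (c i \<otimes> (xs ! i) [^] (n + N)) \<odot>\<^bsub>M\<^esub> r) ?T = (u \<otimes> ?Y [^] N) \<odot>\<^bsub>M\<^esub> r"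
    unfolding eq using c r by (intro finsum_smult[symmetric]) auto
  also have "\<dots> = (?Y [^] N) \<odot>\<^bsub>M\<^esub> (u \<odot>\<^bsub>M\<^esub> r)"
    using u r Y by (simp add: R.m_comm flip: smult_assoc1)
  also have "frac_pow ?Y \<dots> (n + N) = frac_pow ?Y (u \<odot>\<^bsub>M\<^esub> r) n"
    using u r Y by (intro frac_pow_expand[symmetric]) simp_all
  finally have "cech_diff R M xs p f = (\<lambda>T\<in>subsets (Suc p). frac_pow ?Y (u \<odot>\<^bsub>M\<^esub> r) n)"
    unfolding cech_diff_face top by (intro restrict_ext) simp
  with f show ?thesis
    unfolding cech_coboundaries.simps by (metis imageI)
qed

theorem top_cech_cohomology_vanishes:
  assumes "xs \<noteq> []" and p: "primeideal P R"
    and kill: "\<And>n. \<exists>(N::nat) u c. u \<in> carrier R - P \<and> c \<in> {..<length xs} \<rightarrow> carrier R \<and>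
      u \<otimes> y {..<length xs} [^] N = finsum R (\<lambda>i. c i \<otimes> (xs ! i) [^] (n + N)) {..<length xs}"
  shows "is_zero_module (localization_at_prime R (cech_cohomology R xs (length xs) M) P)"
proof -
  interpret P: primeideal P R
    by fact
  obtain p where len: "length xs = Suc p"
    using assms(1) by (cases xs) auto
  let ?T = "{..<length xs}"
  let ?K = "cech_module R M xs (length xs)"
  let ?B = "cech_coboundaries R M xs (length xs)"
  note top = subsets_top
  interpret K: module R ?K
    by (rule module_cech)
  interpret Q: quotient_by_submodule R ?K ?B
    unfolding len by (intro quotient_by_submodule.intro module_cech coboundaries_submodule)
  have "S \<notin> subsets (Suc (length xs))" for S
    using subsetsD[of S "Suc (length xs)"] card_mono[of ?T S] by auto
  then have "subsets (Suc (length xs)) = {}"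
    by blast
  then have "cech_cocycles R M xs (length xs) = carrier ?K"
    by (simp add: cech_cocycles_def kernel_on_def cech_diff_def cech_module_def prod_module_def restrict_def)
  then have H: "cech_cohomology R xs (length xs) M = quotient_module ?K ?B"
    by (simp add: cech_cohomology_def subquotient_def)
  interpret loc: localized_module R "quotient_module ?K ?B" "carrier R - P"
  proof (rule localized_module.intro[OF Q.module_quotient], unfold_locales)
    show "\<one> \<in> carrier R - P"
      using P.I_notcarr P.one_imp_carrier by blast
    show "s \<otimes> t \<in> carrier R - P" if "s \<in> carrier R - P" "t \<in> carrier R - P" for s t
      using that P.I_prime by blast
  qed blast
  show ?thesis
    unfolding localization_at_prime_def H
  proof (rule loc.localization_is_zero)
    fix D assume "D \<in> carrier (quotient_module ?K ?B)"
    then obtain w where w: "w \<in> carrier ?K" "D = ?B +>\<^bsub>?K\<^esub> w"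
      unfolding Q.carrier_quotient by blast
    have Y: "y ?T \<in> carrier R"
      by (rule y_closed) simp
    have "w ?T \<in> carrier (localization R M (powers R (y ?T)))"
      using w(1) by (auto simp: cech_module_simps top cech_component_def)
    with Y obtain r n where r: "r \<in> carrier M" "w ?T = frac_pow (y ?T) r n"
      by (rule localization_powersE)
    obtain N u c where u: "u \<in> carrier R - P" "c \<in> ?T \<rightarrow> carrier R"
      "u \<otimes> y ?T [^] N = finsum R (\<lambda>i. c i \<otimes> (xs ! i) [^] (n + N)) ?T"
      using kill[of n] by (elim exE conjE)
    have "u \<odot>\<^bsub>?K\<^esub> w = (\<lambda>T\<in>subsets (length xs). frac_pow (y ?T) (u \<odot>\<^bsub>M\<^esub> r) n)"
      unfolding cech_module_simps top using r u(1) smult_frac_pow[OF Y r(1), of u n]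
      by (intro restrict_ext) (simp add: cech_component_def)
    then have "u \<odot>\<^bsub>?K\<^esub> w \<in> ?B"
      using top_element_is_coboundary[OF len r(1) _ u(2,3)] u(1) unfolding len by simp
    then have "u \<odot>\<^bsub>quotient_module ?K ?B\<^esub> D = \<zero>\<^bsub>quotient_module ?K ?B\<^esub>"
      using w u(1) by (simp add: Q.coset_eq_zero_iff)
    then show "\<exists>v\<in>carrier R - P. v \<odot>\<^bsub>quotient_module ?K ?B\<^esub> D = \<zero>\<^bsub>quotient_module ?K ?B\<^esub>"
      using u(1) by (intro bexI)
  qed
qed

end

text \<open>
  The form in which parameter sequences are excluded: if \<open>P\<close> contains the sequence and every class of
  the top cohomology is killed by an element outside \<open>P\<close>, then the localization at \<open>P\<close> vanishes.
\<close>

lemma (in cring) not_parameter_seq: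
  assumes "xs \<noteq> []" "primeideal P R" "set xs \<subseteq> P"
    and "\<And>n. \<exists>(N::nat) u c. u \<in> carrier R - P \<and> c \<in> {..<length xs} \<rightarrow> carrier R \<and>
      u \<otimes> (finprod R (\<lambda>i. xs ! i) {..<length xs}) [^] N =
        finsum R (\<lambda>i. c i \<otimes> (xs ! i) [^] (n + N)) {..<length xs}"
  shows "\<not> parameter_seq R xs"
proof
  interpret P: primeideal P R
    by fact
  assume param: "parameter_seq R xs"
  interpret cech_complex R "self_module R" xs
    using param module_self_module
    by (simp add: cech_complex_def cech_complex_axioms_def power_localization_def parameter_seq_def)
  have "is_zero_module (localization_at_prime R (cech_cohomology R xs (length xs) (self_module R)) P)"
    using assms(1,2,4) unfolding subseq_prod_def[symmetric] by (rule top_cech_cohomology_vanishes)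
  moreover have "Idl (set xs) \<subseteq> P"
    using assms(3) P.is_ideal by (intro genideal_minimal)
  ultimately show False
    using param assms(2) unfolding parameter_seq_def by blast
qed

section \<open>The ring k + x k[x, y] and its prime ideals\<close>

abbreviation kH :: "((nat \<times> nat) \<Rightarrow>\<^sub>0 'k::field) ring"
  where "kH \<equiv> monoid_ring H_monoid"

definition vx :: "(nat \<times> nat) \<Rightarrow>\<^sub>0 'k::field" where "vx = single (1, 0) 1"
definition vy :: "(nat \<times> nat) \<Rightarrow>\<^sub>0 'k::field" where "vy = single (0, 1) 1"

text \<open>
  This is the maximal ideal of \<open>k + x k[x, y]\<close>; it is defined as an ideal of \<open>k[x, y]\<close>, because
  closure under multiplication by \<open>y\<close> is the property that matters.
\<close>

definition XA :: "((nat \<times> nat) \<Rightarrow>\<^sub>0 'k::field) set"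
  where "XA = range ((*) vx)"

lemma vx_neq_0: "vx \<noteq> 0"
  unfolding vx_def by (metis lookup_single_eq lookup_zero zero_neq_one)

lemma carrier_kH: "f \<in> carrier kH \<longleftrightarrow> (\<forall>b>0. lookup f (0, b) = 0)"
proof -
  have "f \<in> carrier kH \<longleftrightarrow> (\<forall>a b. lookup f (a, b) \<noteq> 0 \<longrightarrow> (a, b) \<in> H_monoid)"
    by (auto simp: monoid_ring_def in_keys_iff subset_iff)
  also have "\<dots> \<longleftrightarrow> (\<forall>a b. a = 0 \<longrightarrow> b > 0 \<longrightarrow> lookup f (a, b) = 0)"
    by (intro all_cong1) (auto simp: H_monoid_altdef not_less_eq_eq)
  finally show ?thesis
    by simp
qed

lemma kH_simps [simp]:
  "monoid.mult kH = (*)" "\<one>\<^bsub>kH\<^esub> = 1" "\<zero>\<^bsub>kH\<^esub> = 0" "add kH = (+)"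
  by (simp_all add: monoid_ring_def)

interpretation kH: cring kH
  by (rule cring_monoid_ring) (auto simp: H_monoid_altdef zero_prod_def)

lemma pow_kH [simp]: "f [^]\<^bsub>kH\<^esub> (n::nat) = f ^ n"
  by (induction n) (simp_all add: kH.nat_pow_Suc mult.commute)

lemma finsum_kH: "finite I \<Longrightarrow> f \<in> I \<rightarrow> carrier kH \<Longrightarrow> finsum kH f I = sum f I"
  by (induction I rule: finite_induct) (simp_all add: kH.finsum_insert Pi_iff)

lemma finprod_kH: "finite I \<Longrightarrow> f \<in> I \<rightarrow> carrier kH \<Longrightarrow> finprod kH f I = prod f I"
  by (induction I rule: finite_induct) (simp_all add: kH.finprod_insert Pi_iff)

lemma lookup_vx_mult: "lookup (vx * f) (a, b) = (if a = 0 then 0 else lookup f (a - 1, b))"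
  by (induction f rule: poly_mapping_add_induct)
    (auto simp: vx_def distrib_left lookup_add mult_single lookup_single when_def)

text \<open>
  Division by \<open>x\<close> with remainder in \<open>k[y]\<close>.
\<close>

lemma bipoly_decompose: "\<exists>f0 g. f = f0 + vx * g \<and> (\<forall>a>0. \<forall>b. lookup f0 (a, b) = 0)"
proof (induction f rule: poly_mapping_add_induct)
  case zero
  show ?case
    by (intro exI[of _ 0]) simp
next
  case (add_single f k c)
  then obtain f0 g where *: "f = f0 + vx * g" "\<forall>a>0. \<forall>b. lookup f0 (a, b) = 0"
    by blast
  obtain a b where k: "k = (a, b)"
    by (rule prod.exhaust)
  show ?case
  proof (cases "a = 0")
    case True
    then show ?thesis
      using * k by (intro exI[of _ "f0 + single k c"] exI[of _ g]) (auto simp: lookup_add lookup_single)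
  next
    case False
    then have "single k c = vx * single (a - 1, b) c"
      by (simp add: k vx_def mult_single)
    then show ?thesis
      using * by (intro exI[of _ f0] exI[of _ "g + single (a - 1, b) c"]) (simp add: algebra_simps)
  qed
qed

lemma XA_iff: "f \<in> XA \<longleftrightarrow> (\<forall>b. lookup f (0, b) = 0)"
proof
  assume f: "\<forall>b. lookup f (0, b) = 0"
  obtain f0 g where *: "f = f0 + vx * g" "\<forall>a>0. \<forall>b. lookup f0 (a, b) = 0"
    using bipoly_decompose by blast
  have "lookup f0 (a, b) = 0" for a b
  proof (cases a)
    case 0
    have "lookup (f0 + vx * g) (0, b) = 0"
      using f *(1) by blast
    moreover have "lookup (vx * g) (0, b) = 0"
      by (simp add: lookup_vx_mult)
    ultimately show ?thesis
      using 0 unfolding lookup_add by simp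
  qed (use * in simp)
  then have "f0 = 0"
    by (intro poly_mapping_eqI) (metis lookup_zero surj_pair)
  with * show "f \<in> XA"
    by (auto simp: XA_def)
qed (auto simp: XA_def lookup_vx_mult)

lemma kH_iff: "f \<in> carrier kH \<longleftrightarrow> f - single (0, 0) (lookup f (0, 0)) \<in> XA"
  unfolding carrier_kH XA_iff by (auto simp: lookup_minus lookup_single when_def)

lemma XA_subset: "XA \<subseteq> carrier kH"
  by (auto simp: XA_iff carrier_kH)

lemma XA_mult: "f \<in> XA \<Longrightarrow> f * g \<in> XA" "f \<in> XA \<Longrightarrow> g * f \<in> XA"
proof -
  assume "f \<in> XA"
  then obtain h where "f = vx * h"
    unfolding XA_def by blast
  then have "f * g = vx * (h * g)" "g * f = vx * (h * g)"
    by (simp_all add: mult_ac)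
  then show "f * g \<in> XA" "g * f \<in> XA"
    unfolding XA_def by blast+
qed

lemma XA_add: "f \<in> XA \<Longrightarrow> g \<in> XA \<Longrightarrow> f + g \<in> XA"
  by (simp add: XA_iff lookup_add)

lemma vx_mult_in [simp, intro]: "vx * f \<in> XA" "vx * f \<in> carrier kH" "vx \<in> XA" "vx \<in> carrier kH"
proof -
  show *: "vx * f \<in> XA" "vx \<in> XA"
    unfolding XA_def by (auto intro: range_eqI[of _ _ 1])
  then show "vx * f \<in> carrier kH" "vx \<in> carrier kH"
    using XA_subset by blast+
qed

lemma lookup_mult_kH:
  assumes "f \<in> carrier kH"
  shows "lookup (f * g) (0, b) = lookup f (0, 0) * lookup g (0, b)"
proof -
  obtain h where "f - single (0, 0) (lookup f (0, 0)) = vx * h"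
    using assms unfolding kH_iff XA_def by blast
  then have f: "f = single (0, 0) (lookup f (0, 0)) + vx * h"
    by (simp add: algebra_simps)
  have "lookup (single (0, 0) c * g) (0, b) = c * lookup g (0, b)" for c
    by (induction g rule: poly_mapping_add_induct)
      (auto simp: distrib_left lookup_add mult_single lookup_single when_def)
  then show ?thesis
    by (subst f) (simp add: distrib_right lookup_add mult.assoc lookup_vx_mult)
qed

text \<open>
  The value at \<open>x = 0\<close> is multiplicative. For \<open>f\<close> in the ring it is a constant, nonzero if \<open>f\<close> is not
  in the maximal ideal, so the value of \<open>c\<close> is constant whenever that of \<open>fc\<close> is.
\<close>

lemma cofactor_in_kH:
  assumes "f \<in> carrier kH" "f \<notin> XA" "f * c \<in> carrier kH"
  shows "c \<in> carrier kH"
proof -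
  have "lookup f (0, 0) \<noteq> 0"
    using assms(1,2) unfolding carrier_kH XA_iff by (metis gr0I)
  then show ?thesis
    using assms(3) unfolding carrier_kH lookup_mult_kH[OF assms(1)] by simp
qed

lemma ideal_kHI:
  assumes "I \<subseteq> carrier kH" "0 \<in> I" "\<And>f g. f \<in> I \<Longrightarrow> g \<in> I \<Longrightarrow> f + g \<in> I"
    and "\<And>f g. f \<in> I \<Longrightarrow> g \<in> carrier kH \<Longrightarrow> g * f \<in> I"
  shows "ideal I kH"
proof -
  interpret S: module kH "self_module kH"
    by (rule kH.module_self_module)
  show ?thesis
    using assms by (intro kH.ideal_if_submodule S.submodule_if_closed) auto
qed

lemma primeideal_kHI:
  assumes "I \<subseteq> carrier kH" "0 \<in> I" "\<And>f g. f \<in> I \<Longrightarrow> g \<in> I \<Longrightarrow> f + g \<in> I"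
    and "\<And>f g. f \<in> I \<Longrightarrow> g \<in> carrier kH \<Longrightarrow> g * f \<in> I" and "1 \<notin> I"
    and "\<And>f g. f \<in> carrier kH \<Longrightarrow> g \<in> carrier kH \<Longrightarrow> f * g \<in> I \<Longrightarrow> f \<in> I \<or> g \<in> I"
  shows "primeideal I kH"
proof (rule primeidealI)
  show "ideal I kH"
    using assms(1-4) by (rule ideal_kHI)
  show "carrier kH \<noteq> I"
    using assms(5) kH.one_closed by auto
qed (use assms(6) in \<open>auto simp: kH.cring_axioms\<close>)

lemma primeideal_XA: "primeideal XA kH"
proof (rule primeideal_kHI)
  show "1 \<notin> (XA :: (nat \<times> nat \<Rightarrow>\<^sub>0 'a) set)"
    unfolding XA_iff by (auto simp: lookup_one zero_prod_def intro!: exI[of _ 0])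
  show "f \<in> XA \<or> g \<in> XA" if "f \<in> carrier kH" "g \<in> carrier kH" "f * g \<in> XA"
    for f g :: "nat \<times> nat \<Rightarrow>\<^sub>0 'a"
  proof -
    have "lookup f (0, 0) * lookup g (0, 0) = 0"
      using that(3) lookup_mult_kH[OF that(1), of g 0] unfolding XA_iff by simp
    then show ?thesis
      using that unfolding XA_iff carrier_kH by (metis gr0I mult_eq_0_iff)
  qed
  show "0 \<in> (XA :: (nat \<times> nat \<Rightarrow>\<^sub>0 'a) set)"
    by (simp add: XA_iff)
qed (simp_all add: XA_subset XA_mult XA_add)

lemma prime_dvd_ideal:
  assumes "prime_elem c" "\<not> c dvd vx"
  shows "primeideal {f \<in> carrier kH. c dvd f} kH"
proof (rule primeideal_kHI)
  show "1 \<notin> {f \<in> carrier kH. c dvd f}"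
    using assms(1) unfolding prime_elem_def by blast
  show "f + g \<in> {f \<in> carrier kH. c dvd f}" if "f \<in> {f \<in> carrier kH. c dvd f}" "g \<in> {f \<in> carrier kH. c dvd f}" for f g
    using that kH.a_closed[of f g] by simp
  show "g * f \<in> {f \<in> carrier kH. c dvd f}" if "f \<in> {f \<in> carrier kH. c dvd f}" "g \<in> carrier kH" for f g
    using that kH.m_closed[of g f] by simp
  show "f \<in> {f \<in> carrier kH. c dvd f} \<or> g \<in> {f \<in> carrier kH. c dvd f}"
    if "f \<in> carrier kH" "g \<in> carrier kH" "f * g \<in> {f \<in> carrier kH. c dvd f}" for f g
    using that prime_elem_dvd_multD[OF assms(1), of f g] by simp
qed (use kH.zero_closed in auto)

text \<open>
  A prime that contains \<open>x\<close> contains each \<open>xg\<close>, since \<open>(xg)\<^sup>2\<close> is the multiple \<open>x (xg\<^sup>2)\<close> of \<open>x\<close> in the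
  ring. Equality holds because modulo these elements every element of the ring is a constant.
\<close>

lemma prime_containing_vx:
  assumes P: "primeideal P kH" and "vx \<in> P"
  shows "P = XA"
proof -
  interpret P: primeideal P kH
    by fact
  have sub: "vx * g \<in> P" for g
  proof -
    have "vx * (vx * (g * g)) \<in> P"
      using P.I_r_closed[OF assms(2), of "vx * (g * g)"] by simp
    then have "(vx * g) * (vx * g) \<in> P"
      by (simp add: mult_ac)
    then show ?thesis
      using P.I_prime[of "vx * g" "vx * g"] by simp
  qed
  then have "XA \<subseteq> P"
    unfolding XA_def by blast
  moreover have "f \<in> XA" if f: "f \<in> P" for f
  proof (rule ccontr)
    assume "f \<notin> XA"
    have fk: "f \<in> carrier kH"
      using f P.Icarr by blast
    let ?c = "lookup f (0, 0)"
    have c: "?c \<noteq> 0"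
      using fk \<open>f \<notin> XA\<close> unfolding carrier_kH XA_iff by (metis gr0I)
    have "- 1 * (f - single (0, 0) ?c) \<in> XA"
      using fk XA_mult unfolding kH_iff by blast
    then have "f + - 1 * (f - single (0, 0) ?c) \<in> P"
      using f \<open>XA \<subseteq> P\<close> P.a_closed[of f "- 1 * (f - single (0, 0) ?c)"] by auto
    then have *: "single (0, 0) ?c \<in> P"
      by simp
    have "single (0, 0) (1 / ?c) \<in> carrier kH"
      unfolding carrier_kH by (simp add: lookup_single)
    then have "single (0, 0) (1 / ?c) * single (0, 0) ?c \<in> P"
      using P.I_l_closed[OF *] by simp
    then have "1 \<in> P"
      using c by (simp add: mult_single flip: single_one zero_prod_def)
    then show False
      using P.one_imp_carrier P.I_notcarr by simp
  qed
  ultimately show ?thesis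
    by blast
qed

text \<open>
  Elements of \<open>k[x, y]\<close> that behave like units near \<open>P\<close> are brought into the ring by a factor \<open>x\<^sup>2\<close>. One
  \<open>x\<close> would put the element into the ring, but the second is needed to keep \<open>x\<^sup>2 hc = (xc) (xh)\<close> in \<open>P\<close>.
\<close>

lemma not_in_prime_shift:
  assumes P: "primeideal P kH" and "vx \<notin> P" and "h \<in> P"
  shows "vx * vx * (1 + h * c) \<in> carrier kH - P"
proof -
  interpret P: primeideal P kH
    by fact
  have hXc: "(vx * c) * (vx * h) \<in> P"
    using P.I_l_closed[OF P.I_l_closed[OF assms(3), of vx], of "vx * c"] by simp
  have "vx * vx * (1 + h * c) \<notin> P"
  proof
    assume "vx * vx * (1 + h * c) \<in> P"
    moreover have "- 1 * ((vx * c) * (vx * h)) \<in> P"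
      using P.I_l_closed[OF hXc, of "- 1"] by (simp add: carrier_kH lookup_one lookup_uminus zero_prod_def)
    ultimately have "vx * vx * (1 + h * c) \<oplus>\<^bsub>kH\<^esub> - 1 * ((vx * c) * (vx * h)) \<in> P"
      by (rule P.a_closed)
    then have "vx * vx \<in> P"
      by (simp add: algebra_simps)
    then show False
      using P.I_prime[of vx vx] assms(2) by auto
  qed
  then show ?thesis
    by (simp add: mult.assoc)
qed

lemma (in cring) exists_prime_containing:
  assumes "ideal I R" "I \<noteq> carrier R"
  shows "\<exists>P. primeideal P R \<and> I \<subseteq> P"
proof -
  define \<A> where "\<A> = {J. ideal J R \<and> I \<subseteq> J \<and> \<one> \<notin> J}"
  have "\<one> \<notin> I"
    using assms ideal.one_imp_carrier by blast
  then have "I \<in> \<A>"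
    using assms(1) by (simp add: \<A>_def)
  have "\<exists>M\<in>\<A>. \<forall>J\<in>\<A>. M \<subseteq> J \<longrightarrow> J = M"
  proof (rule subset_Zorn_nonempty)
    fix \<C> assume ne: "\<C> \<noteq> {}" and chain: "subset.chain \<A> \<C>"
    have ideal: "ideal J R" if "J \<in> \<C>" for J
      using that chain by (auto simp: subset.chain_def \<A>_def)
    have "ideal (\<Union>\<C>) R"
    proof (rule idealI[OF ring_axioms])
      show "subgroup (\<Union>\<C>) (add_monoid R)"
      proof (rule add.subgroupI)
        show "\<Union>\<C> \<subseteq> carrier R"
          using ideal ideal.Icarr by fast
        show "\<Union>\<C> \<noteq> {}"
          using ne ideal additive_subgroup.zero_closed ideal.axioms(1) by fastforce
        show "\<ominus> a \<in> \<Union>\<C>" if "a \<in> \<Union>\<C>" for a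
          using that ideal additive_subgroup.a_inv_closed ideal.axioms(1) by fast
        fix a b assume "a \<in> \<Union>\<C>" "b \<in> \<Union>\<C>"
        then obtain J K where "J \<in> \<C>" "K \<in> \<C>" "a \<in> J" "b \<in> K"
          by blast
        moreover from this have "J \<subseteq> K \<or> K \<subseteq> J"
          using chain by (auto simp: subset.chain_def)
        ultimately obtain L where L: "L \<in> \<C>" "a \<in> L" "b \<in> L"
          by blast
        then have "a \<oplus> b \<in> L"
          using additive_subgroup.a_closed[OF ideal.axioms(1)[OF ideal[OF L(1)]]] by blast
        with L(1) show "a \<oplus> b \<in> \<Union>\<C>"
          by blast
      qed
    qed (use ideal ideal.I_l_closed ideal.I_r_closed in fast)+
    then show "\<Union>\<C> \<in> \<A>"
      using ne chain by (auto simp: subset.chain_def \<A>_def)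
  qed (use \<open>I \<in> \<A>\<close> in blast)
  then obtain M where M: "M \<in> \<A>" "\<And>J. J \<in> \<A> \<Longrightarrow> M \<subseteq> J \<Longrightarrow> J = M"
    by metis
  have "maximalideal M R"
  proof (rule maximalidealI)
    show "ideal M R" "carrier R \<noteq> M"
      using M(1) one_closed by (auto simp: \<A>_def)
    fix J assume J: "ideal J R" "M \<subseteq> J" "J \<subseteq> carrier R"
    show "J = M \<or> J = carrier R"
    proof (cases "\<one> \<in> J")
      case True
      then show ?thesis
        using J(1) ideal.one_imp_carrier by blast
    next
      case False
      then have "J \<in> \<A>"
        using J M(1) by (auto simp: \<A>_def)
      then show ?thesis
        using M(2) J(2) by blast
    qed
  qed
  then show ?thesis
    using maximalideal_prime M(1) by (auto simp: \<A>_def)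
qed

section \<open>The polynomial grade of the maximal ideal\<close>

lemma kH_constants [simp]: "0 \<in> carrier kH" "1 \<in> carrier kH" "- 1 \<in> carrier kH"
  by (simp_all add: carrier_kH lookup_uminus lookup_one zero_prod_def)

lemma kH_closed:
  "f \<in> carrier kH \<Longrightarrow> g \<in> carrier kH \<Longrightarrow> f + g \<in> carrier kH"
  "f \<in> carrier kH \<Longrightarrow> g \<in> carrier kH \<Longrightarrow> f * g \<in> carrier kH"
  using kH.a_closed[of f g] kH.m_closed[of f g] by simp_all

lemma single_mset_one: "single {#} 1 = 1"
  by (intro poly_mapping_eqI) (auto simp: lookup_single lookup_one when_def)

text \<open>
  The polynomial rings over \<open>k + x k[x, y]\<close> are compared with the monoid algebra over \<open>k[x, y]\<close> of
  the monoid of multisets: the coefficient function \<open>lookup\<close> identifies a subring of that algebra with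
  \<open>mpoly_ring kH m\<close>. The ring laws are inherited, and \<open>y\<close> becomes available as a coefficient.
\<close>

lemma mpoly_carrier_iff:
  fixes P :: "nat multiset \<Rightarrow> (nat \<times> nat \<Rightarrow>\<^sub>0 'k::field)"
  shows
  "P \<in> carrier (mpoly_ring kH m) \<longleftrightarrow>
    (\<exists>Q. P = lookup Q \<and> (\<forall>e. lookup Q e \<in> carrier kH) \<and> (\<forall>e\<in>keys Q. set_mset e \<subseteq> {..<m}))"
proof
  assume "P \<in> carrier (mpoly_ring kH m)"
  then have "P \<in> kH.indexed_pset {..<m} (carrier kH)"
    by (simp add: mpoly_ring_def)
  then show "\<exists>Q. P = lookup Q \<and> (\<forall>e. lookup Q e \<in> carrier kH) \<and> (\<forall>e\<in>keys Q. set_mset e \<subseteq> {..<m})"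
  proof (induction P rule: kH.indexed_pset.induct)
    case (indexed_const k)
    have "kH.indexed_const k = lookup (single {#} k)"
      by (auto simp: kH.indexed_const_def lookup_single when_def)
    moreover have "lookup (single {#} k) e \<in> carrier kH" for e
      using indexed_const by (simp add: lookup_single when_def)
    moreover have "set_mset e \<subseteq> {..<m}" if "e \<in> keys (single {#} k)" for e
      using that by (simp split: if_splits)
    ultimately show ?case
      by blast
  next
    case (indexed_padd P P')
    then obtain Q Q' where "P = lookup Q" "P' = lookup Q'"
      "\<forall>e. lookup Q e \<in> carrier kH" "\<forall>e. lookup Q' e \<in> carrier kH"
      "\<forall>e\<in>keys Q. set_mset e \<subseteq> {..<m}" "\<forall>e\<in>keys Q'. set_mset e \<subseteq> {..<m}"
      by blast
    then show ?case
      by (intro exI[of _ "Q + Q'"])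
        (auto simp: kH.indexed_padd_def lookup_add kH_closed dest!: subsetD[OF Poly_Mapping.keys_add])
  next
    case (indexed_pmult P i)
    then obtain Q where Q: "P = lookup Q" "\<forall>e. lookup Q e \<in> carrier kH" "\<forall>e\<in>keys Q. set_mset e \<subseteq> {..<m}"
      by blast
    have eq: "kH.indexed_pmult P i = lookup (single {#i#} 1 * Q)"
    proof
      fix e
      show "kH.indexed_pmult P i e = lookup (single {#i#} 1 * Q) e"
        unfolding Q(1) kH.indexed_pmult_def
      proof (induction Q rule: poly_mapping_add_induct)
        case (add_single f a b)
        then show ?case
          by (auto simp: distrib_left lookup_add mult_single lookup_single when_def)
      qed simp
    qed
    have "lookup (single {#i#} 1 * Q) e \<in> carrier kH" for e
      unfolding eq[symmetric] kH.indexed_pmult_def using Q kH.zero_closed by auto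
    moreover have "set_mset e \<subseteq> {..<m}" if "e \<in> keys (single {#i#} 1 * Q)" for e
    proof -
      have "i \<in># e" "e - {#i#} \<in> keys Q"
        using that unfolding in_keys_iff eq[symmetric] kH.indexed_pmult_def Q(1) by (auto split: if_splits)
      then show ?thesis
        using Q(3) indexed_pmult(2) by (metis insert_DiffM insert_subset set_mset_add_mset_insert)
    qed
    ultimately show ?case
      using eq by blast
  qed
next
  assume "\<exists>Q. P = lookup Q \<and> (\<forall>e. lookup Q e \<in> carrier kH) \<and> (\<forall>e\<in>keys Q. set_mset e \<subseteq> {..<m})"
  then obtain Q where Q: "P = lookup Q" "\<forall>e. lookup Q e \<in> carrier kH" "\<forall>e\<in>keys Q. set_mset e \<subseteq> {..<m}"
    by blast
  have mono: "lookup (single e c) \<in> kH.indexed_pset {..<m} (carrier kH)"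
    if "set_mset e \<subseteq> {..<m}" "c \<in> carrier kH" for e and c :: "nat \<times> nat \<Rightarrow>\<^sub>0 'k"
    using that(1)
  proof (induction e)
    case empty
    have "lookup (single ({#} :: nat multiset) c) = kH.indexed_const c"
      by (auto simp: kH.indexed_const_def lookup_single when_def)
    then show ?case
      using that(2) by (simp add: kH.indexed_pset.indexed_const)
  next
    case (add i e)
    have "lookup (single (add_mset i e) c) = kH.indexed_pmult (lookup (single e c)) i"
      by (auto simp: kH.indexed_pmult_def lookup_single when_def fun_eq_iff)
    then show ?case
      using add by (simp add: kH.indexed_pset.indexed_pmult)
  qed
  have "lookup Q \<in> kH.indexed_pset {..<m} (carrier kH)"
    using Q(2,3)
  proof (induction Q rule: update_induct)
    case const
    have "lookup (single {#} (0 :: nat \<times> nat \<Rightarrow>\<^sub>0 'k)) \<in> kH.indexed_pset {..<m} (carrier kH)"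
      by (rule mono) simp_all
    then show ?case
      by (simp only: single_zero)
  next
    case (update f a b)
    have eq: "Poly_Mapping.update a b f = f + single a b"
      using update(1) by (rule update_eq_add_single)
    have keys: "keys (Poly_Mapping.update a b f) = insert a (keys f)"
      using update by (simp add: Poly_Mapping.keys_update)
    have lk: "lookup f e \<in> carrier kH" for e
    proof (cases "e = a")
      case True
      then show ?thesis
        using update(1) kH.zero_closed by (simp add: in_keys_iff)
    next
      case False
      then show ?thesis
        using update(4) by (metis Poly_Mapping.lookup_update)
    qed
    have "b \<in> carrier kH"
      using update(4) by (metis Poly_Mapping.lookup_update)
    then have "kH.indexed_padd (lookup f) (lookup (single a b)) \<in> kH.indexed_pset {..<m} (carrier kH)"
      using update(3)[OF allI[OF lk]] update(5) keys mono by (intro kH.indexed_pset.indexed_padd) auto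
    then show ?case
      by (simp add: eq kH.indexed_padd_def lookup_add fun_eq_iff cong: if_cong)
  qed
  then show "P \<in> carrier (mpoly_ring kH m)"
    by (simp add: Q(1) mpoly_ring_def)
qed


definition polys :: "nat \<Rightarrow> (nat multiset \<Rightarrow>\<^sub>0 (nat \<times> nat \<Rightarrow>\<^sub>0 'k::field)) set"
  where "polys m = {Q. (\<forall>e. lookup Q e \<in> carrier kH) \<and> (\<forall>e\<in>keys Q. set_mset e \<subseteq> {..<m})}"

lemma carrier_mpoly: "carrier (mpoly_ring kH m) = lookup ` polys m"
  unfolding polys_def using mpoly_carrier_iff by blast

lemma mpoly_memI: "Q \<in> polys m \<Longrightarrow> lookup Q \<in> carrier (mpoly_ring kH m)"
  unfolding carrier_mpoly by (rule imageI)

lemma lookup_single_mult_mset: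
  "lookup (single a c * Q) e = (if a \<subseteq># e then c * lookup Q (e - a) else 0)"
  for Q :: "nat multiset \<Rightarrow>\<^sub>0 'b::comm_ring_1"
proof (induction Q rule: poly_mapping_add_induct)
  case (add_single Q b d)
  have "a + b = e \<longleftrightarrow> a \<subseteq># e \<and> b = e - a"
    by (metis add_diff_cancel_left' mset_subset_eq_add_left subset_mset.add_diff_inverse)
  then show ?case
    using add_single by (auto simp: distrib_left lookup_add mult_single lookup_single when_def)
qed simp

lemma finite_submultisets: "finite {d. d \<subseteq># (e :: 'b multiset)}"
proof (induction e)
  case (add x e)
  have "{d. d \<subseteq># add_mset x e} \<subseteq> {d. d \<subseteq># e} \<union> add_mset x ` {d. d \<subseteq># e}"
  proof
    fix d assume d: "d \<in> {d. d \<subseteq># add_mset x e}"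
    show "d \<in> {d. d \<subseteq># e} \<union> add_mset x ` {d. d \<subseteq># e}"
    proof (cases "x \<in># d")
      case True
      then obtain d' where "d = add_mset x d'"
        by (metis insert_DiffM)
      then show ?thesis
        using d by auto
    next
      case False
      then have "d \<subseteq># e"
        using d by (metis mem_Collect_eq diff_single_trivial subset_eq_diff_conv add_mset_add_single)
      then show ?thesis
        by blast
    qed
  qed
  then show ?case
    using add finite_subset by blast
qed simp

text \<open>
  The product of the monoid algebra is the convolution over submultisets by which \<open>mpoly_ring\<close> is
  defined.
\<close>

lemma lookup_mult_mset:
  "lookup (P * Q) e = (\<Sum>d | d \<subseteq># e. lookup P d * lookup Q (e - d))"
  for P Q :: "nat multiset \<Rightarrow>\<^sub>0 'b::comm_ring_1"
proof (induction P rule: poly_mapping_add_induct)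
  case (add_single P a c)
  have "(\<Sum>d | d \<subseteq># e. (c when a = d) * lookup Q (e - d)) =
      (\<Sum>d | d \<subseteq># e. if a = d then c * lookup Q (e - a) else 0)"
    by (intro sum.cong) (auto simp: when_def)
  also have "\<dots> = lookup (single a c * Q) e"
    by (simp add: finite_submultisets lookup_single_mult_mset)
  finally show ?case
    using add_single by (simp add: distrib_right lookup_add lookup_single sum.distrib)
qed simp

lemma polys_lookup: "Q \<in> polys m \<Longrightarrow> lookup Q e \<in> carrier kH"
  by (simp add: polys_def)

lemma mpoly_simps:
  "\<zero>\<^bsub>mpoly_ring kH m\<^esub> = lookup 0" "\<one>\<^bsub>mpoly_ring kH m\<^esub> = lookup 1"
  "lookup P \<oplus>\<^bsub>mpoly_ring kH m\<^esub> lookup Q = lookup (P + Q)"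
  by (auto simp: mpoly_ring_def kH.indexed_const_def kH.indexed_padd_def lookup_add lookup_one when_def)

lemma mpoly_mult:
  assumes "P \<in> polys m" "Q \<in> polys m"
  shows "lookup P \<otimes>\<^bsub>mpoly_ring kH m\<^esub> lookup Q = lookup (P * Q)"
proof
  fix e
  have "finsum kH (\<lambda>d. lookup P d * lookup Q (e - d)) {d. d \<subseteq># e} = (\<Sum>d | d \<subseteq># e. lookup P d * lookup Q (e - d))"
    using polys_lookup[OF assms(1)] polys_lookup[OF assms(2)] kH.m_closed
    by (intro finsum_kH finite_submultisets) auto
  then show "(lookup P \<otimes>\<^bsub>mpoly_ring kH m\<^esub> lookup Q) e = lookup (P * Q) e"
    by (simp add: mpoly_ring_def lookup_mult_mset)
qed

lemma polys_mult:
  assumes "P \<in> polys m" "Q \<in> polys m"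
  shows "P * Q \<in> polys m"
proof -
  have "lookup (P * Q) e \<in> carrier kH" for e
  proof -
    have "finsum kH (\<lambda>d. lookup P d * lookup Q (e - d)) {d. d \<subseteq># e} \<in> carrier kH"
      using polys_lookup[OF assms(1)] polys_lookup[OF assms(2)] kH.m_closed
      by (intro kH.finsum_closed) auto
    also have "finsum kH (\<lambda>d. lookup P d * lookup Q (e - d)) {d. d \<subseteq># e} = lookup (P * Q) e"
      unfolding lookup_mult_mset
      using polys_lookup[OF assms(1)] polys_lookup[OF assms(2)] kH.m_closed
      by (intro finsum_kH finite_submultisets) auto
    finally show ?thesis .
  qed
  moreover have "set_mset e \<subseteq> {..<m}" if e: "e \<in> keys (P * Q)" for e
  proof -
    obtain a b where "e = a + b" "a \<in> keys P" "b \<in> keys Q"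
      using e keys_mult[of P Q] by blast
    then show ?thesis
      using assms by (auto simp: polys_def)
  qed
  ultimately show ?thesis
    by (simp add: polys_def)
qed

lemma polys_add:
  assumes "P \<in> polys m" "Q \<in> polys m"
  shows "P + Q \<in> polys m"
proof -
  have "lookup (P + Q) e \<in> carrier kH" for e
    using kH.a_closed[OF polys_lookup[OF assms(1)] polys_lookup[OF assms(2)]] by (simp add: lookup_add)
  moreover have "set_mset e \<subseteq> {..<m}" if "e \<in> keys (P + Q)" for e
    using that Poly_Mapping.keys_add[of P Q] assms unfolding polys_def by blast
  ultimately show ?thesis
    by (simp add: polys_def)
qed

lemma polys_const:
  assumes "c \<in> carrier kH"
  shows "single {#} c \<in> polys m"
proof -
  have "lookup (single {#} c) e \<in> carrier kH" for e :: "nat multiset"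
    using assms by (simp add: lookup_single when_def)
  then show ?thesis
    by (simp add: polys_def)
qed

lemma polys_0: "0 \<in> polys m" and polys_1: "1 \<in> polys m"
  using polys_const[of 0 m] polys_const[of 1 m] by (simp_all add: single_mset_one)

lemma cring_mpoly: "cring (mpoly_ring kH m :: (nat multiset \<Rightarrow> (nat \<times> nat \<Rightarrow>\<^sub>0 'k::field)) ring)"
proof (rule cringI)
  let ?S = "mpoly_ring kH m :: (nat multiset \<Rightarrow> (nat \<times> nat \<Rightarrow>\<^sub>0 'k)) ring"
  show "abelian_group ?S"
  proof (rule abelian_groupI)
    fix P assume "P \<in> carrier ?S"
    then obtain Q where Q: "P = lookup Q" "Q \<in> polys m"
      by (auto simp: carrier_mpoly)
    have "single {#} (- 1) * Q \<in> polys m"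
      by (intro polys_mult polys_const Q) simp
    moreover have "single {#} (- 1) * Q + Q = 0"
      by (simp add: single_uminus single_mset_one)
    ultimately show "\<exists>P'\<in>carrier ?S. P' \<oplus>\<^bsub>?S\<^esub> P = \<zero>\<^bsub>?S\<^esub>"
      unfolding carrier_mpoly Q(1) by (intro bexI[of _ "lookup (single {#} (- 1) * Q)"]) (simp_all add: mpoly_simps)
  qed (auto simp: carrier_mpoly mpoly_simps polys_add polys_0 add.assoc add.commute)
  show "comm_monoid ?S"
    by (rule comm_monoidI) (auto simp: carrier_mpoly mpoly_simps mpoly_mult polys_mult polys_1 mult_ac)
qed (auto simp: carrier_mpoly mpoly_simps mpoly_mult polys_mult polys_add distrib_right)

text \<open>
  The polynomials whose coefficients all lie in the maximal ideal form an ideal, and that ideal contains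
  the generators of \<open>mpoly_ideal\<close>.
\<close>

lemma mpoly_ideal_XA:
  fixes P :: "nat multiset \<Rightarrow> (nat \<times> nat \<Rightarrow>\<^sub>0 'k::field)"
  assumes "P \<in> mpoly_ideal kH m XA"
  shows "\<exists>Q\<in>polys m. P = lookup Q \<and> (\<forall>e. lookup Q e \<in> XA)"
proof -
  let ?S = "mpoly_ring kH m :: (nat multiset \<Rightarrow> (nat \<times> nat \<Rightarrow>\<^sub>0 'k)) ring"
  interpret S: cring ?S
    by (rule cring_mpoly)
  interpret M: module ?S "self_module ?S"
    by (rule S.module_self_module)
  define J :: "(nat multiset \<Rightarrow> (nat \<times> nat \<Rightarrow>\<^sub>0 'k)) set" where "J = {lookup Q | Q. Q \<in> polys m \<and> (\<forall>e. lookup Q e \<in> XA)}"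
  have "0 \<in> (XA :: (nat \<times> nat \<Rightarrow>\<^sub>0 'k) set)"
    by (simp add: XA_iff)
  have JI: "lookup Q \<in> J" if "Q \<in> polys m" "\<And>e. lookup Q e \<in> XA" for Q
    using that unfolding J_def by blast
  have sum: "sum f A \<in> XA" if "finite A" "\<And>i. i \<in> A \<Longrightarrow> f i \<in> XA"
    for f :: "nat multiset \<Rightarrow> (nat \<times> nat \<Rightarrow>\<^sub>0 'k)" and A
    using that by (induction A rule: finite_induct) (auto simp: \<open>0 \<in> XA\<close> XA_add)
  have sub: "submodule J ?S (self_module ?S)"
  proof (rule M.submodule_if_closed)
    show "J \<subseteq> carrier (self_module ?S)"
      by (auto simp: J_def carrier_mpoly)
    show "J \<noteq> {}"
      using JI[OF polys_0] \<open>0 \<in> XA\<close> by auto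
    show "x \<oplus>\<^bsub>self_module ?S\<^esub> y \<in> J" if "x \<in> J" "y \<in> J" for x y
      using that unfolding J_def by (auto simp: mpoly_simps lookup_add intro!: JI[unfolded J_def] polys_add XA_add)
    show "a \<odot>\<^bsub>self_module ?S\<^esub> x \<in> J" if "a \<in> carrier ?S" "x \<in> J" for a x
    proof -
      obtain P Q where PQ: "a = lookup P" "P \<in> polys m" "x = lookup Q" "Q \<in> polys m" "\<And>e. lookup Q e \<in> XA"
        using \<open>a \<in> _\<close> \<open>x \<in> J\<close> by (auto simp: J_def carrier_mpoly)
      have "lookup (P * Q) e \<in> XA" for e
        unfolding lookup_mult_mset using PQ(5) XA_mult by (intro sum finite_submultisets) blast
      then show ?thesis
        using PQ by (simp add: mpoly_mult JI polys_mult)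
    qed
  qed
  have "ideal J ?S"
    using sub by (rule S.ideal_if_submodule)
  moreover have "kH.indexed_const ` XA \<subseteq> J"
  proof
    fix p :: "nat multiset \<Rightarrow> (nat \<times> nat \<Rightarrow>\<^sub>0 'k)" assume "p \<in> kH.indexed_const ` XA"
    then obtain c where c: "c \<in> XA" "p = kH.indexed_const c"
      by blast
    have "p = lookup (single {#} c)"
      by (auto simp: c kH.indexed_const_def lookup_single when_def)
    then show "p \<in> J"
      using c(1) XA_subset \<open>0 \<in> XA\<close> by (auto intro!: JI polys_const simp: lookup_single when_def)
  qed
  ultimately have "mpoly_ideal kH m XA \<subseteq> J"
    unfolding mpoly_ideal_def by (rule S.genideal_minimal)
  then show ?thesis
    using assms by (auto simp: J_def)
qed


lemma single_mset_mult: "lookup (single {#} c * Q) e = c * lookup Q e"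
  for Q :: "nat multiset \<Rightarrow>\<^sub>0 'b::comm_ring_1"
  by (simp add: lookup_single_mult_mset)

lemma vy_not_in_kH: "vy \<notin> carrier kH"
  by (auto simp: carrier_kH vy_def lookup_single intro!: exI[of _ 1])

text \<open>
  Let \<open>F, G\<close> be the first two entries. Since their coefficients lie in \<open>x k[x, y]\<close>, both \<open>yF\<close> and \<open>yG\<close>
  are polynomials over the ring, and \<open>G (yF) = (yG) F\<close>. Regularity of \<open>G\<close> modulo \<open>F\<close> gives \<open>yF = ZF\<close>.
  Multiplying by \<open>x\<close> turns this into an identity over the ring, where \<open>F\<close> can be cancelled, and the
  constant coefficient of \<open>xy = xZ\<close> would put \<open>y\<close> into the ring.
\<close>

lemma weak_regular_seq_in_XA:
  fixes xs :: "(nat multiset \<Rightarrow> (nat \<times> nat \<Rightarrow>\<^sub>0 'k::field)) list"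
  assumes xs: "set xs \<subseteq> mpoly_ideal kH m XA"
    and reg: "weak_regular_seq (mpoly_ring kH m) (self_module (mpoly_ring kH m)) xs"
  shows "length xs \<le> 1"
proof (rule ccontr)
  let ?S = "mpoly_ring kH m :: (nat multiset \<Rightarrow> (nat \<times> nat \<Rightarrow>\<^sub>0 'k)) ring"
  interpret S: cring ?S
    by (rule cring_mpoly)
  assume "\<not> length xs \<le> 1"
  then have len: "length xs > 1" "0 < length xs"
    by auto
  obtain F where F: "F \<in> polys m" "xs ! 0 = lookup F" "\<And>e. lookup F e \<in> XA"
    using mpoly_ideal_XA[of "xs ! 0" m] xs nth_mem[OF len(2)] by blast
  obtain G where G: "G \<in> polys m" "xs ! 1 = lookup G" "\<And>e. lookup G e \<in> XA"
    using mpoly_ideal_XA[of "xs ! 1" m] xs nth_mem[OF len(1)] by blast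
  have regI: "z \<in> Idl\<^bsub>?S\<^esub> (set (take i xs))"
    if "i < length xs" "z \<in> carrier ?S" "xs ! i \<otimes>\<^bsub>?S\<^esub> z \<in> Idl\<^bsub>?S\<^esub> (set (take i xs))" for i z
    using reg that unfolding S.weak_regular_seq_self_iff by blast
  have nzd: "Z = 0" if "Z \<in> polys m" "F * Z = 0" for Z
  proof -
    have Idl: "Idl\<^bsub>?S\<^esub> (set (take 0 xs)) = {lookup 0}"
      by (simp only: take_0 list.set S.genideal_empty mpoly_simps)
    have "xs ! 0 \<otimes>\<^bsub>?S\<^esub> lookup Z = lookup 0"
      by (simp only: F(2) mpoly_mult[OF F(1) that(1)] that(2))
    then have "xs ! 0 \<otimes>\<^bsub>?S\<^esub> lookup Z \<in> Idl\<^bsub>?S\<^esub> (set (take 0 xs))"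
      unfolding Idl by (rule ssubst) (rule singletonI)
    then have "lookup Z \<in> Idl\<^bsub>?S\<^esub> (set (take 0 xs))"
      by (rule regI[OF len(2) mpoly_memI[OF that(1)]])
    then show ?thesis
      unfolding Idl by (simp only: singleton_iff Poly_Mapping.lookup_inject)
  qed
  have shift: "single {#} vy * P \<in> polys m" if "P \<in> polys m" "\<And>e. lookup P e \<in> XA" for P
  proof -
    have "lookup (single {#} vy * P) e \<in> carrier kH" for e
      using XA_mult(2)[OF that(2)[of e], of vy] XA_subset by (auto simp: single_mset_mult)
    moreover have "keys (single {#} vy * P) \<subseteq> keys P"
      by (auto simp: in_keys_iff single_mset_mult)
    ultimately show ?thesis
      using that(1) by (auto simp: polys_def)
  qed
  have Idl: "Idl\<^bsub>?S\<^esub> (set (take 1 xs)) = {x \<otimes>\<^bsub>?S\<^esub> lookup F | x. x \<in> carrier ?S}"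
  proof -
    have "set (take 1 xs) = {lookup F}"
      using len F(2) by (cases xs) auto
    then show ?thesis
      using S.cgenideal_eq_genideal[OF mpoly_memI[OF F(1)]] unfolding cgenideal_def by simp
  qed
  have "lookup (single {#} vy * F) \<in> Idl\<^bsub>?S\<^esub> (set (take 1 xs))"
  proof (rule regI[OF len(1)])
    show "lookup (single {#} vy * F) \<in> carrier ?S"
      by (intro mpoly_memI shift F)
    have "xs ! 1 \<otimes>\<^bsub>?S\<^esub> lookup (single {#} vy * F) = lookup (G * (single {#} vy * F))"
      unfolding G(2) by (intro mpoly_mult shift F G)
    also have "G * (single {#} vy * F) = single {#} vy * G * F"
      by (simp only: mult_ac)
    also have "lookup (single {#} vy * G * F) = lookup (single {#} vy * G) \<otimes>\<^bsub>?S\<^esub> lookup F"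
      by (intro mpoly_mult[symmetric] shift F G)
    finally show "xs ! 1 \<otimes>\<^bsub>?S\<^esub> lookup (single {#} vy * F) \<in> Idl\<^bsub>?S\<^esub> (set (take 1 xs))"
      unfolding Idl using mpoly_memI[OF shift[OF G(1,3)]] by blast
  qed
  then obtain z where z: "z \<in> carrier ?S" "lookup (single {#} vy * F) = z \<otimes>\<^bsub>?S\<^esub> lookup F"
    unfolding Idl by blast
  then obtain Z where Z: "Z \<in> polys m" "z = lookup Z"
    unfolding carrier_mpoly by blast
  have Z2: "single {#} vy * F = Z * F"
    using z(2) unfolding Z(2) mpoly_mult[OF Z(1) F(1)] Poly_Mapping.lookup_inject .
  \<comment> \<open>The constant y is not a polynomial over the ring, so F is cancelled from the multiple by x.\<close>
  let ?D = "single {#} (vx * vy) + single {#} (- 1) * (single {#} vx * Z)"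
  have "?D \<in> polys m"
    by (intro polys_add polys_mult polys_const Z(1)) simp_all
  moreover have "F * ?D = 0"
  proof -
    have xy: "single {#} (vx * vy) = single {#} vx * single {#} vy"
      by (simp add: mult_single)
    have "F * ?D = single {#} vx * (single {#} vy * F) - single {#} vx * (Z * F)"
      unfolding xy single_uminus single_mset_one by (simp add: algebra_simps)
    then show ?thesis
      by (simp add: Z2)
  qed
  ultimately have "?D = 0"
    by (rule nzd)
  then have "lookup ?D {#} = 0"
    by simp
  then have "vx * vy = vx * lookup Z {#}"
    by (simp add: lookup_add single_mset_mult)
  then have "vy = lookup Z {#}"
    using bipoly_mult_cancel vx_neq_0 by blast
  then show False
    using polys_lookup[OF Z(1), of "{#}"] vy_not_in_kH by metis
qed

lemma classical_grade_XA:
  "classical_grade (mpoly_ring kH m :: (nat multiset \<Rightarrow> (nat \<times> nat \<Rightarrow>\<^sub>0 'k::field)) ring)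
    (mpoly_ideal kH m XA) (self_module (mpoly_ring kH m)) = 1"
proof (rule antisym)
  let ?S = "mpoly_ring kH m :: (nat multiset \<Rightarrow> (nat \<times> nat \<Rightarrow>\<^sub>0 'k)) ring"
  interpret S: cring ?S
    by (rule cring_mpoly)
  show "classical_grade ?S (mpoly_ideal kH m XA) (self_module ?S) \<le> 1"
    unfolding classical_grade_def
  proof (rule SUP_least, clarify)
    fix xs assume "set xs \<subseteq> mpoly_ideal kH m XA" "weak_regular_seq ?S (self_module ?S) xs"
    then have "length xs \<le> 1"
      by (rule weak_regular_seq_in_XA)
    then show "enat (length xs) \<le> 1"
      by (simp add: one_enat_def)
  qed
  let ?x = "lookup (single {#} vx)"
  have x: "kH.indexed_const vx = ?x"
    by (auto simp: kH.indexed_const_def lookup_single when_def)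
  have xS: "?x \<in> carrier ?S"
    by (intro mpoly_memI polys_const vx_mult_in)
  have "?x \<in> kH.indexed_const ` XA"
    using vx_mult_in(3) x by (metis imageI)
  then have "?x \<in> mpoly_ideal kH m XA"
    unfolding mpoly_ideal_def genideal_def by blast
  moreover have "weak_regular_seq ?S (self_module ?S) [?x]"
    unfolding S.weak_regular_seq_self_iff
  proof (intro conjI allI ballI impI)
    fix i z assume i: "i < length [?x]" and z: "z \<in> carrier ?S"
      and "[?x] ! i \<otimes>\<^bsub>?S\<^esub> z \<in> Idl\<^bsub>?S\<^esub> (set (take i [?x]))"
    obtain Z where Z: "Z \<in> polys m" "z = lookup Z"
      using z unfolding carrier_mpoly by blast
    have "i = 0"
      using i by simp
    then have "?x \<otimes>\<^bsub>?S\<^esub> lookup Z = lookup 0"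
      using \<open>[?x] ! i \<otimes>\<^bsub>?S\<^esub> z \<in> _\<close> unfolding Z(2) by (simp add: S.genideal_empty mpoly_simps)
    then have "lookup (single {#} vx * Z) = lookup 0"
      using mpoly_mult[OF polys_const[OF vx_mult_in(4)] Z(1)] by simp
    then have "vx * lookup Z e = 0" for e
      by (metis lookup_zero single_mset_mult)
    then have "lookup Z e = 0" for e
      using bipoly_mult_eq_0_iff vx_neq_0 by blast
    then have "Z = 0"
      by (intro poly_mapping_eqI) simp
    then show "z \<in> Idl\<^bsub>?S\<^esub> (set (take i [?x]))"
      using i Z by (simp add: S.genideal_empty mpoly_simps)
  qed (use xS in simp)
  ultimately have "enat (length [?x]) \<le> classical_grade ?S (mpoly_ideal kH m XA) (self_module ?S)"
    unfolding classical_grade_def by (intro SUP_upper2[of "[?x]"]) simp_all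
  then show "1 \<le> classical_grade ?S (mpoly_ideal kH m XA) (self_module ?S)"
    by (simp add: one_enat_def)
qed

lemma polynomial_grade_XA: "polynomial_grade kH XA = 1"
  unfolding polynomial_grade_def classical_grade_XA by (rule limI[OF tendsto_const])

section \<open>Failure of the ideal-theoretic properties\<close>

lemma XA_iff_dvd: "f \<in> XA \<longleftrightarrow> vx dvd f"
  by (auto simp: XA_def dvd_def)

lemma lookup_vy_mult: "lookup (vy * f) (a, 0) = 0"
  by (induction f rule: poly_mapping_add_induct)
    (auto simp: vy_def distrib_left lookup_add mult_single lookup_single when_def)

lemma prime_elem_vy: "prime_elem (vy :: nat \<times> nat \<Rightarrow>\<^sub>0 'k::field)"
proof -
  have "yx.to_poly (vy :: nat \<times> nat \<Rightarrow>\<^sub>0 'k) = [:[:0, 1:]:]"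
    by (simp add: vy_def yx.to_poly_single monom_0 monom_Suc)
  moreover have "prime_elem [:0, 1 :: 'k:]"
    by (rule prime_elem_linear_field_poly) simp
  ultimately show ?thesis
    by (metis lift_prime_elem_poly yx.prime_elem_to_poly_iff)
qed

lemma prime_elem_vx: "prime_elem (vx :: nat \<times> nat \<Rightarrow>\<^sub>0 'k::field)"
proof -
  have "xy.to_poly (vx :: nat \<times> nat \<Rightarrow>\<^sub>0 'k) = [:[:0, 1:]:]"
    by (simp add: vx_def xy.to_poly_single monom_0 monom_Suc)
  moreover have "prime_elem [:0, 1 :: 'k:]"
    by (rule prime_elem_linear_field_poly) simp
  ultimately show ?thesis
    by (metis lift_prime_elem_poly xy.prime_elem_to_poly_iff)
qed

lemma vy_not_dvd_vx: "\<not> vy dvd vx"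
proof
  assume "vy dvd (vx :: nat \<times> nat \<Rightarrow>\<^sub>0 'k::field)"
  then obtain h :: "nat \<times> nat \<Rightarrow>\<^sub>0 'k" where "vx = vy * h"
    by (elim dvdE)
  then have "lookup (vx :: nat \<times> nat \<Rightarrow>\<^sub>0 'k) (1, 0) = 0"
    by (metis lookup_vy_mult)
  then show False
    by (simp add: vx_def)
qed

definition YA :: "(nat \<times> nat \<Rightarrow>\<^sub>0 'k::field) set"
  where "YA = {f \<in> carrier kH. vy dvd f}"

lemma primeideal_YA: "primeideal YA kH"
  unfolding YA_def using prime_elem_vy vy_not_dvd_vx by (rule prime_dvd_ideal)

lemma YA_psubset_XA: "YA \<subset> XA"
proof
  show "YA \<subseteq> (XA :: (nat \<times> nat \<Rightarrow>\<^sub>0 'k::field) set)"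
  proof
    fix f :: "nat \<times> nat \<Rightarrow>\<^sub>0 'k" assume "f \<in> YA"
    then have f: "f \<in> carrier kH" "vy dvd f"
      by (simp_all add: YA_def)
    then have "lookup f (0, 0) = 0"
      by (metis dvdE lookup_vy_mult)
    then show "f \<in> XA"
      using f(1) unfolding carrier_kH XA_iff by (metis gr0I)
  qed
  show "YA \<noteq> (XA :: (nat \<times> nat \<Rightarrow>\<^sub>0 'k::field) set)"
    using vy_not_dvd_vx vx_mult_in(3) unfolding YA_def by blast
qed

lemma vxy_in_YA: "vx * vy \<in> YA"
  by (simp add: YA_def)

lemma vxy_neq_0: "vx * vy \<noteq> (0 :: nat \<times> nat \<Rightarrow>\<^sub>0 'k::field)"
proof -
  have "vy \<noteq> (0 :: nat \<times> nat \<Rightarrow>\<^sub>0 'k)"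
    using prime_elem_vy unfolding prime_elem_def by blast
  then show ?thesis
    using vx_neq_0 by (simp add: bipoly_mult_eq_0_iff)
qed

lemma primeideal_zero: "primeideal {0} kH"
  by (rule primeideal_kHI) (auto simp: bipoly_mult_eq_0_iff)

lemma primeideal_zero_mem: "primeideal P kH \<Longrightarrow> 0 \<in> P"
  using additive_subgroup.zero_closed[OF ideal.axioms(1)[OF primeideal.axioms(1)]] by fastforce

lemma prime_height_ge:
  assumes "\<And>i. i \<le> n \<Longrightarrow> primeideal (c i) R" "\<And>i. i < n \<Longrightarrow> c i \<subset> c (Suc i)" "c n = P"
  shows "enat n \<le> prime_height R P"
  unfolding prime_height_def using assms by (intro SUP_upper) blast

text \<open>
  Any prime that contains the maximal ideal is the end of the chain \<open>0 \<subset> yA \<inter> R \<subset> P\<close>, where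
  \<open>A = k[x, y]\<close> and \<open>R = k + xA\<close>.
\<close>

lemma height_XA: "2 \<le> height kH XA"
  unfolding height_def
proof (rule INF_greatest)
  fix P :: "(nat \<times> nat \<Rightarrow>\<^sub>0 'k::field) set"
  assume "P \<in> {P. primeideal P kH \<and> XA \<subseteq> P}"
  then have P: "primeideal P kH" "XA \<subseteq> P"
    by auto
  define c where "c = (\<lambda>i::nat. if i = 0 then {0} else if i = 1 then YA else P)"
  have "{0} \<subset> (YA :: (nat \<times> nat \<Rightarrow>\<^sub>0 'k) set)"
    using vxy_in_YA vxy_neq_0 primeideal_zero_mem[OF primeideal_YA] by blast
  moreover have "YA \<subset> P"
    using YA_psubset_XA P(2) by blast
  ultimately have "c i \<subset> c (Suc i)" if "i < 2" for i
    using that by (auto simp: c_def less_Suc_eq numeral_2_eq_2)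
  then have "enat 2 \<le> prime_height kH P"
    by (intro prime_height_ge[of 2 c]) (auto simp: c_def primeideal_zero primeideal_YA P(1))
  then show "2 \<le> prime_height kH P"
    by (simp add: numeral_eq_enat)
qed

lemma not_cohen_macaulay_ideals: "\<not> cohen_macaulay_ideals (kH :: (nat \<times> nat \<Rightarrow>\<^sub>0 'k::field) ring)"
proof
  assume "cohen_macaulay_ideals (kH :: (nat \<times> nat \<Rightarrow>\<^sub>0 'k) ring)"
  then have "height kH (XA :: (nat \<times> nat \<Rightarrow>\<^sub>0 'k) set) = 1"
    using primeideal.axioms(1)[OF primeideal_XA] polynomial_grade_XA
    unfolding cohen_macaulay_ideals_def by metis
  then show False
    using height_XA by (metis numeral_le_one_iff semiring_norm(69))
qed

text \<open>
  The principal ideal \<open>I = (xy)\<close> has height at least 1. Modulo \<open>I\<close>, the element \<open>x y\<^sup>2\<close> is annihilated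
  exactly by the maximal ideal: \<open>xh \<cdot> x y\<^sup>2 = (xhy) xy\<close>, and \<open>a x y\<^sup>2 \<in> I\<close> forces \<open>ay\<close> to be in the ring,
  hence \<open>a\<close> to have constant term 0. So the maximal ideal is weakly associated to the quotient by \<open>I\<close>,
  while the prime \<open>YA\<close> lies strictly between them.
\<close>

lemma not_weak_bourbaki_unmixed: "\<not> weak_bourbaki_unmixed (kH :: (nat \<times> nat \<Rightarrow>\<^sub>0 'k::field) ring)"
proof
  let ?R = "kH :: (nat \<times> nat \<Rightarrow>\<^sub>0 'k) ring"
  let ?z = "vx * vy :: nat \<times> nat \<Rightarrow>\<^sub>0 'k"
  define I where "I = Idl\<^bsub>?R\<^esub> {?z}"
  assume unmixed: "weak_bourbaki_unmixed ?R"
  have z: "?z \<in> carrier ?R"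
    by simp
  have I: "ideal I ?R"
    unfolding I_def using z by (intro kH.genideal_ideal) simp
  have I_eq: "I = {h * ?z | h. h \<in> carrier ?R}"
    unfolding I_def using kH.cgenideal_eq_genideal[OF z] by (simp add: cgenideal_def)
  have zI: "?z \<in> I"
    unfolding I_def using kH.genideal_self'[OF z] .
  have "min_generators ?R I \<le> enat (card {?z})"
    unfolding min_generators_def I_def using z by (intro INF_lower) simp
  also have "\<dots> \<le> height ?R I"
    unfolding height_def
  proof (rule INF_greatest)
    fix P assume "P \<in> {P. primeideal P ?R \<and> I \<subseteq> P}"
    then have P: "primeideal P ?R" "I \<subseteq> P"
      by auto
    have "{0} \<subset> P"
      using P(2) zI vxy_neq_0 primeideal_zero_mem[OF P(1)] by blast
    then have "enat 1 \<le> prime_height ?R P"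
      by (intro prime_height_ge[of 1 "\<lambda>i. if i = 0 then {0} else P"]) (auto simp: primeideal_zero P(1))
    then show "enat (card {?z}) \<le> prime_height ?R P"
      by simp
  qed
  finally have "min_generators ?R I \<le> height ?R I" .
  moreover have "finitely_generated_ideal ?R I"
    unfolding finitely_generated_ideal_def I_def using z by (intro exI[of _ "{?z}"]) simp
  ultimately have sub: "weakly_associated_primes ?R (quotient_module (self_module ?R) I) \<subseteq> minimal_primes ?R I"
    using unmixed I unfolding weak_bourbaki_unmixed_def by blast
  let ?w = "?z * vy"
  have w: "?w \<in> carrier ?R"
    by (simp add: mult.assoc)
  have "{a \<in> carrier ?R. a \<otimes>\<^bsub>?R\<^esub> ?w \<in> I} = XA"
  proof (intro equalityI subsetI)
    fix a :: "nat \<times> nat \<Rightarrow>\<^sub>0 'k" assume "a \<in> XA"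
    then obtain h where h: "a = vx * h"
      unfolding XA_def by blast
    have "a * ?w = (vx * (h * vy)) * ?z"
      by (simp add: h mult_ac)
    then have "a * ?w \<in> I"
      unfolding I_eq using vx_mult_in(2) by blast
    then show "a \<in> {a \<in> carrier ?R. a \<otimes>\<^bsub>?R\<^esub> ?w \<in> I}"
      using \<open>a \<in> XA\<close> XA_subset by auto
  next
    fix a :: "nat \<times> nat \<Rightarrow>\<^sub>0 'k" assume "a \<in> {a \<in> carrier ?R. a \<otimes>\<^bsub>?R\<^esub> ?w \<in> I}"
    then obtain h where a: "a \<in> carrier ?R" and h: "h \<in> carrier ?R" "a * ?w = h * ?z"
      unfolding I_eq by auto
    have "?z * (a * vy) = ?z * h"
      using h(2) by (simp only: mult_ac)
    then have "a * vy = h"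
      using bipoly_mult_cancel vxy_neq_0 by blast
    then have "lookup (a * vy) (0, 1) = 0"
      using h(1) unfolding carrier_kH by simp
    then have "lookup a (0, 0) = 0"
      by (simp add: lookup_mult_kH[OF a] vy_def)
    then show "a \<in> XA"
      using a unfolding carrier_kH XA_iff by (metis gr0I)
  qed
  then have ann: "annihilator ?R (quotient_module (self_module ?R) I) (I +>\<^bsub>?R\<^esub> ?w) = XA"
    using kH.annihilator_quotient[OF I w] by simp
  have "XA \<in> minimal_primes ?R XA"
    unfolding minimal_primes_def using primeideal_XA by blast
  moreover have "I +>\<^bsub>?R\<^esub> ?w \<in> carrier (quotient_module (self_module ?R) I)"
    unfolding kH.carrier_quotient_self_module[OF I] using w by (rule imageI)
  ultimately have "XA \<in> weakly_associated_primes ?R (quotient_module (self_module ?R) I)"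
    unfolding weakly_associated_primes_def using ann by (metis UN_I)
  then have "XA \<in> minimal_primes ?R I"
    using sub by blast
  moreover have "I \<subseteq> YA"
    unfolding I_def using vxy_in_YA primeideal.axioms(1)[OF primeideal_YA]
    by (intro kH.genideal_minimal) auto
  ultimately have "YA = (XA :: (nat \<times> nat \<Rightarrow>\<^sub>0 'k) set)"
    using primeideal_YA YA_psubset_XA unfolding minimal_primes_def by blast
  then show False
    using YA_psubset_XA by blast
qed

section \<open>Strong parameter sequences\<close>

lemma parameter_seq_closed: "parameter_seq R xs \<Longrightarrow> x \<in> set xs \<Longrightarrow> x \<in> carrier R"
  unfolding parameter_seq_def by blast

text \<open>
  The vanishing criterion for this ring, with the products and sums of the record written as
  those of the ambient polynomial type.
\<close>

lemma not_parameter_seq_kH: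
  assumes "xs \<noteq> []" "primeideal P kH" "set xs \<subseteq> P"
    and kill: "\<And>n. \<exists>(N::nat) u cs. u \<in> carrier kH - P \<and> length cs = length xs \<and> set cs \<subseteq> carrier kH \<and>
      u * prod_list xs ^ N = (\<Sum>i<length xs. cs ! i * (xs ! i) ^ (n + N))"
  shows "\<not> parameter_seq kH xs"
proof (rule kH.not_parameter_seq[OF assms(1-3)])
  fix n :: nat
  obtain N u cs where *: "u \<in> carrier kH - P" "length cs = length xs" "set cs \<subseteq> carrier kH"
    "u * prod_list xs ^ N = (\<Sum>i<length xs. cs ! i * (xs ! i) ^ (n + N))"
    using kill[of n] by (elim exE conjE)
  have sub: "P \<subseteq> carrier kH"
    using ideal.Icarr[OF primeideal.axioms(1)[OF assms(2)]] by blast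
  have xs: "xs ! i \<in> carrier kH" if "i < length xs" for i
    using that assms(3) sub nth_mem[of i xs] by blast
  have cs: "cs ! i \<in> carrier kH" if "i < length xs" for i
    using that *(2,3) nth_mem[of i cs] by auto
  have pow: "(xs ! i) ^ k \<in> carrier kH" if "i < length xs" for i k
    using kH.nat_pow_closed[OF xs[OF that], of k] by simp
  have "finprod kH (\<lambda>i. xs ! i) {..<length xs} = (\<Prod>i<length xs. xs ! i)"
    using xs by (intro finprod_kH) auto
  also have "\<dots> = prod_list xs"
    by (simp add: prod.list_conv_set_nth atLeast0LessThan)
  finally have prod: "finprod kH (\<lambda>i. xs ! i) {..<length xs} = prod_list xs" .
  have sum: "finsum kH (\<lambda>i. cs ! i \<otimes>\<^bsub>kH\<^esub> (xs ! i) [^]\<^bsub>kH\<^esub> (n + N)) {..<length xs} =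
      (\<Sum>i<length xs. cs ! i * (xs ! i) ^ (n + N))"
    unfolding kH_simps pow_kH using cs pow by (intro finsum_kH) (auto intro!: kH_closed(2))
  show "\<exists>N u c. u \<in> carrier kH - P \<and> c \<in> {..<length xs} \<rightarrow> carrier kH \<and>
      u \<otimes>\<^bsub>kH\<^esub> (finprod kH (\<lambda>i. xs ! i) {..<length xs}) [^]\<^bsub>kH\<^esub> N =
        finsum kH (\<lambda>i. c i \<otimes>\<^bsub>kH\<^esub> (xs ! i) [^]\<^bsub>kH\<^esub> (n + N)) {..<length xs}"
    unfolding prod using *(1,4) cs sum
    by (intro exI[of _ N] exI[of _ u] exI[of _ "\<lambda>i. cs ! i"] conjI) (simp_all add: Pi_iff)
qed

lemma parameter_neq_0:
  assumes "parameter_seq kH [f]"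
  shows "f \<noteq> 0"
proof
  assume "f = 0"
  have "\<not> parameter_seq kH [0 :: nat \<times> nat \<Rightarrow>\<^sub>0 'a]"
  proof (rule not_parameter_seq_kH)
    fix n :: nat
    show "\<exists>(N::nat) u cs. u \<in> carrier kH - {0 :: nat \<times> nat \<Rightarrow>\<^sub>0 'a} \<and> length cs = length [0 :: nat \<times> nat \<Rightarrow>\<^sub>0 'a] \<and>
      set cs \<subseteq> carrier kH \<and> u * prod_list [0] ^ N = (\<Sum>i<length [0 :: nat \<times> nat \<Rightarrow>\<^sub>0 'a]. cs ! i * ([0] ! i) ^ (n + N))"
      by (rule exI[of _ 1], rule exI[of _ 1], rule exI[of _ "[0]"]) simp
  qed (auto simp: primeideal_zero)
  then show False
    using assms \<open>f = 0\<close> by simp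
qed

text \<open>
  At the maximal ideal the pair is, up to radical, generated by its greatest common divisor, so there
  is no second cohomology.
\<close>

lemma parameter_pair_not_in_XA:
  assumes "f \<noteq> 0" "parameter_seq kH [f, g]"
  shows "f \<notin> XA \<or> g \<notin> XA"
proof (rule ccontr)
  assume "\<not> ?thesis"
  then obtain f' g' where fg: "f = vx * f'" "g = vx * g'"
    unfolding XA_def by blast
  have "f' \<noteq> 0"
    using assms(1) fg by auto
  have "\<not> parameter_seq kH [f, g]"
  proof (rule not_parameter_seq_kH[OF _ primeideal_XA])
    show "set [f, g] \<subseteq> XA"
      by (simp add: fg)
    fix n :: nat
    obtain N u p q where u: "lookup u (0, 0) \<noteq> 0" "\<forall>b>0. lookup u (0, b) = 0"
      "u * (f * g) ^ N = vx * p * f ^ (n + N) + vx * q * g ^ (n + N)"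
      using bipoly_top_class_killed[OF \<open>f' \<noteq> 0\<close>, of g' n] unfolding fg vx_def by metis
    have "u \<in> carrier kH - XA"
      using u(1,2) by (auto simp: carrier_kH XA_iff)
    then show "\<exists>(N::nat) u cs. u \<in> carrier kH - XA \<and> length cs = length [f, g] \<and> set cs \<subseteq> carrier kH \<and>
      u * prod_list [f, g] ^ N = (\<Sum>i<length [f, g]. cs ! i * ([f, g] ! i) ^ (n + N))"
      using u(3)
      by (intro exI[of _ N] exI[of _ u] exI[of _ "[vx * p, vx * q]"]) (simp add: lessThan_Suc add.commute)
  qed simp
  with assms(2) show False
    by blast
qed

text \<open>
  If \<open>c\<close> divides \<open>x\<close>, the pair lies in the maximal ideal, which is already excluded. Otherwise \<open>cA \<inter> R\<close> is
  a prime containing the pair, where \<open>A = k[x, y]\<close> and \<open>R = k + xA\<close>. Writing \<open>f = c\<^sup>i f'\<close> with \<open>c\<close> prime to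
  \<open>f'\<close> and \<open>g = cg'\<close>, the identity \<open>f' g\<^sup>i = f g'\<^sup>i\<close> makes \<open>g\<^sup>i\<close> a multiple of \<open>f\<close> near that prime.
\<close>

lemma parameter_pair_coprime:
  assumes "f \<noteq> 0" and param: "parameter_seq kH [f, g]" and c: "prime_elem c" "c dvd f"
  shows "\<not> c dvd g"
proof
  assume "c dvd g"
  have fg: "f \<in> carrier kH" "g \<in> carrier kH"
    using parameter_seq_closed[OF param] by simp_all
  have "\<not> c dvd vx"
  proof
    assume "c dvd vx"
    then obtain d where d: "vx = c * d"
      by (elim dvdE)
    have "\<not> vx dvd d"
    proof
      assume "vx dvd d"
      then obtain e where "d = vx * e"
        by (elim dvdE)
      with d have "vx * 1 = vx * (c * e)"
        by (simp add: mult_ac)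
      then have "1 = c * e"
        using bipoly_mult_cancel vx_neq_0 by blast
      then show False
        using c(1) unfolding prime_elem_def by (metis dvd_triv_left)
    qed
    then have "vx dvd c"
      using prime_elem_dvd_multD[OF prime_elem_vx, of c d] d by (metis dvd_refl)
    then have "f \<in> XA" "g \<in> XA"
      using c(2) \<open>c dvd g\<close> dvd_trans XA_iff_dvd by blast+
    then show False
      using parameter_pair_not_in_XA[OF assms(1) param] by blast
  qed
  let ?P = "{r \<in> carrier kH. c dvd r}"
  obtain i f' where f': "f = c ^ i * f'" "\<not> c dvd f'"
    using bipoly_split_off_prime_power[OF c(1) assms(1)] by blast
  obtain g' where g': "g = c * g'"
    using \<open>c dvd g\<close> by (elim dvdE)
  have key: "f' * g ^ i = f * g' ^ i"
    unfolding f'(1) g' by (simp add: power_mult_distrib mult_ac)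
  have "\<not> parameter_seq kH [f, g]"
  proof (rule not_parameter_seq_kH[OF _ prime_dvd_ideal[OF c(1) \<open>\<not> c dvd vx\<close>]])
    show "set [f, g] \<subseteq> ?P"
      using fg c(2) \<open>c dvd g\<close> by simp
    fix n :: nat
    let ?N = "i * n"
    have "(f' * g ^ i) ^ n = (f * g' ^ i) ^ n"
      by (simp only: key)
    then have e: "f' ^ n * g ^ ?N = f ^ n * g' ^ ?N"
      by (simp add: power_mult_distrib power_mult)
    have "vx * f' ^ n * (f * g) ^ ?N = vx * f ^ ?N * (f' ^ n * g ^ ?N)"
      by (simp add: power_mult_distrib mult_ac)
    also have "\<dots> = vx * g' ^ ?N * f ^ (n + ?N)"
      unfolding e by (simp add: power_add mult_ac)
    finally have "vx * f' ^ n * (f * g) ^ ?N = vx * g' ^ ?N * f ^ (n + ?N)" .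
    moreover have "vx * f' ^ n \<in> carrier kH - ?P"
      using prime_elem_dvd_multD[OF c(1)] prime_elem_dvd_power[OF c(1)] \<open>\<not> c dvd vx\<close> f'(2) by blast
    ultimately show "\<exists>(N::nat) u cs. u \<in> carrier kH - ?P \<and> length cs = length [f, g] \<and> set cs \<subseteq> carrier kH \<and>
      u * prod_list [f, g] ^ N = (\<Sum>i<length [f, g]. cs ! i * ([f, g] ! i) ^ (n + N))"
      by (intro exI[of _ ?N] exI[of _ "vx * f' ^ n"] exI[of _ "[vx * g' ^ ?N, 0]"]) (simp add: lessThan_Suc)
  qed simp
  with param show False
    by blast
qed

text \<open>
  A prime \<open>P\<close> containing \<open>f, g, h\<close> does not contain \<open>x\<close>, because \<open>f\<close> and \<open>g\<close> are not both in the maximal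
  ideal. The relation \<open>h\<^sup>e (1 + hc) \<in> (f, g)\<close> of \<open>k[x, y]\<close>, multiplied by \<open>x\<^sup>2\<close>, becomes a relation over
  the ring whose factor \<open>s = x\<^sup>2 (1 + hc)\<close> is outside \<open>P\<close>.
\<close>

lemma no_parameter_triple:
  assumes "f \<noteq> 0" and coprime: "\<And>c. prime_elem c \<Longrightarrow> c dvd f \<Longrightarrow> \<not> c dvd g"
    and XA: "f \<notin> XA \<or> g \<notin> XA"
  shows "\<not> parameter_seq kH [f, g, h]"
proof
  assume param: "parameter_seq kH [f, g, h]"
  have fgh: "f \<in> carrier kH" "g \<in> carrier kH" "h \<in> carrier kH"
    using parameter_seq_closed[OF param] by simp_all
  have "ideal (Idl\<^bsub>kH\<^esub> (set [f, g, h])) kH" "Idl\<^bsub>kH\<^esub> (set [f, g, h]) \<noteq> carrier kH"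
    using fgh param unfolding parameter_seq_def by (auto intro: kH.genideal_ideal)
  then obtain P where P: "primeideal P kH" "Idl\<^bsub>kH\<^esub> (set [f, g, h]) \<subseteq> P"
    using kH.exists_prime_containing by blast
  then have sub: "set [f, g, h] \<subseteq> P"
    using kH.genideal_self[of "set [f, g, h]"] fgh by auto
  have "vx \<notin> P"
    using prime_containing_vx[OF P(1)] XA sub by auto
  obtain e c p q where fit: "h ^ e * (1 + h * c) = p * f + q * g"
    using coprime_fitting[OF assms(1) coprime] by blast
  define s where "s = vx * vx * (1 + h * c)"
  have s: "s \<in> carrier kH - P"
    unfolding s_def using not_in_prime_shift[OF P(1) \<open>vx \<notin> P\<close>] sub by simp
  have hs: "h ^ e * s = (vx * vx * p) * f + (vx * vx * q) * g"
    using arg_cong[OF fit, of "\<lambda>t. vx * vx * t"] by (simp add: s_def algebra_simps)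
  interpret P: primeideal P kH
    by (rule P(1))
  have prime_mult: "a * b \<in> carrier kH - P" if "a \<in> carrier kH - P" "b \<in> carrier kH - P" for a b
    using that P.I_prime[of a b] kH_closed(2)[of a b] by auto
  have prime_pow: "a ^ n \<in> carrier kH - P" if "a \<in> carrier kH - P" for a n
  proof (induction n)
    case 0
    have "(1 :: nat \<times> nat \<Rightarrow>\<^sub>0 'a) \<notin> P"
      using P.one_imp_carrier P.I_notcarr by auto
    then show ?case
      by simp
  next
    case (Suc n)
    then show ?case
      unfolding power_Suc by (rule prime_mult[OF that])
  qed
  have "\<not> parameter_seq kH [f, g, h]"
  proof (rule not_parameter_seq_kH[OF _ P(1) sub])
    fix n :: nat
    obtain p' q' where pq: "(h ^ e * s) ^ (n + n) = p' * f ^ n + q' * g ^ n"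
      using power_add_combination[of "vx * vx * p" f "vx * vx * q" g n n] unfolding hs by blast
    \<comment> \<open>the power of h produced by the (2n)-th power of the relation\<close>
    let ?N = "e * (n + n)"
    let ?u = "vx * s ^ (n + n)"
    have "?u * (f * (g * h)) ^ ?N = vx * f ^ ?N * g ^ ?N * (h ^ e * s) ^ (n + n)"
      by (simp add: power_mult_distrib power_mult mult_ac)
    also have "\<dots> = vx * (p' * g ^ ?N) * f ^ (n + ?N) + vx * (q' * f ^ ?N) * g ^ (n + ?N)"
      unfolding pq by (simp add: power_add algebra_simps)
    finally have "?u * (f * (g * h)) ^ ?N = vx * (p' * g ^ ?N) * f ^ (n + ?N) + vx * (q' * f ^ ?N) * g ^ (n + ?N)" .
    moreover have "?u \<in> carrier kH - P"
      using \<open>vx \<notin> P\<close> by (intro prime_mult prime_pow s) simp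
    ultimately show "\<exists>(N::nat) u cs. u \<in> carrier kH - P \<and> length cs = length [f, g, h] \<and> set cs \<subseteq> carrier kH \<and>
      u * prod_list [f, g, h] ^ N = (\<Sum>i<length [f, g, h]. cs ! i * ([f, g, h] ! i) ^ (n + N))"
      by (intro exI[of _ ?N] exI[of _ ?u] exI[of _ "[vx * (p' * g ^ ?N), vx * (q' * f ^ ?N), 0]"])
        (simp add: lessThan_Suc add.commute)
  qed simp
  with param show False
    by blast
qed

text \<open>
  From \<open>gz \<in> (f)\<close> unique factorization gives \<open>z = fc\<close> with \<open>c\<close> in \<open>k[x, y]\<close>. Since both \<open>fc\<close> and \<open>gc\<close>
  are in the ring and one of \<open>f, g\<close> is outside the maximal ideal, \<open>c\<close> is in the ring too.
\<close>

lemma coprime_pair_regular: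
  assumes fg: "f \<in> carrier kH" "g \<in> carrier kH" and "f \<noteq> 0"
    and coprime: "\<And>c. prime_elem c \<Longrightarrow> c dvd f \<Longrightarrow> \<not> c dvd g"
    and XA: "f \<notin> XA \<or> g \<notin> XA"
    and z: "z \<in> carrier kH" "g * z \<in> Idl\<^bsub>kH\<^esub> {f}"
  shows "z \<in> Idl\<^bsub>kH\<^esub> {f}"
proof -
  have Idl: "Idl\<^bsub>kH\<^esub> {f} = {h * f | h. h \<in> carrier kH}"
    using kH.cgenideal_eq_genideal[OF fg(1)] by (simp add: cgenideal_def)
  obtain h where h: "h \<in> carrier kH" "g * z = h * f"
    using z(2) unfolding Idl by blast
  then have "f dvd g * z"
    by simp
  then have "f dvd z"
    using bipoly_coprime_dvd_mult_cancel[OF \<open>f \<noteq> 0\<close> coprime] by blast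
  then obtain c where c: "z = f * c"
    by (elim dvdE)
  have "f * (g * c) = f * h"
    using h(2) by (simp add: c mult_ac)
  then have "g * c = h"
    using bipoly_mult_cancel \<open>f \<noteq> 0\<close> by blast
  then have "c \<in> carrier kH"
    using XA cofactor_in_kH[OF fg(1), of c] cofactor_in_kH[OF fg(2), of c] h(1) z(1) c by auto
  then show ?thesis
    unfolding Idl using c by (auto simp: mult.commute)
qed

lemma cohen_macaulay_HM: "cohen_macaulay_hamilton_marley (kH :: (nat \<times> nat \<Rightarrow>\<^sub>0 'k::field) ring)"
  unfolding cohen_macaulay_hamilton_marley_def
proof (intro allI impI)
  let ?R = "kH :: (nat \<times> nat \<Rightarrow>\<^sub>0 'k) ring"
  fix xs assume strong: "strong_parameter_seq ?R xs"
  then have xs: "set xs \<subseteq> carrier ?R"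
    and param: "\<And>i. 1 \<le> i \<Longrightarrow> i \<le> length xs \<Longrightarrow> parameter_seq ?R (take i xs)"
    unfolding strong_parameter_seq_def by blast+
  have one: "xs ! 0 \<noteq> 0" if "1 \<le> length xs"
    using param[of 1] that parameter_neq_0[of "xs ! 0"] by (cases xs) auto
  have take2: "take 2 xs = [xs ! 0, xs ! 1]" if "2 \<le> length xs"
    using that by (cases xs; cases "tl xs") (auto simp: numeral_2_eq_2)
  have two: "parameter_seq ?R [xs ! 0, xs ! 1]" if "2 \<le> length xs"
    using param[of 2] that take2 by simp
  have len: "length xs \<le> 2"
  proof (rule ccontr)
    assume "\<not> length xs \<le> 2"
    then have l: "3 \<le> length xs" "2 \<le> length xs" "1 \<le> length xs"
      by auto
    then have "take 3 xs = [xs ! 0, xs ! 1, xs ! 2]"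
      by (cases xs; cases "tl xs"; cases "tl (tl xs)") (auto simp: numeral_3_eq_3 numeral_2_eq_2)
    then have "parameter_seq ?R [xs ! 0, xs ! 1, xs ! 2]"
      using param[of 3] l(1) by simp
    then show False
      using no_parameter_triple[OF one[OF l(3)] parameter_pair_coprime[OF one[OF l(3)] two[OF l(2)]]
        parameter_pair_not_in_XA[OF one[OF l(3)] two[OF l(2)]]] by blast
  qed
  have "weak_regular_seq ?R (self_module ?R) xs"
    unfolding kH.weak_regular_seq_self_iff
  proof (intro conjI xs allI impI ballI)
    fix i z
    assume i: "i < length xs" and z: "z \<in> carrier ?R" "xs ! i \<otimes>\<^bsub>?R\<^esub> z \<in> Idl\<^bsub>?R\<^esub> (set (take i xs))"
    show "z \<in> Idl\<^bsub>?R\<^esub> (set (take i xs))"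
    proof (cases i)
      case 0
      then have "xs ! 0 * z = 0"
        using z(2) by (simp add: kH.genideal_empty)
      then have "z = 0"
        using one i 0 by (simp add: bipoly_mult_eq_0_iff)
      then show ?thesis
        using 0 by (simp add: kH.genideal_empty)
    next
      case (Suc j)
      then have i1: "i = 1" and l: "2 \<le> length xs" "1 \<le> length xs"
        using i len by auto
      have t: "set (take 1 xs) = {xs ! 0}"
        using l by (cases xs) auto
      have "xs ! 0 \<in> carrier ?R" "xs ! 1 \<in> carrier ?R"
        using l by (auto intro!: subsetD[OF xs] nth_mem)
      then show ?thesis
        using coprime_pair_regular[OF _ _ one[OF l(2)] parameter_pair_coprime[OF one[OF l(2)] two[OF l(1)]]
          parameter_pair_not_in_XA[OF one[OF l(2)] two[OF l(1)]] z(1)] z(2)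
        unfolding i1 t by simp
    qed
  qed
  moreover have "Idl\<^bsub>?R\<^esub> (set xs) \<noteq> carrier ?R"
  proof (cases "xs = []")
    case True
    have "(1 :: nat \<times> nat \<Rightarrow>\<^sub>0 'k) \<in> carrier ?R"
      by simp
    moreover have "1 \<notin> Idl\<^bsub>?R\<^esub> (set xs)"
      using True by (simp add: kH.genideal_empty)
    ultimately show ?thesis
      by metis
  next
    case False
    then show ?thesis
      using param[of "length xs"] unfolding parameter_seq_def by (cases xs) auto
  qed
  ultimately show "regular_seq ?R (self_module ?R) xs"
    unfolding regular_seq_def using kH.ideal_smult_self_module[OF kH.genideal_ideal[OF xs]] by simp
qed

theorem theorem4p10:
  fixes kH :: "((nat \<times> nat) \<Rightarrow>\<^sub>0 'k::field) ring"
  assumes "kH = monoid_ring H_monoid"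
  shows "\<not> cohen_macaulay_ideals kH \<and>
         \<not> weak_bourbaki_unmixed kH \<and>
         cohen_macaulay_hamilton_marley kH"
  unfolding assms using not_cohen_macaulay_ideals not_weak_bourbaki_unmixed cohen_macaulay_HM by blast

end
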